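(* Let $N\ge 2$ and let $S\subset\mathbb{R}^{N+1}$ be a smooth hypersurface enclosing a compact strictly convex domain $U_S$. Consider the billiard dynamics inside $U_S$. For each prime number $p$ at least one of the following two statements is satisfied: (A) there is some $n\in\mathbb{N}$ such that infinitely many periodic billiard trajectories bounce $p^{n}$ times; (B) there is a sequence $\{\gamma_\alpha \mid \alpha\in\mathbb{N}\}$ of (pairwise) geometrically distinct periodic billiard trajectories such that: (i) each $\gamma_\alpha$ bounces $p^{n_\alpha}$ times for some $n_\alpha\in\mathbb{N}$; (ii) each $\gamma_\alpha$ has Morse coindex less than or equal to $N$ and it is not a local maximum for the length functional $\mathcal{L}^{p^{n_\alpha}}$.
   Context: $\mathbb{N}=\{1,2,3,\dots\}$. Strict convexity means that the second fundamental form of $S=\partial U_S$ is everywhere positive definite (so $S$ is diffeomorphic to the sphere $S^N$). A curve in $U_S$ is a billiard trajectory if it is piecewise straight with constant speed and, at the instants when it hits $S$, it bounces by the usual reflection law (the normal component of the velocity changes sign, the tangential one is preserved). It is periodic with period $T>0$ if it is a curve of the form $\gamma:\mathbb{R}/T\mathbb{Z}\to U_S$ ($T$ is not required to be the minimal period). For $n\in\mathbb{N}$ the cyclic configuration space is $\mathrm{C}^n(S)=\{q=(q_0,\dots,q_{n-1})\in S^{\times n} \mid q_j\neq q_{j+1}\ \forall j\in\mathbb{Z}_n\}$, an open subset of $S^{\times n}$ (indices modulo $n$). The length functional is $\mathcal{L}^n(q)=\sum_{j\in\mathbb{Z}_n}|q_{j+1}-q_j|$; it is smooth on $\mathrm{C}^n(S)$.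 For $q\in \mathrm{C}^n(S)$ let $\gamma_q$ be the closed polygonal curve, with prescribed speed, that bounces periodically at $q_0,\dots,q_{n-1}$. Then $q$ is a critical point of $\mathcal{L}^n|_{\mathrm{C}^n(S)}$ if and only if $\gamma_q$ is a periodic billiard trajectory, and one says that $\gamma_q$ bounces $n$ times. The dihedral group $\mathbb{D}_n$ acts on $\mathrm{C}^n(S)$ by permuting the coordinates (as a group of permutations of $\mathbb{Z}_n$), leaving $\mathcal{L}^n$ invariant; points in the same $\mathbb{D}_n$-orbit are associated with the same geometric closed curve. Periodic billiard trajectories are counted as geometric closed curves. Two periodic billiard trajectories, with bounce sequences $q\in \mathrm{C}^n(S)$ and $q'\in \mathrm{C}^{n'}(S)$, are geometrically distinct if they are not iterates of the same closed curve, i.e. if for no $m,m'\in\mathbb{N}$ with $nm=n'm'$ do the iterated sequences $(q,\dots,q)$ ($m$ times) and $(q',\dots,q')$ ($m'$ times) lie in the same $\mathbb{D}_{nm}$-orbit. The Morse coindex of a trajectory $\gamma_q$ with $q\in \mathrm{C}^n(S)$ critical for $\mathcal{L}^n$ is the dimension of the positive eigenspace of the Hessian of $\mathcal{L}^n$ at $q$; "$\gamma_q$ is a local maximum for $\mathcal{L}^n$" means that $q$ is a local maximum of $\mathcal{L}^n$. *)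

theory Defs
  imports
    "HOL-Analysis.Analysis"
    "HOL-Computational_Algebra.Primes"
    "HOL-Library.Function_Algebras"
begin

section \<open>Smooth hypersurfaces and strictly convex domains\<close>

text \<open>Used for open \<^term>\<open>V\<close> only; on finite-dimensional spaces this is the usual class
  $C^k$, since the \<open>C_k_on (Suc k)\<close> clause asks all directional derivatives to be $C^k$.\<close>

primrec C_k_on :: "nat \<Rightarrow> 'a::real_normed_vector set \<Rightarrow> ('a \<Rightarrow> 'b::real_normed_vector) \<Rightarrow> bool" where
  "C_k_on 0 V f = continuous_on V f"
| "C_k_on (Suc k) V f =
    ((\<forall>x\<in>V. f differentiable (at x)) \<and> (\<forall>v. C_k_on k V (\<lambda>x. frechet_derivative f (at x) v)))"

definition smooth_on :: "'a::real_normed_vector set \<Rightarrow> ('a \<Rightarrow> 'b::real_normed_vector) \<Rightarrow> bool" where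
  "smooth_on V f \<longleftrightarrow> (\<forall>k. C_k_on k V f)"

definition smooth_hypersurface :: "'a::euclidean_space set \<Rightarrow> bool" where
  "smooth_hypersurface S \<longleftrightarrow>
    (\<forall>x\<in>S. \<exists>V (f :: 'a \<Rightarrow> real). open V \<and> x \<in> V \<and> smooth_on V f \<and>
       S \<inter> V = {y \<in> V. f y = 0} \<and> (\<forall>y \<in> S \<inter> V. frechet_derivative f (at y) \<noteq> (\<lambda>v. 0)))"

definition tangent_space :: "'a::euclidean_space set \<Rightarrow> 'a \<Rightarrow> 'a set" where
  "tangent_space S x = {v. \<exists>c :: real \<Rightarrow> 'a. \<exists>e>0. smooth_on {-e<..<e} c \<and> c ` {-e<..<e} \<subseteq> S \<and>
     c 0 = x \<and> (c has_vector_derivative v) (at 0)}"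

text \<open>\<open>U\<close> is a compact domain (the closure of a nonempty connected open set) with boundary \<open>S\<close>.\<close>

definition encloses :: "'a::euclidean_space set \<Rightarrow> 'a set \<Rightarrow> bool" where
  "encloses S U \<longleftrightarrow> compact U \<and> interior U \<noteq> {} \<and> connected (interior U) \<and>
     closure (interior U) = U \<and> frontier U = S"

definition outer_normal :: "'a::euclidean_space set \<Rightarrow> 'a \<Rightarrow> 'a" where
  "outer_normal U x = (THE \<nu>. norm \<nu> = 1 \<and> (\<forall>v \<in> tangent_space (frontier U) x. \<nu> \<bullet> v = 0) \<and>
     (\<exists>e>0. \<forall>t\<in>{0<..<e}. x + t *\<^sub>R \<nu> \<notin> U))"

text \<open>$\mathrm{II}_x(v,w) = \langle d\nu_x(v), w\rangle$ for the Gauss map $\nu$, to be applied to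
  tangent vectors only: the derivative of $\nu$ is taken within the hypersurface, so its values on
  tangent vectors (and only those) are determined. With the outer normal the
  unit sphere has $\mathrm{II}_x(v,v) = |v|^2$.\<close>

definition second_fundamental_form :: "'a::euclidean_space set \<Rightarrow> 'a \<Rightarrow> 'a \<Rightarrow> 'a \<Rightarrow> real" where
  "second_fundamental_form U x v w =
     frechet_derivative (outer_normal U) (at x within frontier U) v \<bullet> w"

definition strictly_convex :: "'a::euclidean_space set \<Rightarrow> bool" where
  "strictly_convex U \<longleftrightarrow>
    (\<forall>x \<in> frontier U. \<forall>v \<in> tangent_space (frontier U) x.
       v \<noteq> 0 \<longrightarrow> second_fundamental_form U x v v > 0)"


section \<open>Billiard trajectories\<close>

definition reflection_law :: "'a::real_inner \<Rightarrow> 'a \<Rightarrow> 'a \<Rightarrow> bool" where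
  "reflection_law \<nu> v v' \<longleftrightarrow>
     v' \<bullet> \<nu> = - (v \<bullet> \<nu>) \<and> v' - (v' \<bullet> \<nu>) *\<^sub>R \<nu> = v - (v \<bullet> \<nu>) *\<^sub>R \<nu>"

text \<open>Curves on $\mathbb{R}/T\mathbb{Z}$ are \<open>T\<close>-periodic curves on $\mathbb{R}$. At every time the
  curve is straight on both sides, with incoming velocity \<open>v\<close> and outgoing velocity \<open>v'\<close>.\<close>

definition periodic_billiard_trajectory ::
  "'a::euclidean_space set \<Rightarrow> real \<Rightarrow> (real \<Rightarrow> 'a) \<Rightarrow> bool" where
  "periodic_billiard_trajectory U T \<gamma> \<longleftrightarrow>
     T > 0 \<and> (\<forall>t. \<gamma> (t + T) = \<gamma> t) \<and> range \<gamma> \<subseteq> U \<and>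
     (\<exists>speed>0. \<forall>t. \<exists>v v' e. e > 0 \<and> norm v = speed \<and> norm v' = speed \<and>
        (\<forall>h\<in>{0..e}. \<gamma> (t - h) = \<gamma> t - h *\<^sub>R v) \<and>
        (\<forall>h\<in>{0..e}. \<gamma> (t + h) = \<gamma> t + h *\<^sub>R v') \<and>
        (if \<gamma> t \<in> frontier U then reflection_law (outer_normal U (\<gamma> t)) v v' else v' = v))"

text \<open>A configuration with \<open>n\<close> points is a function on \<open>{..<n}\<close>, extended by \<^const>\<open>undefined\<close>.\<close>

definition cyclic_config :: "nat \<Rightarrow> 'a set \<Rightarrow> (nat \<Rightarrow> 'a) set" where
  "cyclic_config n S = {q \<in> {..<n} \<rightarrow>\<^sub>E S. \<forall>j<n. q j \<noteq> q (Suc j mod n)}"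

text \<open>Within one period, which may start at any bounce, \<open>\<gamma>\<close> hits \<open>S\<close> exactly \<open>n\<close> times, namely
  at \<open>q 0, \<dots>, q (n - 1)\<close> in this order.\<close>

definition bounce_sequence ::
  "'a::euclidean_space set \<Rightarrow> real \<Rightarrow> (real \<Rightarrow> 'a) \<Rightarrow> nat \<Rightarrow> (nat \<Rightarrow> 'a) \<Rightarrow> bool" where
  "bounce_sequence S T \<gamma> n q \<longleftrightarrow> q \<in> cyclic_config n S \<and>
     (\<exists>t :: nat \<Rightarrow> real. strict_mono_on {..<n} t \<and>
        {s \<in> {t 0..<t 0 + T}. \<gamma> s \<in> S} = t ` {..<n} \<and> (\<forall>j<n. q j = \<gamma> (t j)))"

definition billiard_bounces ::
  "'a::euclidean_space set \<Rightarrow> 'a set \<Rightarrow> nat \<Rightarrow> (nat \<Rightarrow> 'a) set" where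
  "billiard_bounces S U n =
     {q. \<exists>T \<gamma>. periodic_billiard_trajectory U T \<gamma> \<and> bounce_sequence S T \<gamma> n q}"

text \<open>The dihedral group as a group of permutations of $\mathbb{Z}_n$, represented by
  \<open>{..<n}\<close>: the rotations $j \mapsto j + k$ and the reflections $j \mapsto k - j$.\<close>

definition dihedral_orbit :: "nat \<Rightarrow> (nat \<Rightarrow> 'a) \<Rightarrow> (nat \<Rightarrow> 'a) set" where
  "dihedral_orbit n q =
     {restrict (\<lambda>j. q ((k + j) mod n)) {..<n} | k. k < n} \<union>
     {restrict (\<lambda>j. q ((k + (n - j)) mod n)) {..<n} | k. k < n}"

definition iterated :: "nat \<Rightarrow> nat \<Rightarrow> (nat \<Rightarrow> 'a) \<Rightarrow> nat \<Rightarrow> 'a" where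
  "iterated m n q = restrict (\<lambda>j. q (j mod n)) {..<n * m}"

definition geometrically_distinct ::
  "nat \<Rightarrow> (nat \<Rightarrow> 'a) \<Rightarrow> nat \<Rightarrow> (nat \<Rightarrow> 'a) \<Rightarrow> bool" where
  "geometrically_distinct n q n' q' \<longleftrightarrow>
     \<not> (\<exists>m\<ge>1. \<exists>m'\<ge>1. n * m = n' * m' \<and>
          iterated m' n' q' \<in> dihedral_orbit (n * m) (iterated m n q))"


section \<open>The length functional and its Morse coindex\<close>

definition length_functional :: "nat \<Rightarrow> (nat \<Rightarrow> 'a::real_normed_vector) \<Rightarrow> real" where
  "length_functional n q = (\<Sum>j<n. norm (q (Suc j mod n) - q j))"

definition length_local_max :: "nat \<Rightarrow> 'a::euclidean_space set \<Rightarrow> (nat \<Rightarrow> 'a) \<Rightarrow> bool" where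
  "length_local_max n S q \<longleftrightarrow>
     (\<exists>e>0. \<forall>q' \<in> cyclic_config n S. (\<forall>j<n. dist (q' j) (q j) < e) \<longrightarrow>
        length_functional n q' \<le> length_functional n q)"

text \<open>Tangent vectors of the configuration space are functions vanishing outside \<open>{..<n}\<close>.\<close>

definition config_tangent_space ::
  "nat \<Rightarrow> 'a::euclidean_space set \<Rightarrow> (nat \<Rightarrow> 'a) \<Rightarrow> (nat \<Rightarrow> 'a) set" where
  "config_tangent_space n S q =
     {v. (\<forall>j<n. v j \<in> tangent_space S (q j)) \<and> (\<forall>j\<ge>n. v j = 0)}"

definition config_inner :: "nat \<Rightarrow> (nat \<Rightarrow> 'a::real_inner) \<Rightarrow> (nat \<Rightarrow> 'a) \<Rightarrow> real" where
  "config_inner n v w = (\<Sum>j<n. v j \<bullet> w j)"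

definition config_variation ::
  "nat \<Rightarrow> 'a::euclidean_space set \<Rightarrow> (nat \<Rightarrow> 'a) \<Rightarrow> (nat \<Rightarrow> 'a) \<Rightarrow> (nat \<Rightarrow> 'a) \<Rightarrow>
     (real \<times> real \<Rightarrow> nat \<Rightarrow> 'a) \<Rightarrow> bool" where
  "config_variation n S q v w \<sigma> \<longleftrightarrow>
     (\<exists>e>0. \<sigma> ` ball (0, 0) e \<subseteq> cyclic_config n S \<and>
            (\<forall>j<n. smooth_on (ball (0, 0) e) (\<lambda>z. \<sigma> z j))) \<and>
     \<sigma> (0, 0) = q \<and>
     (\<forall>j<n. ((\<lambda>s. \<sigma> (s, 0) j) has_vector_derivative v j) (at 0) \<and>
            ((\<lambda>t. \<sigma> (0, t) j) has_vector_derivative w j) (at 0))"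

text \<open>The Hessian at a critical point \<open>q\<close>, as a bilinear form on the tangent space: the mixed
  second derivative of the length along any two-parameter family in the configuration space
  with velocities \<open>v\<close> and \<open>w\<close>. At critical points the value does not depend on the family;
  elsewhere the definition is meaningless.\<close>

definition length_hessian ::
  "nat \<Rightarrow> 'a::euclidean_space set \<Rightarrow> (nat \<Rightarrow> 'a) \<Rightarrow> (nat \<Rightarrow> 'a) \<Rightarrow> (nat \<Rightarrow> 'a) \<Rightarrow> real" where
  "length_hessian n S q v w =
     (THE h. \<exists>\<sigma>. config_variation n S q v w \<sigma> \<and>
        h = deriv (\<lambda>s. deriv (\<lambda>t. length_functional n (\<sigma> (s, t))) 0) 0)"

definition config_scale :: "real \<Rightarrow> (nat \<Rightarrow> 'a::real_vector) \<Rightarrow> nat \<Rightarrow> 'a" where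
  "config_scale c v = (\<lambda>j. c *\<^sub>R v j)"

lemma vector_space_config: "vector_space (config_scale :: real \<Rightarrow> (nat \<Rightarrow> 'a::real_vector) \<Rightarrow> _)"
  by unfold_locales (auto simp: config_scale_def fun_eq_iff algebra_simps)

text \<open>Eigenvectors are those of the symmetric operator representing the Hessian with respect to
  the Riemannian metric induced from the Euclidean space.\<close>

definition positive_eigenvectors ::
  "nat \<Rightarrow> 'a::euclidean_space set \<Rightarrow> (nat \<Rightarrow> 'a) \<Rightarrow> (nat \<Rightarrow> 'a) set" where
  "positive_eigenvectors n S q =
     {v \<in> config_tangent_space n S q. \<exists>\<mu>>0. \<forall>w \<in> config_tangent_space n S q.
        length_hessian n S q v w = \<mu> * config_inner n v w}"

definition morse_coindex :: "nat \<Rightarrow> 'a::euclidean_space set \<Rightarrow> (nat \<Rightarrow> 'a) \<Rightarrow> nat" where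
  "morse_coindex n S q =
     vector_space.dim config_scale (module.span config_scale (positive_eigenvectors n S q))"

end

theory Submission
  imports Defs
begin

text \<open>Suppose that for every \<open>n = p ^ k\<close> only finitely many configurations are critical,
  and let \<open>D\<close> be the diameter of \<open>S\<close>. A maximum \<open>x\<close> of the length
  \<open>L\<close> on \<open>S ^ n\<close> and its cyclic shift \<open>x'\<close> are different, and they can be
  joined inside \<open>{L > (n - 5) D}\<close> by deforming both, one point at a time, into a configuration
  that oscillates along a diameter. The critical level \<open>c\<close> of this mountain pass contains a point
  which is neither a local maximum nor passable, where passable means that it does not locally
  obstruct paths in \<open>{L > c}\<close>. All points are passable except critical configurations of
  coindex at most 1: a noncritical configuration can be pushed upwards; if a point collides with its
  successor, then \<open>L\<close> grows in all directions of the tangent space, whose unit sphere is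
  connected since its dimension \<open>N\<close> is at least 2; with two positive eigenvectors
  \<open>L\<close> grows around a circle. So there is a critical configuration of coindex at most 1, not a
  local maximum, with \<open>(n - 5) D < L < n D\<close>. The averages \<open>L / n\<close> are invariant
  under iteration and under the dihedral group; they are less than \<open>D\<close> and tend to
  \<open>D\<close>, so along a subsequence they are strictly increasing and the trajectories are
  geometrically distinct.\<close>


subsection \<open>Calculus of smooth maps\<close>

text \<open>There is no space on which a gradient flow could be run: the product
  \<open>S ^ n\<close> is compact, but the length is not differentiable where neighbouring points
  collide, and the open set of cyclic configurations, where it is smooth, is not compact. So the
  mountain pass is found by separating closed sets in the compact product, with
  \<open>passable\<close> in the role of a deformation lemma, and collisions are treated as points
  from which the length can be increased. Finiteness of the critical set isolates each critical
  point from the others. Strict convexity is used as transversality of chords to \<open>S\<close>: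
  trajectories touch \<open>S\<close> only at their bounces, multipliers do not vanish, and at a
  collision the edge arriving from the other neighbour loses length at a smaller rate than the
  collapsed edge gains. The constant 5: a maximum has length at least \<open>(n - 1) * D\<close>, a
  deformation may lose three edges, and one more \<open>D\<close> makes the bound strict. For
  \<open>n \<ge> 5\<close> this level is nonnegative, so constant configurations, where all edges
  are collapsed, stay below the pass.\<close>

lemma C_k_on_cong:
  assumes "open V" "\<And>x. x \<in> V \<Longrightarrow> f x = g x" "C_k_on k V f"
  shows "C_k_on k V g"
  using assms(2,3)
proof (induction k arbitrary: f g)
  case 0
  then show ?case by (metis C_k_on.simps(1) continuous_on_cong)
next
  case (Suc k)
  note f = Suc.prems(2)[unfolded C_k_on.simps]
  have eq: "frechet_derivative f (at x) = frechet_derivative g (at x)" if "x \<in> V" for x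
    by (rule frechet_derivative_transform_within_open[OF _ \<open>open V\<close> that Suc.prems(1)]) (use f that in blast)+
  have "g differentiable at x" if "x \<in> V" for x
    using f that \<open>open V\<close> Suc.prems(1) unfolding differentiable_def
    by (meson has_derivative_transform_within_open)
  moreover have "C_k_on k V (\<lambda>x. frechet_derivative g (at x) v)" for v
    by (rule Suc.IH[of "\<lambda>x. frechet_derivative f (at x) v"]) (use eq f in simp_all)
  ultimately show ?case by simp
qed

lemma C_k_on_SucD: "C_k_on (Suc k) V f \<Longrightarrow> C_k_on k V f"
proof (induction k arbitrary: f)
  case 0
  then show ?case
    by (auto intro!: continuous_at_imp_continuous_on dest: differentiable_imp_continuous_within)
qed auto

text \<open>\<open>C_k_on\<close> is phrased with the choice operator
  \<open>frechet_derivative\<close>; this rule accepts a derivative given by a formula, to which the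
  closure properties below can be applied.\<close>

lemma C_k_on_SucI:
  assumes "open V" "\<And>x. x \<in> V \<Longrightarrow> (f has_derivative f' x) (at x)"
    and "\<And>v. C_k_on k V (\<lambda>x. f' x v)"
  shows "C_k_on (Suc k) V f"
proof -
  have "frechet_derivative f (at x) = f' x" if "x \<in> V" for x
    using assms(2)[OF that] frechet_derivative_at by metis
  then have "C_k_on k V (\<lambda>x. frechet_derivative f (at x) v)" for v
    by (intro C_k_on_cong[OF \<open>open V\<close> _ assms(3)]) simp
  then show ?thesis
    using assms(2) by (auto simp: differentiable_def)
qed

lemma C_k_on_SucE:
  assumes "C_k_on (Suc k) V f" "x \<in> V"
  shows "(f has_derivative frechet_derivative f (at x)) (at x)"
  using assms frechet_derivative_works by auto

lemma C_k_on_const: "open V \<Longrightarrow> C_k_on k V (\<lambda>x. c)"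
proof (induction k arbitrary: c)
  case (Suc k)
  then show ?case by (intro C_k_on_SucI[where f' = "\<lambda>x v. 0"]) auto
qed simp

lemma C_k_on_bounded_linear: "open V \<Longrightarrow> bounded_linear f \<Longrightarrow> C_k_on k V f"
proof (induction k)
  case 0
  then show ?case by (simp add: linear_continuous_on)
next
  case (Suc k)
  then show ?case
    by (intro C_k_on_SucI[where f' = "\<lambda>x. f"]) (auto intro: bounded_linear_imp_has_derivative C_k_on_const)
qed

lemma C_k_on_add:
  assumes "open V"
  shows "C_k_on k V f \<Longrightarrow> C_k_on k V g \<Longrightarrow> C_k_on k V (\<lambda>x. f x + g x)"
proof (induction k arbitrary: f g)
  case 0
  then show ?case by (auto intro: continuous_intros)
next
  case (Suc k)
  note D = Suc.prems[THEN C_k_on_SucE]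
  show ?case
    by (rule C_k_on_SucI[OF assms, where f' = "\<lambda>x v. frechet_derivative f (at x) v + frechet_derivative g (at x) v"])
       (use Suc D in \<open>auto intro!: derivative_eq_intros\<close>)
qed

lemma C_k_on_sum:
  assumes "open V" "finite I" "\<And>i. i \<in> I \<Longrightarrow> C_k_on k V (f i)"
  shows "C_k_on k V (\<lambda>x. \<Sum>i\<in>I. f i x)"
  using assms(2,3)
proof (induction I rule: finite_induct)
  case (insert i I)
  then have "C_k_on k V (\<lambda>x. f i x + (\<Sum>i\<in>I. f i x))"
    by (intro C_k_on_add[OF \<open>open V\<close>]) auto
  then show ?case using insert.hyps by simp
qed (simp add: C_k_on_const[OF \<open>open V\<close>])

lemma C_k_on_bilinear:
  assumes "open V" "bounded_bilinear B"
  shows "C_k_on k V f \<Longrightarrow> C_k_on k V g \<Longrightarrow> C_k_on k V (\<lambda>x. B (f x) (g x))"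
proof (induction k arbitrary: f g)
  case 0
  then show ?case by (simp add: bounded_bilinear.continuous_on[OF assms(2)])
next
  case (Suc k)
  note D = Suc.prems[THEN C_k_on_SucE]
  show ?case
  proof (rule C_k_on_SucI[OF \<open>open V\<close>])
    show "((\<lambda>x. B (f x) (g x)) has_derivative
       (\<lambda>v. B (f x) (frechet_derivative g (at x) v) + B (frechet_derivative f (at x) v) (g x))) (at x)"
      if "x \<in> V" for x
      using bounded_bilinear.FDERIV[OF assms(2) D[OF that]] .
    show "C_k_on k V (\<lambda>x. B (f x) (frechet_derivative g (at x) v) + B (frechet_derivative f (at x) v) (g x))" for v
      using Suc.prems C_k_on_SucD[OF Suc.prems(1)] C_k_on_SucD[OF Suc.prems(2)]
      by (intro C_k_on_add[OF \<open>open V\<close>] Suc.IH) auto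
  qed
qed

lemma linear_eq_sum_Basis:
  fixes f :: "'a::euclidean_space \<Rightarrow> 'b::real_vector"
  assumes "linear f"
  shows "f v = (\<Sum>b\<in>Basis. (v \<bullet> b) *\<^sub>R f b)"
  by (metis (no_types, lifting) assms euclidean_representation linear_scale linear_sum sum.cong)

text \<open>In the chain rule the derivative of \<open>f\<close> is taken in a direction that varies
  with the point, whereas the definition of \<open>C_k_on\<close> and the induction hypothesis
  concern fixed directions. The basis expansion separates the two dependences.\<close>

lemma C_k_on_compose:
  fixes f :: "'b::euclidean_space \<Rightarrow> 'c::real_normed_vector" and g :: "'a::real_normed_vector \<Rightarrow> 'b"
  assumes "open V"
  shows "C_k_on k W f \<Longrightarrow> C_k_on k V g \<Longrightarrow> g ` V \<subseteq> W \<Longrightarrow> C_k_on k V (\<lambda>x. f (g x))"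
proof (induction k arbitrary: f g)
  case 0
  then show ?case by (auto intro: continuous_on_compose2)
next
  case (Suc k)
  let ?f' = "\<lambda>x. frechet_derivative f (at x)" and ?g' = "\<lambda>x. frechet_derivative g (at x)"
  show ?case
  proof (rule C_k_on_SucI[OF \<open>open V\<close>])
    fix x assume "x \<in> V"
    then have "g x \<in> W" using Suc.prems by auto
    have "linear (?f' (g x))"
      by (rule linear_frechet_derivative) (use Suc.prems(1) \<open>g x \<in> W\<close> in simp)
    from linear_eq_sum_Basis[OF this]
    have eq: "(\<lambda>v. ?f' (g x) (?g' x v)) = (\<lambda>v. \<Sum>b\<in>Basis. (?g' x v \<bullet> b) *\<^sub>R ?f' (g x) b)"
      by (intro ext)
    show "((\<lambda>x. f (g x)) has_derivative
        (\<lambda>v. \<Sum>b\<in>Basis. (?g' x v \<bullet> b) *\<^sub>R ?f' (g x) b)) (at x)"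
      unfolding eq[symmetric]
      by (rule has_derivative_compose[OF C_k_on_SucE[OF Suc.prems(2) \<open>x \<in> V\<close>]
            C_k_on_SucE[OF Suc.prems(1) \<open>g x \<in> W\<close>]])
  next
    fix v
    have "C_k_on k V (\<lambda>x. ?g' x v \<bullet> b)" for b
      by (rule C_k_on_bilinear[OF \<open>open V\<close> bounded_bilinear_inner])
         (use Suc.prems in \<open>auto intro: C_k_on_const[OF \<open>open V\<close>]\<close>)
    moreover have "C_k_on k V (\<lambda>x. ?f' (g x) b)" for b
      using Suc.prems(1,3) C_k_on_SucD[OF Suc.prems(2)] by (intro Suc.IH) auto
    ultimately show "C_k_on k V (\<lambda>x. \<Sum>b\<in>Basis. (?g' x v \<bullet> b) *\<^sub>R ?f' (g x) b)"
      by (intro C_k_on_sum[OF \<open>open V\<close>] C_k_on_bilinear[OF \<open>open V\<close> bounded_bilinear_scaleR]) auto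
  qed
qed

lemma C_k_on_inverse:
  fixes f :: "'a::real_normed_vector \<Rightarrow> real"
  assumes "open V" "\<And>x. x \<in> V \<Longrightarrow> f x \<noteq> 0"
  shows "C_k_on k V f \<Longrightarrow> C_k_on k V (\<lambda>x. inverse (f x))"
proof (induction k)
  case 0
  then show ?case using assms by (auto intro!: continuous_intros)
next
  case (Suc k)
  let ?f' = "\<lambda>x. frechet_derivative f (at x)"
  have IH: "C_k_on k V (\<lambda>x. inverse (f x))"
    using Suc C_k_on_SucD by blast
  show ?case
  proof (rule C_k_on_SucI[OF \<open>open V\<close>])
    show "((\<lambda>x. inverse (f x)) has_derivative (\<lambda>v. (-1) * ((inverse (f x) * inverse (f x)) * ?f' x v))) (at x)"
      if "x \<in> V" for x
      by (rule derivative_eq_intros C_k_on_SucE[OF Suc.prems that] refl assms(2)[OF that])+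
         (simp add: fun_eq_iff)
    show "C_k_on k V (\<lambda>x. (-1) * ((inverse (f x) * inverse (f x)) * ?f' x v))" for v
      by (intro C_k_on_bilinear[OF \<open>open V\<close> bounded_bilinear_mult] IH C_k_on_const[OF \<open>open V\<close>])
         (use Suc.prems in auto)
  qed
qed

lemma smooth_on_Suc:
  assumes "smooth_on V f"
  shows "smooth_on V (\<lambda>x. frechet_derivative f (at x) v)"
  unfolding smooth_on_def
proof
  fix k
  have "C_k_on (Suc k) V f" using assms unfolding smooth_on_def by blast
  then show "C_k_on k V (\<lambda>x. frechet_derivative f (at x) v)" by simp
qed

lemma smooth_on_differentiable: "smooth_on V f \<Longrightarrow> x \<in> V \<Longrightarrow> f differentiable (at x)"
  unfolding smooth_on_def by (metis C_k_on.simps(2))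

lemma smooth_on_has_derivative:
  "smooth_on V f \<Longrightarrow> x \<in> V \<Longrightarrow> (f has_derivative frechet_derivative f (at x)) (at x)"
  using smooth_on_differentiable frechet_derivative_works by blast

lemma smooth_on_continuous: "smooth_on V f \<Longrightarrow> continuous_on V f"
  unfolding smooth_on_def by (metis C_k_on.simps(1))

text \<open>The mean value theorem, applied to the second difference
  \<open>f (s v + t w) - f (s v) - f (t w) + f 0\<close> in either order of the variables.\<close>

lemma second_difference_mean_value:
  fixes f :: "'a::real_normed_vector \<Rightarrow> real"
  assumes "smooth_on V f" "0 < s" "0 < t"
    and V: "\<And>a b. 0 \<le> a \<Longrightarrow> a \<le> s \<Longrightarrow> 0 \<le> b \<Longrightarrow> b \<le> t \<Longrightarrow> x + a *\<^sub>R v + b *\<^sub>R w \<in> V"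
  shows "\<exists>a b. 0 < a \<and> a < s \<and> 0 < b \<and> b < t \<and>
    f (x + s *\<^sub>R v + t *\<^sub>R w) - f (x + s *\<^sub>R v) - f (x + t *\<^sub>R w) + f x =
      s * t * frechet_derivative (\<lambda>y. frechet_derivative f (at y) v) (at (x + a *\<^sub>R v + b *\<^sub>R w)) w"
proof -
  let ?D = "\<lambda>y. frechet_derivative f (at y) v"
  define h where "h a = f (x + a *\<^sub>R v + t *\<^sub>R w) - f (x + a *\<^sub>R v)" for a
  have inV: "x + a *\<^sub>R v + t *\<^sub>R w \<in> V" "x + a *\<^sub>R v \<in> V" if "0 \<le> a" "a \<le> s" for a
    using V[of a t] V[of a 0] that assms by auto
  have D1: "((\<lambda>a. f (x + a *\<^sub>R v + c)) has_real_derivative ?D (x + a *\<^sub>R v + c)) (at a)"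
    if "x + a *\<^sub>R v + c \<in> V" for a c
  proof -
    have "((\<lambda>a. x + a *\<^sub>R v + c) has_derivative (\<lambda>r. r *\<^sub>R v)) (at a)"
      by (auto intro!: derivative_eq_intros)
    from has_derivative_compose[OF this smooth_on_has_derivative[OF assms(1) that]]
    show ?thesis
      by (auto simp: has_field_derivative_def linear_scale[OF linear_frechet_derivative[OF smooth_on_differentiable[OF assms(1) that]]] mult.commute[of _ "?D _"] mult_commute_abs)
  qed
  have "(h has_real_derivative ?D (x + a *\<^sub>R v + t *\<^sub>R w) - ?D (x + a *\<^sub>R v)) (at a)" if "0 \<le> a" "a \<le> s" for a
    unfolding h_def using D1[of a "t *\<^sub>R w"] D1[of a 0] inV[OF that] by (intro DERIV_diff) auto
  then obtain a where a: "0 < a" "a < s" "h s - h 0 = (s - 0) * (?D (x + a *\<^sub>R v + t *\<^sub>R w) - ?D (x + a *\<^sub>R v))"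
    using MVT2[of 0 s h "\<lambda>a. ?D (x + a *\<^sub>R v + t *\<^sub>R w) - ?D (x + a *\<^sub>R v)"] \<open>0 < s\<close> by auto
  define y where "y = x + a *\<^sub>R v"
  have "((\<lambda>b. ?D (y + b *\<^sub>R w)) has_real_derivative frechet_derivative ?D (at (y + b *\<^sub>R w)) w) (at b)"
    if "0 \<le> b" "b \<le> t" for b
  proof -
    have yV: "y + b *\<^sub>R w \<in> V" using V[of a b] a that by (auto simp: y_def)
    have "((\<lambda>b. y + b *\<^sub>R w) has_derivative (\<lambda>r. r *\<^sub>R w)) (at b)"
      by (auto intro!: derivative_eq_intros)
    from has_derivative_compose[OF this smooth_on_has_derivative[OF smooth_on_Suc[OF assms(1)] yV]]
    show ?thesis
      by (auto simp: has_field_derivative_def linear_scale[OF linear_frechet_derivative[OF smooth_on_differentiable[OF smooth_on_Suc[OF assms(1)] yV]]] mult_commute_abs)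
  qed
  then obtain b where b: "0 < b" "b < t"
      "?D (y + t *\<^sub>R w) - ?D (y + 0 *\<^sub>R w) = (t - 0) * frechet_derivative ?D (at (y + b *\<^sub>R w)) w"
    using MVT2[of 0 t "\<lambda>b. ?D (y + b *\<^sub>R w)" "\<lambda>b. frechet_derivative ?D (at (y + b *\<^sub>R w)) w"] \<open>0 < t\<close> by auto
  show ?thesis
    using a b by (intro exI[of _ a] exI[of _ b]) (auto simp: h_def y_def algebra_simps)
qed

text \<open>Both mean values express the same second difference, at two points close to
  \<open>x\<close>; continuity of the two mixed derivatives then brings their values at
  \<open>x\<close> within any \<open>e\<close> of each other.\<close>

lemma second_derivative_symmetric:
  fixes f :: "'a::real_normed_vector \<Rightarrow> real"
  assumes "open V" "smooth_on V f" "x \<in> V"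
  shows "frechet_derivative (\<lambda>y. frechet_derivative f (at y) v) (at x) w =
         frechet_derivative (\<lambda>y. frechet_derivative f (at y) w) (at x) v" (is "?A x = ?B x")
proof -
  have contA: "continuous_on V ?A" and contB: "continuous_on V ?B"
    using assms by (auto intro!: smooth_on_continuous smooth_on_Suc)
  have "dist (?A x) (?B x) \<le> e" if "e > 0" for e
  proof -
    have "\<exists>d>0. \<forall>y. dist y x < d \<longrightarrow> y \<in> V \<and> dist (?A y) (?A x) < e/2 \<and> dist (?B y) (?B x) < e/2"
    proof -
      have "isCont ?A x" "isCont ?B x"
        using contA contB assms(1,3) by (simp_all add: continuous_on_eq_continuous_at)
      then obtain d1 d2 where "d1 > 0" "\<And>y. dist y x < d1 \<Longrightarrow> dist (?A y) (?A x) < e/2"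
          "d2 > 0" "\<And>y. dist y x < d2 \<Longrightarrow> dist (?B y) (?B x) < e/2"
        using half_gt_zero[OF \<open>e > 0\<close>] unfolding continuous_at_eps_delta by metis
      moreover obtain d3 where "d3 > 0" "ball x d3 \<subseteq> V"
        using assms open_contains_ball by blast
      ultimately show ?thesis
        by (intro exI[of _ "min d1 (min d2 d3)"]) (auto simp: dist_commute subset_iff)
    qed
    then obtain d where "d > 0"
      and d: "\<And>y. dist y x < d \<Longrightarrow> y \<in> V \<and> dist (?A y) (?A x) < e/2 \<and> dist (?B y) (?B x) < e/2"
      by blast
    \<comment> \<open>The parallelogram with sides \<open>s *\<^sub>R v\<close> and
      \<open>s *\<^sub>R w\<close> at \<open>x\<close> has to fit into the ball of radius
      \<open>d\<close>; the summand 1 covers \<open>v = w = 0\<close>.\<close>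
    define s where "s = d / (2 * (norm v + norm w + 1))"
    have "s > 0" using \<open>d > 0\<close> by (auto simp: s_def add_nonneg_pos)
    have small: "dist (x + a *\<^sub>R v + b *\<^sub>R w) x < d" if "0 \<le> a" "a \<le> s" "0 \<le> b" "b \<le> s" for a b
    proof -
      have "dist (x + a *\<^sub>R v + b *\<^sub>R w) x \<le> a * norm v + b * norm w"
        using that norm_triangle_ineq[of "a *\<^sub>R v" "b *\<^sub>R w"] by (simp add: dist_norm add.assoc)
      also have "\<dots> \<le> s * norm v + s * norm w"
        using that by (intro add_mono mult_right_mono) auto
      also have "\<dots> < 2 * (s * (norm v + norm w + 1))"
      proof -
        have "0 \<le> s * norm v" "0 \<le> s * norm w" using \<open>s > 0\<close> by auto
        then show ?thesis using \<open>s > 0\<close> unfolding distrib_left by linarith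
      qed
      also have "\<dots> = d"
      proof -
        define n where "n = norm v + norm w + 1"
        have "n > 0" by (simp add: n_def add_nonneg_pos)
        then show ?thesis by (simp add: s_def flip: n_def)
      qed
      finally show ?thesis .
    qed
    obtain a b where ab: "0 < a" "a < s" "0 < b" "b < s"
      "f (x + s *\<^sub>R v + s *\<^sub>R w) - f (x + s *\<^sub>R v) - f (x + s *\<^sub>R w) + f x = s * s * ?A (x + a *\<^sub>R v + b *\<^sub>R w)"
      using second_difference_mean_value[OF assms(2) \<open>s > 0\<close> \<open>s > 0\<close>, of x v w] small d by meson
    have small': "dist (x + a *\<^sub>R w + b *\<^sub>R v) x < d" if "0 \<le> a" "a \<le> s" "0 \<le> b" "b \<le> s" for a b
      using small[of b a] that by (simp add: add.assoc add.commute[of "a *\<^sub>R w"])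
    obtain a' b' where ab': "0 < a'" "a' < s" "0 < b'" "b' < s"
      "f (x + s *\<^sub>R w + s *\<^sub>R v) - f (x + s *\<^sub>R w) - f (x + s *\<^sub>R v) + f x = s * s * ?B (x + a' *\<^sub>R w + b' *\<^sub>R v)"
      using second_difference_mean_value[OF assms(2) \<open>s > 0\<close> \<open>s > 0\<close>, of x w v] small' d by meson
    have "s * s * ?A (x + a *\<^sub>R v + b *\<^sub>R w) = s * s * ?B (x + b' *\<^sub>R v + a' *\<^sub>R w)"
      using ab(5) ab'(5) by (simp add: algebra_simps)
    then have "?A (x + a *\<^sub>R v + b *\<^sub>R w) = ?B (x + b' *\<^sub>R v + a' *\<^sub>R w)" using \<open>s > 0\<close> by simp
    moreover have "dist (?A (x + a *\<^sub>R v + b *\<^sub>R w)) (?A x) < e/2" "dist (?B (x + b' *\<^sub>R v + a' *\<^sub>R w)) (?B x) < e/2"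
      using small[of a b] small[of b' a'] ab ab' d by auto
    ultimately show ?thesis by (metis dist_commute dist_triangle_half_l less_imp_le)
  qed
  then have "dist (?A x) (?B x) \<le> 0" by (rule dense_ge)
  then show ?thesis by simp
qed


text \<open>Only continuity of \<open>\<tau>\<close> is assumed. Linearising \<open>f\<close> at the
  graph point bounds \<open>A v + \<Delta> * A n\<close> by
  \<open>\<eta> * (norm v + \<bar>\<Delta>\<bar>)\<close>, where \<open>\<Delta>\<close> is the
  increment of \<open>\<tau>\<close>. A first use of this bound gives
  \<open>\<bar>\<Delta>\<bar> \<le> C * norm v\<close>, a second one the derivative.\<close>

lemma implicit_function_has_derivative:
  fixes f :: "'a::real_normed_vector \<Rightarrow> real"
  assumes "open W" "x \<in> W" "continuous_on W \<tau>" "norm n = 1"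
    and zero: "\<And>x. x \<in> W \<Longrightarrow> f (x + \<tau> x *\<^sub>R n) = 0"
    and f: "(f has_derivative A) (at (x + \<tau> x *\<^sub>R n))" and "A n \<noteq> 0"
  shows "(\<tau> has_derivative (\<lambda>v. - (A v * inverse (A n)))) (at x)"
  unfolding has_derivative_at_alt
proof (intro conjI allI impI)
  interpret A: bounded_linear A using f by (rule has_derivative_bounded_linear)
  show "bounded_linear (\<lambda>v. - (A v * inverse (A n)))"
    by (intro bounded_linear_minus bounded_linear_mult_const A.bounded_linear_axioms)
  obtain K where K: "K > 0" "\<And>v. \<bar>A v\<bar> \<le> norm v * K"
    using A.pos_bounded by auto
  define \<alpha> where "\<alpha> = \<bar>A n\<bar>"
  have "\<alpha> > 0" using \<open>A n \<noteq> 0\<close> by (simp add: \<alpha>_def)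
  fix e :: real assume "e > 0"
  define C where "C = 2 * (K + \<alpha>) / \<alpha>"
  have "C > 0" using K \<open>\<alpha> > 0\<close> by (simp add: C_def)
  \<comment> \<open>The first entry lets the term in \<open>\<Delta>\<close> be absorbed on the
    left, which is where the factor \<open>C\<close> comes from; the second makes the final error
    \<open>\<eta> * (1 + C)\<close> at most \<open>e * \<alpha>\<close>.\<close>
  define \<eta> where "\<eta> = min (\<alpha> / 2) (e * \<alpha> / (1 + C))"
  have "\<eta> > 0" using \<open>\<alpha> > 0\<close> \<open>e > 0\<close> \<open>C > 0\<close> by (simp add: \<eta>_def)
  obtain d where "d > 0" and d: "\<And>h. norm h < d \<Longrightarrow>
      \<bar>f (x + \<tau> x *\<^sub>R n + h) - f (x + \<tau> x *\<^sub>R n) - A h\<bar> \<le> \<eta> * norm h"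
    using f \<open>\<eta> > 0\<close> unfolding has_derivative_at_alt
    by (metis add_diff_cancel_left' real_norm_def)
  have "isCont \<tau> x" using assms by (simp add: continuous_on_eq_continuous_at)
  then obtain d1 where "d1 > 0" and d1: "\<And>y. dist y x < d1 \<Longrightarrow> dist (\<tau> y) (\<tau> x) < d / 2"
    using half_gt_zero[OF \<open>d > 0\<close>] unfolding continuous_at_eps_delta by metis
  obtain d2 where "d2 > 0" and d2: "ball x d2 \<subseteq> W"
    using assms open_contains_ball by blast
  show "\<exists>d>0. \<forall>y. norm (y - x) < d \<longrightarrow>
      norm (\<tau> y - \<tau> x - - (A (y - x) * inverse (A n))) \<le> e * norm (y - x)"
  proof (intro exI conjI allI impI)
    show "min (d / 2) (min d1 d2) > 0" using \<open>d > 0\<close> \<open>d1 > 0\<close> \<open>d2 > 0\<close> by simp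
    fix y assume y: "norm (y - x) < min (d / 2) (min d1 d2)"
    define v where "v = y - x"
    define \<Delta> where "\<Delta> = \<tau> y - \<tau> x"
    have "y \<in> W" using y d2 by (auto simp: dist_norm norm_minus_commute)
    have "\<bar>\<Delta>\<bar> < d / 2" using d1[of y] y by (simp add: \<Delta>_def dist_norm)
    moreover have "norm (v + \<Delta> *\<^sub>R n) \<le> norm v + \<bar>\<Delta>\<bar>"
      using norm_triangle_ineq[of v "\<Delta> *\<^sub>R n"] \<open>norm n = 1\<close> by simp
    ultimately have small: "norm (v + \<Delta> *\<^sub>R n) < d" using y by (simp add: v_def)
    have "x + \<tau> x *\<^sub>R n + (v + \<Delta> *\<^sub>R n) = y + \<tau> y *\<^sub>R n"
      by (simp add: v_def \<Delta>_def algebra_simps)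
    with d[OF small] zero[OF \<open>x \<in> W\<close>] zero[OF \<open>y \<in> W\<close>]
    have "\<bar>A (v + \<Delta> *\<^sub>R n)\<bar> \<le> \<eta> * norm (v + \<Delta> *\<^sub>R n)" by simp
    also have "\<dots> \<le> \<eta> * (norm v + \<bar>\<Delta>\<bar>)"
      using \<open>norm (v + \<Delta> *\<^sub>R n) \<le> norm v + \<bar>\<Delta>\<bar>\<close> \<open>\<eta> > 0\<close> by simp
    finally have est: "\<bar>A v + \<Delta> * A n\<bar> \<le> \<eta> * (norm v + \<bar>\<Delta>\<bar>)"
      by (simp add: A.add A.scaleR)
    have "\<eta> \<le> \<alpha> / 2" unfolding \<eta>_def by (rule min.cobounded1)
    have "\<alpha> * \<bar>\<Delta>\<bar> \<le> \<bar>A v\<bar> + \<eta> * (norm v + \<bar>\<Delta>\<bar>)"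
      using est abs_triangle_ineq4[of "A v + \<Delta> * A n" "A v"] by (simp add: \<alpha>_def abs_mult mult.commute)
    also have "\<dots> \<le> K * norm v + \<alpha> * norm v + \<alpha> / 2 * \<bar>\<Delta>\<bar>"
    proof -
      have "\<eta> * norm v \<le> \<alpha> * norm v" "\<eta> * \<bar>\<Delta>\<bar> \<le> \<alpha> / 2 * \<bar>\<Delta>\<bar>"
        using \<open>\<eta> \<le> \<alpha> / 2\<close> \<open>\<alpha> > 0\<close> by (intro mult_right_mono; simp)+
      then show ?thesis using K(2)[of v] by (simp add: algebra_simps)
    qed
    finally have "\<bar>\<Delta>\<bar> \<le> C * norm v"
      using \<open>\<alpha> > 0\<close> by (simp add: C_def field_simps)
    then have "\<eta> * (norm v + \<bar>\<Delta>\<bar>) \<le> \<eta> * (norm v + C * norm v)"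
      using \<open>\<eta> > 0\<close> by simp
    also have "\<dots> = \<eta> * (1 + C) * norm v" by (simp add: algebra_simps)
    also have "\<dots> \<le> (e * \<alpha>) * norm v"
    proof (rule mult_right_mono)
      have "\<eta> \<le> e * \<alpha> / (1 + C)" unfolding \<eta>_def by (rule min.cobounded2)
      then show "\<eta> * (1 + C) \<le> e * \<alpha>" using \<open>C > 0\<close> by (simp add: field_simps)
    qed simp
    finally have "\<bar>A v + \<Delta> * A n\<bar> \<le> e * \<alpha> * norm v" using est by linarith
    moreover have "\<Delta> - - (A v * inverse (A n)) = (A v + \<Delta> * A n) / A n"
      using \<open>A n \<noteq> 0\<close> by (simp add: field_simps)
    ultimately show "norm (\<tau> y - \<tau> x - - (A (y - x) * inverse (A n))) \<le> e * norm (y - x)"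
      using \<open>\<alpha> > 0\<close> by (simp add: \<alpha>_def abs_divide divide_le_eq flip: \<Delta>_def v_def) (simp add: mult.commute mult.left_commute)
  qed
qed

text \<open>Bootstrapping: the derivative of \<open>\<tau>\<close> is a formula in
  \<open>\<tau>\<close> itself and in derivatives of \<open>f\<close> at the graph point, so it is
  as often differentiable as \<open>\<tau>\<close> is already known to be.\<close>

lemma implicit_function_smooth:
  fixes f :: "'a::euclidean_space \<Rightarrow> real"
  assumes "smooth_on V f" "open W" "continuous_on W \<tau>" "norm n = 1"
    and zero: "\<And>x. x \<in> W \<Longrightarrow> x + \<tau> x *\<^sub>R n \<in> V \<and> f (x + \<tau> x *\<^sub>R n) = 0"
    and nz: "\<And>x. x \<in> W \<Longrightarrow> frechet_derivative f (at (x + \<tau> x *\<^sub>R n)) n \<noteq> 0"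
  shows "smooth_on W \<tau>"
  unfolding smooth_on_def
proof
  fix k
  let ?p = "\<lambda>x. x + \<tau> x *\<^sub>R n"
  let ?A = "\<lambda>x. frechet_derivative f (at (?p x))"
  show "C_k_on k W \<tau>"
  proof (induction k)
    case (Suc k)
    have p: "C_k_on k W ?p"
      by (intro C_k_on_add[OF \<open>open W\<close>] C_k_on_bilinear[OF \<open>open W\<close> bounded_bilinear_scaleR] Suc.IH
          C_k_on_const[OF \<open>open W\<close>] C_k_on_bounded_linear[OF \<open>open W\<close>] bounded_linear_ident)
    have A: "C_k_on k W (\<lambda>x. ?A x v)" for v
      by (rule C_k_on_compose[OF \<open>open W\<close>, of k V "\<lambda>y. frechet_derivative f (at y) v" ?p])
         (use p zero smooth_on_Suc[OF assms(1)] in \<open>auto simp: smooth_on_def\<close>)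
    show ?case
    proof (rule C_k_on_SucI[OF \<open>open W\<close>])
      show "(\<tau> has_derivative (\<lambda>v. - (?A x v * inverse (?A x n)))) (at x)" if "x \<in> W" for x
        using zero nz that smooth_on_has_derivative[OF assms(1)] assms(2-4)
        by (intro implicit_function_has_derivative[where f = f and W = W]) auto
      have "C_k_on k W (\<lambda>x. (-1) * (?A x v * inverse (?A x n)))" for v
        by (intro C_k_on_bilinear[OF \<open>open W\<close> bounded_bilinear_mult] C_k_on_const[OF \<open>open W\<close>]
            C_k_on_inverse[OF \<open>open W\<close>] A nz)
      then show "C_k_on k W (\<lambda>x. - (?A x v * inverse (?A x n)))" for v by simp
    qed
  qed (use assms in simp)
qed


section \<open>Regular zero sets as graphs\<close>

lemma isCont_eventually_gt:
  fixes f :: "'a::t2_space \<Rightarrow> 'b::linorder_topology"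
  assumes "isCont f x"
  shows "a < f x \<Longrightarrow> \<forall>\<^sub>F y in nhds x. a < f y" "f x < a \<Longrightarrow> \<forall>\<^sub>F y in nhds x. f y < a"
proof -
  have "(f \<longlongrightarrow> f x) (nhds x)"
    using assms by (simp add: continuous_within tendsto_at_iff_tendsto_nhds)
  then show "a < f x \<Longrightarrow> \<forall>\<^sub>F y in nhds x. a < f y" "f x < a \<Longrightarrow> \<forall>\<^sub>F y in nhds x. f y < a"
    by (auto dest: order_tendstoD)
qed

text \<open>\<open>n\<close> is the direction of the gradient at \<open>y\<close>, and \<open>\<tau> x\<close> the height of the zero set
  of \<open>f\<close> above \<open>x\<close> in this direction.\<close>

lemma local_graph:
  fixes f :: "'a::euclidean_space \<Rightarrow> real"
  assumes "open V" "smooth_on V f" "y \<in> V" "f y = 0" "frechet_derivative f (at y) \<noteq> (\<lambda>v. 0)"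
  obtains n W \<tau> \<rho> where "norm n = 1" "open W" "connected W" "y \<in> W" "\<rho> > 0" "smooth_on W \<tau>"
    and "\<And>x. x \<in> W \<Longrightarrow> \<bar>\<tau> x\<bar> < \<rho>"
    and "\<And>x s. x \<in> W \<Longrightarrow> \<bar>s\<bar> < \<rho> \<Longrightarrow> x + s *\<^sub>R n \<in> V"
    and "\<And>x s. x \<in> W \<Longrightarrow> \<bar>s\<bar> < \<rho> \<Longrightarrow> f (x + s *\<^sub>R n) = 0 \<longleftrightarrow> s = \<tau> x"
    and "\<And>x. x \<in> W \<Longrightarrow> frechet_derivative \<tau> (at x) n = -1"
    and "\<And>v. frechet_derivative \<tau> (at y) v = - (n \<bullet> v)"
proof -
  let ?f' = "\<lambda>x. frechet_derivative f (at x)"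
  define g where "g = (\<Sum>b\<in>Basis. ?f' y b *\<^sub>R b)"
  have fg: "?f' y v = g \<bullet> v" for v
    using linear_eq_sum_Basis[OF linear_frechet_derivative[OF smooth_on_differentiable[OF assms(2,3)]], of v]
    by (simp add: g_def inner_sum_left mult.commute inner_commute[of v])
  then have "g \<noteq> 0" using assms(5) by auto
  define n where "n = sgn g"
  have n: "norm n = 1" using \<open>g \<noteq> 0\<close> by (simp add: n_def norm_sgn)
  have "?f' y n > 0"
    using \<open>g \<noteq> 0\<close> by (simp add: fg n_def sgn_div_norm power2_norm_eq_inner[symmetric])
  moreover have cont': "continuous_on V (\<lambda>x. ?f' x n)"
    by (intro smooth_on_continuous smooth_on_Suc assms)
  ultimately have "\<forall>\<^sub>F x in nhds y. ?f' x n > 0"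
    using assms(1,3) by (intro isCont_eventually_gt) (simp_all add: continuous_on_eq_continuous_at)
  then obtain V' where V': "open V'" "y \<in> V'" "\<And>x. x \<in> V' \<Longrightarrow> ?f' x n > 0"
    unfolding eventually_nhds by blast
  obtain r where "r > 0" and r: "ball y r \<subseteq> V \<inter> V'"
    using V' assms(1,3) open_contains_ball[of "V \<inter> V'"] by blast
  have mono: "f (x + s *\<^sub>R n) < f (x + t *\<^sub>R n)"
    if "s < t" "x + s *\<^sub>R n \<in> ball y r" "x + t *\<^sub>R n \<in> ball y r" for x s t
  proof (rule DERIV_pos_imp_increasing[OF \<open>s < t\<close>])
    fix u assume u: "s \<le> u" "u \<le> t"
    have "x + u *\<^sub>R n \<in> ball y r"
    proof -
      define c where "c = (u - s) / (t - s)"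
      have c: "0 \<le> c" "c \<le> 1" "u = (1 - c) * s + c * t"
        using u \<open>s < t\<close> by (auto simp: c_def divide_simps) (simp add: algebra_simps)
      have "x + u *\<^sub>R n = (1 - c) *\<^sub>R (x + s *\<^sub>R n) + c *\<^sub>R (x + t *\<^sub>R n)"
        by (simp add: c(3) algebra_simps)
      then show ?thesis
        using convexD[OF convex_ball that(2,3), of "1 - c" c] c by simp
    qed
    then have inV: "x + u *\<^sub>R n \<in> V" "?f' (x + u *\<^sub>R n) n > 0" using r V' by auto
    have "((\<lambda>u. x + u *\<^sub>R n) has_derivative (\<lambda>r. r *\<^sub>R n)) (at u)"
      by (auto intro!: derivative_eq_intros)
    from has_derivative_compose[OF this smooth_on_has_derivative[OF assms(2) inV(1)]]
    have "((\<lambda>u. f (x + u *\<^sub>R n)) has_real_derivative ?f' (x + u *\<^sub>R n) n) (at u)"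
      by (auto simp: has_field_derivative_def mult_commute_abs
          linear_scale[OF linear_frechet_derivative[OF smooth_on_differentiable[OF assms(2) inV(1)]]])
    then show "\<exists>D. ((\<lambda>u. f (x + u *\<^sub>R n)) has_real_derivative D) (at u) \<and> D > 0"
      using inV by blast
  qed
  \<comment> \<open>A third of \<open>r\<close>: a point at distance less than \<open>\<rho>\<close>
    from \<open>y\<close>, moved by at most \<open>\<rho>\<close> along \<open>n\<close>, stays in
    the ball of radius \<open>r\<close>, where \<open>f\<close> increases along
    \<open>n\<close>.\<close>
  define \<rho> where "\<rho> = r / 3"
  have "\<rho> > 0" using \<open>r > 0\<close> by (simp add: \<rho>_def)
  have inb: "x + s *\<^sub>R n \<in> ball y r" if "x \<in> ball y \<rho>" "\<bar>s\<bar> \<le> \<rho>" for x s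
  proof -
    have "norm (x + s *\<^sub>R n - y) \<le> norm (x - y) + \<bar>s\<bar>"
      using norm_triangle_ineq[of "x - y" "s *\<^sub>R n"] n by (simp add: algebra_simps)
    then show ?thesis using that \<open>r > 0\<close> by (simp add: \<rho>_def dist_norm norm_minus_commute)
  qed
  have contf: "continuous_on V f" using smooth_on_continuous assms by blast
  have cont_nhds: "isCont (\<lambda>x. f (x + s *\<^sub>R n)) x" if "x \<in> ball y \<rho>" "\<bar>s\<bar> \<le> \<rho>" for x s
  proof -
    have "isCont f (x + s *\<^sub>R n)"
      using inb[OF that] r contf assms(1) continuous_on_eq_continuous_at by blast
    moreover have "isCont (\<lambda>x. x + s *\<^sub>R n) x" by (intro continuous_intros)
    ultimately show ?thesis by (rule isCont_o2[rotated])
  qed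
  have pos: "f (y + \<rho> *\<^sub>R n) > 0" "f (y + (-\<rho>) *\<^sub>R n) < 0"
    using mono[of 0 \<rho> y] mono[of "-\<rho>" 0 y] inb[of y \<rho>] inb[of y "-\<rho>"] inb[of y 0] \<open>\<rho> > 0\<close> assms(4) by auto
  have pos_nhds: "\<forall>\<^sub>F x in nhds x0. f (x + s *\<^sub>R n) > 0"
    if "x0 \<in> ball y \<rho>" "\<bar>s\<bar> \<le> \<rho>" "f (x0 + s *\<^sub>R n) > 0" for x0 s
    by (rule isCont_eventually_gt[OF cont_nhds]) (fact that)+
  have neg_nhds: "\<forall>\<^sub>F x in nhds x0. f (x + s *\<^sub>R n) < 0"
    if "x0 \<in> ball y \<rho>" "\<bar>s\<bar> \<le> \<rho>" "f (x0 + s *\<^sub>R n) < 0" for x0 s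
    by (rule isCont_eventually_gt[OF cont_nhds]) (fact that)+
  have "\<forall>\<^sub>F x in nhds y. f (x + \<rho> *\<^sub>R n) > 0 \<and> f (x + (-\<rho>) *\<^sub>R n) < 0"
    using pos_nhds[of y \<rho>] neg_nhds[of y "-\<rho>"] pos \<open>\<rho> > 0\<close> by (simp add: eventually_conj)
  then obtain \<delta>0 where "\<delta>0 > 0" and \<delta>0: "\<And>x. dist x y < \<delta>0 \<Longrightarrow> f (x + \<rho> *\<^sub>R n) > 0 \<and> f (x + (-\<rho>) *\<^sub>R n) < 0"
    unfolding eventually_nhds_metric by blast
  define W where "W = ball y (min \<delta>0 \<rho>)"
  have W: "open W" "connected W" "y \<in> W" "W \<subseteq> ball y \<rho>"
    using \<open>\<delta>0 > 0\<close> \<open>\<rho> > 0\<close> by (auto simp: W_def)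
  have W0: "f (x + \<rho> *\<^sub>R n) > 0" "f (x + (-\<rho>) *\<^sub>R n) < 0" if "x \<in> W" for x
    using \<delta>0[of x] that by (auto simp: W_def dist_commute)
  have "\<exists>s. \<bar>s\<bar> < \<rho> \<and> f (x + s *\<^sub>R n) = 0" if xW: "x \<in> W" for x
  proof -
    have "continuous_on {-\<rho>..\<rho>} (\<lambda>s. f (x + s *\<^sub>R n))"
      by (rule continuous_on_compose2[OF contf])
         (use r W(4) xW inb in \<open>force intro!: continuous_intros\<close>)+
    then obtain s where s: "-\<rho> \<le> s" "s \<le> \<rho>" "f (x + s *\<^sub>R n) = 0"
      using IVT'[of "\<lambda>s. f (x + s *\<^sub>R n)" "-\<rho>" 0 \<rho>] W0[OF xW] \<open>\<rho> > 0\<close> by force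
    then have "s \<noteq> \<rho>" "s \<noteq> -\<rho>" using W0[OF xW] by auto
    then show ?thesis using s by (intro exI[of _ s]) auto
  qed
  then obtain \<tau> where \<tau>: "\<And>x. x \<in> W \<Longrightarrow> \<bar>\<tau> x\<bar> < \<rho> \<and> f (x + \<tau> x *\<^sub>R n) = 0" by metis
  have sgn: "f (x + s *\<^sub>R n) < 0 \<longleftrightarrow> s < \<tau> x" "f (x + s *\<^sub>R n) > 0 \<longleftrightarrow> s > \<tau> x"
    if "x \<in> W" "\<bar>s\<bar> \<le> \<rho>" for x s
  proof -
    have "x \<in> ball y \<rho>" and t: "\<bar>\<tau> x\<bar> < \<rho>" "f (x + \<tau> x *\<^sub>R n) = 0" using that W(4) \<tau>[OF that(1)] by auto
    then have b: "x + s *\<^sub>R n \<in> ball y r" "x + \<tau> x *\<^sub>R n \<in> ball y r"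
      using inb[of x s] inb[of x "\<tau> x"] that(2) by auto
    have "s < \<tau> x \<Longrightarrow> f (x + s *\<^sub>R n) < 0" "s > \<tau> x \<Longrightarrow> f (x + s *\<^sub>R n) > 0"
      using mono[OF _ b] mono[OF _ b(2,1)] t by auto
    then show "f (x + s *\<^sub>R n) < 0 \<longleftrightarrow> s < \<tau> x" "f (x + s *\<^sub>R n) > 0 \<longleftrightarrow> s > \<tau> x"
      using t by (metis less_irrefl linorder_neqE_linordered_idom order_less_trans)+
  qed
  \<comment> \<open>At the heights \<open>\<tau> x + e'\<close> and \<open>\<tau> x - e'\<close> the
    function \<open>f\<close> has strict and opposite signs; these persist over nearby base points
    and enclose the height of the zero set there.\<close>
  have "isCont \<tau> x" if "x \<in> W" for x
    unfolding continuous_at_eps_delta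
  proof (intro allI impI)
    fix e :: real assume "e > 0"
    define e' where "e' = min e (\<rho> - \<bar>\<tau> x\<bar>)"
    have e': "e' > 0" "\<bar>\<tau> x + e'\<bar> \<le> \<rho>" "\<bar>\<tau> x - e'\<bar> \<le> \<rho>" "e' \<le> e"
      using \<open>e > 0\<close> \<tau>[OF that] by (auto simp: e'_def)
    have x: "x \<in> ball y \<rho>" using that W by auto
    have "\<forall>\<^sub>F x' in nhds x. f (x' + (\<tau> x + e') *\<^sub>R n) > 0 \<and> f (x' + (\<tau> x - e') *\<^sub>R n) < 0 \<and> x' \<in> W"
      using pos_nhds[OF x e'(2)] neg_nhds[OF x e'(3)] sgn[OF that e'(2)] sgn[OF that e'(3)] e'(1)
        eventually_nhds_in_open[OF W(1) that] by (simp add: eventually_conj)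
    then obtain d where "d > 0" and d: "\<And>x'. dist x' x < d \<Longrightarrow>
        f (x' + (\<tau> x + e') *\<^sub>R n) > 0 \<and> f (x' + (\<tau> x - e') *\<^sub>R n) < 0 \<and> x' \<in> W"
      unfolding eventually_nhds_metric by blast
    have "dist (\<tau> x') (\<tau> x) < e" if "dist x' x < d" for x'
      using d[OF that] sgn[of x' "\<tau> x + e'"] sgn[of x' "\<tau> x - e'"] e' by (auto simp: dist_real_def)
    then show "\<exists>d>0. \<forall>x'. dist x' x < d \<longrightarrow> dist (\<tau> x') (\<tau> x) < e" using \<open>d > 0\<close> by blast
  qed
  then have cont: "continuous_on W \<tau>" by (simp add: continuous_at_imp_continuous_on)
  have inV: "x + s *\<^sub>R n \<in> V \<and> ?f' (x + s *\<^sub>R n) n > 0" if "x \<in> W" "\<bar>s\<bar> \<le> \<rho>" for x s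
    using inb[of x s] that W(4) r V'(3) by blast
  have inV\<tau>: "x + \<tau> x *\<^sub>R n \<in> V" "?f' (x + \<tau> x *\<^sub>R n) n \<noteq> 0" if "x \<in> W" for x
    using inV[OF that, of "\<tau> x"] \<tau>[OF that] by auto
  have smooth: "smooth_on W \<tau>"
    using \<tau> inV\<tau> by (intro implicit_function_smooth[OF assms(2) W(1) cont n]) auto
  have D: "frechet_derivative \<tau> (at x) =
      (\<lambda>v. - (?f' (x + \<tau> x *\<^sub>R n) v * inverse (?f' (x + \<tau> x *\<^sub>R n) n)))" if "x \<in> W" for x
    by (rule frechet_derivative_at[symmetric],
        rule implicit_function_has_derivative[where f = f, OF W(1) that cont n])
       (use \<tau> inV\<tau> that smooth_on_has_derivative[OF assms(2)] in auto)
  show thesis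
  proof (rule that[of n W \<rho> \<tau>])
    show "f (x + s *\<^sub>R n) = 0 \<longleftrightarrow> s = \<tau> x" if "x \<in> W" "\<bar>s\<bar> < \<rho>" for x s
      using sgn[of x s] \<tau>[of x] that by (smt (verit))
    show "frechet_derivative \<tau> (at x) n = -1" if "x \<in> W" for x
      using D[OF that] inV\<tau>[OF that] by simp
    have "\<tau> y = 0" using sgn[OF W(3), of 0] assms(4) \<open>\<rho> > 0\<close> by auto
    then show "frechet_derivative \<tau> (at y) v = - (n \<bullet> v)" for v
      using D[OF W(3)] \<open>g \<noteq> 0\<close>
      by (simp add: fg n_def sgn_div_norm power2_norm_eq_inner[symmetric] power2_eq_square divide_simps)
  qed (use n W \<open>\<rho> > 0\<close> smooth \<tau> inV in auto)
qed


subsection \<open>Charts of the boundary\<close>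

lemma smooth_on_minus:
  assumes "open V" "smooth_on V f"
  shows "smooth_on V (\<lambda>x. - f x)"
proof -
  have "C_k_on k V (\<lambda>x. (-1) *\<^sub>R f x)" for k
    using assms by (intro C_k_on_bilinear[OF \<open>open V\<close> bounded_bilinear_scaleR] C_k_on_const) (auto simp: smooth_on_def)
  then show ?thesis by (simp add: smooth_on_def)
qed

lemma isCont_eventually_in_open:
  fixes f :: "'a::t2_space \<Rightarrow> 'b::t2_space"
  assumes "isCont f x" "open W" "f x \<in> W"
  shows "\<forall>\<^sub>F y in nhds x. f y \<in> W"
proof -
  have "(f \<longlongrightarrow> f x) (nhds x)"
    using assms by (simp add: continuous_within tendsto_at_iff_tendsto_nhds)
  then show ?thesis using assms(2,3) by (rule topological_tendstoD)
qed

lemma open_line: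
  fixes x v :: "'a::real_normed_vector"
  assumes "open W" "x \<in> W"
  obtains e where "e > 0" "\<And>t. \<bar>t\<bar> < e \<Longrightarrow> x + t *\<^sub>R v \<in> W"
proof -
  have "isCont (\<lambda>t::real. x + t *\<^sub>R v) 0" by (intro continuous_intros)
  then have "\<forall>\<^sub>F t in nhds 0. x + t *\<^sub>R v \<in> W"
    using assms by (intro isCont_eventually_in_open) auto
  then show thesis using that unfolding eventually_nhds_metric by auto
qed

text \<open>\<open>\<tau> x\<close> is the signed distance, in the fixed direction \<open>n\<close>, from \<open>x\<close> to \<open>S\<close>.\<close>

locale boundary_chart =
  fixes S U :: "'a::euclidean_space set" and y n :: 'a and W :: "'a set" and \<tau> :: "'a \<Rightarrow> real"
  assumes unit: "norm n = 1" and open_W: "open W" and center: "y \<in> W" "\<tau> y = 0"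
    and smooth: "smooth_on W \<tau>"
    and graph_in: "x \<in> W \<Longrightarrow> x + \<tau> x *\<^sub>R n \<in> S"
    and in_S_iff: "x \<in> W \<Longrightarrow> x \<in> S \<longleftrightarrow> \<tau> x = 0"
    and in_U_iff: "x \<in> W \<Longrightarrow> x \<in> U \<longleftrightarrow> \<tau> x \<ge> 0"
    and deriv_normal: "x \<in> W \<Longrightarrow> frechet_derivative \<tau> (at x) n = -1"
    and deriv_center: "frechet_derivative \<tau> (at y) v = - (n \<bullet> v)"
    and S_def: "S = frontier U"

text \<open>A local equation of \<open>S\<close> does not tell on which side \<open>U\<close> lies.
  The regions below and above the graph are connected and miss the frontier, so each is contained in
  \<open>U\<close> or disjoint from it. Both contained would make \<open>y\<close> an interior
  point; both disjoint would contradict that \<open>U\<close> is the closure of its interior. If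
  \<open>U\<close> is the upper region, \<open>n\<close> and \<open>\<tau>\<close> change
  sign.\<close>

lemma boundary_chart_exists:
  fixes S U :: "'a::euclidean_space set"
  assumes "smooth_hypersurface S" "encloses S U" "y \<in> S"
  shows "\<exists>n W \<tau>. boundary_chart S U y n W \<tau>"
proof -
  obtain V and f :: "'a \<Rightarrow> real" where V: "open V" "y \<in> V" "smooth_on V f" "S \<inter> V = {x \<in> V. f x = 0}"
    and nz: "\<forall>x\<in>S \<inter> V. frechet_derivative f (at x) \<noteq> (\<lambda>v. 0)"
    using assms(1,3) unfolding smooth_hypersurface_def by blast
  have "f y = 0" using V assms(3) by blast
  have nzy: "frechet_derivative f (at y) \<noteq> (\<lambda>v. 0)" using nz V(2) assms(3) by blast
  obtain n W \<tau> \<rho> where n: "norm n = 1" and W: "open W" "connected W" "y \<in> W" and "\<rho> > 0" "smooth_on W \<tau>"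
    and \<tau>\<rho>: "\<And>x. x \<in> W \<Longrightarrow> \<bar>\<tau> x\<bar> < \<rho>"
    and inV: "\<And>x s. x \<in> W \<Longrightarrow> \<bar>s\<bar> < \<rho> \<Longrightarrow> x + s *\<^sub>R n \<in> V"
    and f0: "\<And>x s. x \<in> W \<Longrightarrow> \<bar>s\<bar> < \<rho> \<Longrightarrow> f (x + s *\<^sub>R n) = 0 \<longleftrightarrow> s = \<tau> x"
    and Dn: "\<And>x. x \<in> W \<Longrightarrow> frechet_derivative \<tau> (at x) n = -1"
    and Dy: "\<And>v. frechet_derivative \<tau> (at y) v = - (n \<bullet> v)"
    by (rule local_graph[OF V(1,3,2) \<open>f y = 0\<close> nzy]) (rule that)
  have S: "S = frontier U" and U: "closure (interior U) = U" "compact U"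
    using assms(2) by (auto simp: encloses_def)
  have S_iff: "x + s *\<^sub>R n \<in> S \<longleftrightarrow> s = \<tau> x" if "x \<in> W" "\<bar>s\<bar> < \<rho>" for x s
    using inV[OF that] f0[OF that] V(4) by blast
  have S_iff0: "x \<in> S \<longleftrightarrow> \<tau> x = 0" if "x \<in> W" for x
    using S_iff[OF that, of 0] \<open>\<rho> > 0\<close> by auto
  have "S \<subseteq> U" using S U(2) compact_imp_closed frontier_subset_closed by blast
  \<comment> \<open>\<open>lo\<close> consists of the points \<open>x + s *\<^sub>R n\<close> with
    \<open>- \<rho> < s < \<tau> x\<close>, and \<open>up\<close> of those with
    \<open>\<tau> x < s < \<rho>\<close>; the fraction \<open>t\<close> presents both as images of a
    connected product. A point \<open>x\<close> of \<open>W\<close> has height 0 over itself, so it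
    lies in \<open>lo\<close> if \<open>\<tau> x > 0\<close> and in \<open>up\<close> if
    \<open>\<tau> x < 0\<close>.\<close>
  define lo where "lo = (\<lambda>(x, t). x + (\<tau> x - t * (\<tau> x + \<rho>)) *\<^sub>R n) ` (W \<times> {0<..<1})"
  define up where "up = (\<lambda>(x, t). x + (\<tau> x + t * (\<rho> - \<tau> x)) *\<^sub>R n) ` (W \<times> {0<..<1})"
  have cont: "continuous_on (W \<times> {0<..<1::real}) (\<lambda>z. \<tau> (fst z))"
    by (rule continuous_on_compose2[OF smooth_on_continuous[OF \<open>smooth_on W \<tau>\<close>]]) (auto intro: continuous_intros)
  have conn: "connected lo" "connected up"
    unfolding lo_def up_def case_prod_unfold
    by (intro connected_continuous_image continuous_intros cont connected_Times W connected_Ioo)+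
  have lo_up: "lo \<inter> S = {}" "up \<inter> S = {}"
  proof -
    have "x + (\<tau> x - t * (\<tau> x + \<rho>)) *\<^sub>R n \<notin> S \<and> x + (\<tau> x + t * (\<rho> - \<tau> x)) *\<^sub>R n \<notin> S"
      if "x \<in> W" "0 < t" "t < 1" for x t
    proof -
      have "0 < t * (\<tau> x + \<rho>)" "t * (\<tau> x + \<rho>) < 1 * (\<tau> x + \<rho>)"
           "0 < t * (\<rho> - \<tau> x)" "t * (\<rho> - \<tau> x) < 1 * (\<rho> - \<tau> x)"
        using that(2,3) \<tau>\<rho>[OF that(1)]
        by (intro mult_pos_pos mult_strict_right_mono; linarith)+
      then show ?thesis using S_iff[OF that(1)] \<tau>\<rho>[OF that(1)] by auto
    qed
    then show "lo \<inter> S = {}" "up \<inter> S = {}" by (auto simp: lo_def up_def)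
  qed
  have in_lo: "x \<in> lo" if "x \<in> W" "\<tau> x > 0" for x
  proof -
    have 1: "(x, \<tau> x / (\<tau> x + \<rho>)) \<in> W \<times> {0<..<1}" and 2: "\<tau> x - \<tau> x / (\<tau> x + \<rho>) * (\<tau> x + \<rho>) = 0"
      using that \<open>\<rho> > 0\<close> by auto
    show ?thesis unfolding lo_def by (rule rev_image_eqI[OF 1]) (simp only: split 2 scaleR_zero_left add_0_right)
  qed
  have in_up: "x \<in> up" if "x \<in> W" "\<tau> x < 0" for x
  proof -
    have "\<rho> - \<tau> x > 0" using that \<open>\<rho> > 0\<close> by simp
    then have 1: "(x, - \<tau> x / (\<rho> - \<tau> x)) \<in> W \<times> {0<..<1}" and 2: "\<tau> x + - \<tau> x / (\<rho> - \<tau> x) * (\<rho> - \<tau> x) = 0"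
      using that \<open>\<rho> > 0\<close> by (auto simp: field_simps)
    show ?thesis unfolding up_def by (rule rev_image_eqI[OF 1]) (simp only: split 2 scaleR_zero_left add_0_right)
  qed
  have side: "lo \<subseteq> U \<or> lo \<inter> U = {}" "up \<subseteq> U \<or> up \<inter> U = {}"
    using connected_Int_frontier[OF conn(1), of U] connected_Int_frontier[OF conn(2), of U] lo_up
    unfolding S by blast+
  have "\<not> (lo \<subseteq> U \<and> up \<subseteq> U)"
  proof
    assume "lo \<subseteq> U \<and> up \<subseteq> U"
    then have "W \<subseteq> U"
      using in_lo in_up S_iff0 \<open>S \<subseteq> U\<close> by (metis linorder_neqE_linordered_idom subset_iff)
    then have "y \<in> interior U" using W interiorI by blast
    then show False using assms(3) S by (simp add: frontier_def)
  qed
  moreover have "\<not> (lo \<inter> U = {} \<and> up \<inter> U = {})"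
  proof
    assume "lo \<inter> U = {} \<and> up \<inter> U = {}"
    then have "W \<inter> U \<subseteq> S"
      using in_lo in_up S_iff0 by (metis IntD1 IntD2 IntI empty_iff linorder_neqE_linordered_idom subsetI)
    then have "W \<inter> interior U = {}"
      using S interior_subset by (fastforce simp: frontier_def)
    moreover have "y \<in> closure (interior U)" using \<open>S \<subseteq> U\<close> assms(3) U by auto
    ultimately show False using W by (auto simp: closure_iff_nhds_not_empty)
  qed
  ultimately consider "lo \<subseteq> U" "up \<inter> U = {}" | "lo \<inter> U = {}" "up \<subseteq> U" using side by auto
  then show ?thesis
  proof cases
    case 1
    have "x \<in> U \<longleftrightarrow> \<tau> x \<ge> 0" if "x \<in> W" for x
      using in_lo[OF that] in_up[OF that] 1 S_iff0[OF that] \<open>S \<subseteq> U\<close>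
      by (metis IntI empty_iff less_eq_real_def not_less subsetD)
    then have "boundary_chart S U y n W \<tau>"
      using n W \<open>smooth_on W \<tau>\<close> S_iff \<tau>\<rho> S_iff0 Dn Dy S assms(3) by unfold_locales auto
    then show ?thesis by blast
  next
    case 2
    have D: "frechet_derivative (\<lambda>x. - \<tau> x) (at x) v = - frechet_derivative \<tau> (at x) v" if "x \<in> W" for x v
      using has_derivative_minus[OF smooth_on_has_derivative[OF \<open>smooth_on W \<tau>\<close> that]]
      by (metis frechet_derivative_at)
    have lin: "frechet_derivative \<tau> (at x) (- v) = - frechet_derivative \<tau> (at x) v" if "x \<in> W" for x v
      using linear_neg[OF linear_frechet_derivative[OF smooth_on_differentiable[OF \<open>smooth_on W \<tau>\<close> that]]] .
    have "x \<in> U \<longleftrightarrow> - \<tau> x \<ge> 0" if "x \<in> W" for x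
      using in_lo[OF that] in_up[OF that] 2 S_iff0[OF that] \<open>S \<subseteq> U\<close>
      by (metis IntI empty_iff neg_0_le_iff_le less_eq_real_def not_less subsetD)
    then have "boundary_chart S U y (- n) W (\<lambda>x. - \<tau> x)"
      using n W smooth_on_minus[OF W(1) \<open>smooth_on W \<tau>\<close>] S_iff \<tau>\<rho> S_iff0 Dn Dy S assms(3) D lin
      by unfold_locales auto
    then show ?thesis by blast
  qed
qed

context boundary_chart
begin

lemma smooth_on_graph_line:
  assumes "open I" "\<And>t. t \<in> I \<Longrightarrow> g t \<in> W" "smooth_on I g"
  shows "smooth_on I (\<lambda>t::'b::real_normed_vector. g t + \<tau> (g t) *\<^sub>R n)"
  unfolding smooth_on_def
proof
  fix k
  have g: "C_k_on k I g" using assms(3) by (simp add: smooth_on_def)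
  have "C_k_on k I (\<lambda>t. \<tau> (g t))"
    by (rule C_k_on_compose[OF assms(1) _ g, of W]) (use smooth assms(2) in \<open>auto simp: smooth_on_def\<close>)
  then show "C_k_on k I (\<lambda>t. g t + \<tau> (g t) *\<^sub>R n)"
    by (intro C_k_on_add[OF assms(1)] g C_k_on_bilinear[OF assms(1) bounded_bilinear_scaleR] C_k_on_const[OF assms(1)])
qed

lemma derivative_line:
  assumes "x \<in> W"
  shows "((\<lambda>t. \<tau> (x + t *\<^sub>R v)) has_real_derivative frechet_derivative \<tau> (at x) v) (at 0)"
proof -
  have "((\<lambda>t::real. x + t *\<^sub>R v) has_derivative (\<lambda>t. t *\<^sub>R v)) (at 0)"
    by (auto intro!: derivative_eq_intros)
  moreover have "(\<tau> has_derivative frechet_derivative \<tau> (at x)) (at (x + 0 *\<^sub>R v))"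
    using smooth_on_has_derivative[OF smooth assms] by simp
  ultimately have "((\<lambda>t. \<tau> (x + t *\<^sub>R v)) has_derivative (\<lambda>t. frechet_derivative \<tau> (at x) (t *\<^sub>R v))) (at 0)"
    by (rule has_derivative_compose)
  then show ?thesis
    by (simp add: has_field_derivative_def mult_commute_abs
        linear_scale[OF linear_frechet_derivative[OF smooth_on_differentiable[OF smooth assms]]])
qed

lemma tangent_space_chart:
  assumes "x \<in> S" "x \<in> W"
  shows "tangent_space S x = {v. frechet_derivative \<tau> (at x) v = 0}"
proof (intro equalityI subsetI CollectI; clarify?)
  fix v assume "v \<in> tangent_space S x"
  then obtain c e where e: "e > 0" and c: "c ` {-e<..<e} \<subseteq> S" "c 0 = x" "(c has_vector_derivative v) (at (0::real))"
    unfolding tangent_space_def by blast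
  have "(c has_derivative (\<lambda>t. t *\<^sub>R v)) (at 0)" using c(3) by (simp add: has_vector_derivative_def)
  moreover have "(\<tau> has_derivative frechet_derivative \<tau> (at x)) (at (c 0))"
    using smooth_on_has_derivative[OF smooth assms(2)] c(2) by simp
  ultimately have D: "((\<lambda>t. \<tau> (c t)) has_derivative (\<lambda>t. frechet_derivative \<tau> (at x) (t *\<^sub>R v))) (at 0)"
    by (rule has_derivative_compose)
  have "isCont c 0" using c(3) has_vector_derivative_continuous by blast
  then have "\<forall>\<^sub>F t in nhds 0. c t \<in> W"
    using open_W assms(2) c(2) by (intro isCont_eventually_in_open) auto
  moreover have "\<forall>\<^sub>F t in nhds 0. t \<in> {-e<..<e}" using e by (intro eventually_nhds_in_open) auto
  ultimately have "\<forall>\<^sub>F t in nhds 0. \<tau> (c t) = 0"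
    by eventually_elim (use c(1) in_S_iff in blast)
  then obtain X where "open X" "0 \<in> X" "\<And>t. t \<in> X \<Longrightarrow> \<tau> (c t) = 0"
    unfolding eventually_nhds by blast
  from has_derivative_transform_within_open[OF D this]
  have "((\<lambda>t::real. 0::real) has_derivative (\<lambda>t. frechet_derivative \<tau> (at x) (t *\<^sub>R v))) (at 0)" .
  from has_derivative_unique[OF this has_derivative_const] show "frechet_derivative \<tau> (at x) v = 0"
    by (metis scaleR_one)
next
  fix v assume v: "frechet_derivative \<tau> (at x) v = 0"
  \<comment> \<open>The straight line, projected to \<open>S\<close> along \<open>n\<close>: since
    the derivative of \<open>\<tau>\<close> vanishes in direction \<open>v\<close>, the projection
    does not change the velocity at 0.\<close>
  define c where "c = (\<lambda>t. (x + t *\<^sub>R v) + \<tau> (x + t *\<^sub>R v) *\<^sub>R n)"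
  obtain e where "e > 0" and e: "\<And>t. \<bar>t\<bar> < e \<Longrightarrow> x + t *\<^sub>R v \<in> W"
    using open_line[OF open_W assms(2)] by metis
  have "smooth_on {-e<..<e} c"
    unfolding c_def
  proof (rule smooth_on_graph_line)
    show "smooth_on {-e<..<e} (\<lambda>t. x + t *\<^sub>R v)"
      unfolding smooth_on_def
      by (intro allI C_k_on_add[OF open_greaterThanLessThan] C_k_on_const[OF open_greaterThanLessThan]
          C_k_on_bounded_linear[OF open_greaterThanLessThan bounded_linear_scaleR_left])
  qed (use e in auto)
  moreover have "c ` {-e<..<e} \<subseteq> S" using e by (auto simp: c_def intro!: graph_in)
  moreover have "c 0 = x" using assms in_S_iff by (simp add: c_def)
  moreover have "(c has_vector_derivative v) (at 0)"
  proof -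
    have "((\<lambda>t. \<tau> (x + t *\<^sub>R v)) has_derivative (\<lambda>t. 0)) (at 0)"
      using derivative_line[OF assms(2), of v] v by (simp add: has_field_derivative_def lambda_zero)
    note h = has_derivative_scaleR_left[OF this, of n]
    have "((\<lambda>t. x + t *\<^sub>R v) has_derivative (\<lambda>t. t *\<^sub>R v)) (at 0)"
      by (auto intro!: derivative_eq_intros)
    from has_derivative_add[OF this h] have "(c has_derivative (\<lambda>t. t *\<^sub>R v)) (at 0)"
      by (simp add: c_def)
    then show ?thesis by (simp add: has_vector_derivative_def)
  qed
  ultimately show "v \<in> tangent_space S x" unfolding tangent_space_def using \<open>e > 0\<close> by blast
qed

lemma tangent_space_center: "y \<in> S \<and> tangent_space S y = {v. n \<bullet> v = 0}"
  using center in_S_iff[of y] tangent_space_chart[of y] deriv_center by auto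

text \<open>On \<open>W\<close> the function \<open>\<tau>\<close> is nonnegative exactly on
  \<open>U\<close>, so its gradient \<open>g\<close> points inwards. A unit vector orthogonal to the
  tangent space is \<open>sgn g\<close> or its negative, and the ray in direction
  \<open>sgn g\<close> starts inside \<open>U\<close>, which leaves only one candidate for the
  definite description.\<close>

lemma outer_normal_chart:
  assumes "x \<in> S" "x \<in> W" and g: "\<And>v. frechet_derivative \<tau> (at x) v = g \<bullet> v"
  shows "outer_normal U x = - sgn g"
proof -
  have "g \<noteq> 0" using g[of n] deriv_normal[OF assms(2)] by auto
  then have sg: "norm (sgn g) = 1" "g \<bullet> sgn g = norm g"
    by (auto simp: norm_sgn sgn_div_norm power2_norm_eq_inner[symmetric] power2_eq_square)
  have T: "tangent_space (frontier U) x = {v. g \<bullet> v = 0}"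
    using tangent_space_chart[OF assms(1,2)] g S_def by simp
  have "\<tau> x = 0" using assms in_S_iff by simp
  have sgn_line: "\<exists>e>0. \<forall>t\<in>{0<..<e}. x + t *\<^sub>R v \<in> W \<and> (\<tau> (x + t *\<^sub>R v) < 0 \<longleftrightarrow> g \<bullet> v < 0)"
    if gv: "g \<bullet> v \<noteq> 0" for v
  proof -
    note D = derivative_line[OF assms(2), of v, unfolded g]
    obtain e where "e > 0" and e: "\<And>t. \<bar>t\<bar> < e \<Longrightarrow> x + t *\<^sub>R v \<in> W"
      using open_line[OF open_W assms(2)] by metis
    consider "g \<bullet> v < 0" | "g \<bullet> v > 0" using gv by linarith
    then obtain d where "d > 0" "\<And>t. 0 < t \<Longrightarrow> t < d \<Longrightarrow> \<tau> (x + t *\<^sub>R v) < 0 \<longleftrightarrow> g \<bullet> v < 0"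
    proof cases
      case 1
      then show thesis using DERIV_neg_dec_right[OF D] that \<open>\<tau> x = 0\<close> by auto
    next
      case 2
      then show thesis using DERIV_pos_inc_right[OF D] that \<open>\<tau> x = 0\<close> by (auto dest: order.asym)
    qed
    then show ?thesis using e \<open>e > 0\<close> by (intro exI[of _ "min d e"]) auto
  qed
  show ?thesis
    unfolding outer_normal_def T
  proof (rule the_equality, intro conjI)
    show "\<exists>e>0. \<forall>t\<in>{0<..<e}. x + t *\<^sub>R - sgn g \<notin> U"
    proof -
      have "g \<bullet> - sgn g < 0" using sg \<open>g \<noteq> 0\<close> by simp
      then show ?thesis using sgn_line[of "- sgn g"] in_U_iff by (metis less_irrefl not_le)
    qed
    show "\<forall>v\<in>{v. g \<bullet> v = 0}. - sgn g \<bullet> v = 0" by (simp add: sgn_div_norm)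
    show "norm (- sgn g) = 1" using sg by simp
  next
    fix \<nu> assume \<nu>: "norm \<nu> = 1 \<and> (\<forall>v\<in>{v. g \<bullet> v = 0}. \<nu> \<bullet> v = 0) \<and> (\<exists>e>0. \<forall>t\<in>{0<..<e}. x + t *\<^sub>R \<nu> \<notin> U)"
    define v where "v = \<nu> - (\<nu> \<bullet> sgn g) *\<^sub>R sgn g"
    have sgsg: "sgn g \<bullet> sgn g = 1" using sg(1) by (simp add: norm_eq_1)
    have "sgn g \<bullet> v = 0" by (simp add: v_def inner_diff_right sgsg inner_commute)
    then have "g \<bullet> v = 0" using \<open>g \<noteq> 0\<close> by (simp add: sgn_div_norm)
    then have "\<nu> \<bullet> v = 0" using \<nu> by auto
    then have "v \<bullet> v = 0" using \<open>sgn g \<bullet> v = 0\<close> by (simp add: v_def inner_diff_left)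
    then have eq: "\<nu> = (\<nu> \<bullet> sgn g) *\<^sub>R sgn g" by (simp add: v_def)
    then have "\<bar>\<nu> \<bullet> sgn g\<bar> = 1" using \<nu> sg(1) by (metis norm_scaleR mult_1_right)
    then consider "\<nu> = sgn g" | "\<nu> = - sgn g" using eq by (metis abs_eq_iff' scaleR_minus1_left scaleR_one)
    then show "\<nu> = - sgn g"
    proof cases
      case 1
      obtain e where e: "e > 0" "\<And>t. t \<in> {0<..<e} \<Longrightarrow> x + t *\<^sub>R \<nu> \<notin> U" using \<nu> by blast
      obtain d where d: "d > 0" "\<And>t. t \<in> {0<..<d} \<Longrightarrow> x + t *\<^sub>R \<nu> \<in> W \<and> \<not> \<tau> (x + t *\<^sub>R \<nu>) < 0"
        using sgn_line[of \<nu>] 1 sg(2) \<open>g \<noteq> 0\<close> by auto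
      have "min d e / 2 \<in> {0<..<d}" "min d e / 2 \<in> {0<..<e}" using e(1) d(1) by auto
      then show ?thesis using e(2) d(2) in_U_iff by (meson not_less)
    qed
  qed
qed

lemma outer_normal_center: "outer_normal U y = n"
proof -
  have "outer_normal U y = - sgn (- n)"
    using tangent_space_center center deriv_center by (intro outer_normal_chart) auto
  then show ?thesis using unit by (simp add: sgn_div_norm)
qed

text \<open>Linearity in \<open>w\<close> is part of being a derivative. Linearity in
  \<open>v\<close> needs the expansion of the first derivative on a whole neighbourhood of
  \<open>x\<close> before it is differentiated.\<close>

lemma second_derivative_linear:
  assumes "x \<in> W"
  shows "frechet_derivative (\<lambda>x. frechet_derivative \<tau> (at x) v) (at x) w =
    (\<Sum>b\<in>Basis. (v \<bullet> b) * frechet_derivative (\<lambda>x. frechet_derivative \<tau> (at x) b) (at x) w)"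
proof -
  have "((\<lambda>x. \<Sum>b\<in>Basis. (v \<bullet> b) * frechet_derivative \<tau> (at x) b) has_derivative
      (\<lambda>w. \<Sum>b\<in>Basis. (v \<bullet> b) * frechet_derivative (\<lambda>x. frechet_derivative \<tau> (at x) b) (at x) w)) (at x)"
    by (intro has_derivative_sum has_derivative_mult_right smooth_on_has_derivative[OF smooth_on_Suc[OF smooth] assms])
  moreover have "(\<Sum>b\<in>Basis. (v \<bullet> b) * frechet_derivative \<tau> (at z) b) = frechet_derivative \<tau> (at z) v" if "z \<in> W" for z
    using linear_eq_sum_Basis[OF linear_frechet_derivative[OF smooth_on_differentiable[OF smooth that]], of v] by simp
  ultimately have "((\<lambda>x. frechet_derivative \<tau> (at x) v) has_derivative
      (\<lambda>w. \<Sum>b\<in>Basis. (v \<bullet> b) * frechet_derivative (\<lambda>x. frechet_derivative \<tau> (at x) b) (at x) w)) (at x)"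
    by (rule has_derivative_transform_within_open[OF _ open_W assms])
  from fun_cong[OF frechet_derivative_at[OF this], of w] show ?thesis by (rule sym)
qed

text \<open>On \<open>S\<close> the Gauss map is the negative normalised gradient of
  \<open>\<tau>\<close>. Its derivative at \<open>y\<close>, paired with a tangent vector
  \<open>d\<close>, is minus the second derivative of \<open>\<tau>\<close>: differentiating the
  normalising factor contributes only a multiple of \<open>n\<close>, which is orthogonal to
  \<open>d\<close>.\<close>

lemma second_derivative_neg:
  assumes "strictly_convex U" "d \<noteq> 0" "n \<bullet> d = 0"
  shows "frechet_derivative (\<lambda>x. frechet_derivative \<tau> (at x) d) (at y) d < 0"
proof -
  let ?D2 = "\<lambda>v. frechet_derivative (\<lambda>x. frechet_derivative \<tau> (at x) v) (at y)"
  define G where "G x = (\<Sum>b\<in>Basis. frechet_derivative \<tau> (at x) b *\<^sub>R b)" for x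
  have G: "frechet_derivative \<tau> (at x) v = G x \<bullet> v" if "x \<in> W" for x v
    using linear_eq_sum_Basis[OF linear_frechet_derivative[OF smooth_on_differentiable[OF smooth that]], of v]
    by (simp add: G_def inner_sum_left mult.commute inner_commute[of v])
  have "n \<bullet> G y = n \<bullet> (- n) \<and> v \<bullet> G y = v \<bullet> (- n)" for v
    using G[OF center(1), of v] G[OF center(1), of n] deriv_center[of v] deriv_center[of n] by (simp add: inner_commute)
  then have Gy: "G y = - n" by (metis vector_eq_ldot)
  define G' where "G' h = (\<Sum>b\<in>Basis. ?D2 b h *\<^sub>R b)" for h
  have DG: "(G has_derivative G') (at y)"
    unfolding G_def G'_def
    by (intro has_derivative_sum has_derivative_scaleR_left smooth_on_has_derivative[OF smooth_on_Suc[OF smooth] center(1)])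
  obtain \<phi>' where D\<phi>: "((\<lambda>x. inverse (norm (G x))) has_derivative \<phi>') (at y)"
  proof -
    have "(norm has_derivative (\<lambda>h. h \<bullet> sgn (G y))) (at (G y))" using Gy unit by (intro has_derivative_norm) auto
    from Deriv.has_derivative_inverse[OF _ has_derivative_compose[OF DG this]]
    show thesis using that Gy unit by fastforce
  qed
  define \<nu> where "\<nu> = (\<lambda>x. - (inverse (norm (G x)) *\<^sub>R G x))"
  have D\<nu>: "(\<nu> has_derivative (\<lambda>h. - (inverse (norm (G y)) *\<^sub>R G' h + \<phi>' h *\<^sub>R G y))) (at y)"
    unfolding \<nu>_def by (intro has_derivative_minus has_derivative_scaleR D\<phi> DG)
  define \<nu>' where "\<nu>' h = - (G' h - \<phi>' h *\<^sub>R n)" for h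
  have D\<nu>: "(\<nu> has_derivative \<nu>') (at y)"
    using D\<nu> Gy unit by (simp add: \<nu>'_def[abs_def])
  have \<nu>_eq: "\<nu> x = outer_normal U x" if "x \<in> W" "x \<in> frontier U" for x
    using outer_normal_chart[OF _ that(1) G[OF that(1)]] that S_def by (simp add: \<nu>_def sgn_div_norm)
  have y: "y \<in> S" using tangent_space_center by simp
  have "(outer_normal U has_derivative \<nu>') (at y within frontier U)"
  proof -
    obtain e where "e > 0" "\<And>x. dist x y < e \<Longrightarrow> x \<in> W"
      using open_W center by (auto simp: open_dist)
    then show ?thesis
      using \<nu>_eq y S_def by (intro has_derivative_transform_within[OF has_derivative_at_withinI[OF D\<nu>], of e]) auto
  qed
  \<comment> \<open>Within the frontier a derivative is not unique, because its values on normal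
    vectors are free. Composition with a curve in \<open>S\<close> of velocity \<open>d\<close> pins
    down the value at \<open>d\<close>.\<close>
  then have F: "(outer_normal U has_derivative frechet_derivative (outer_normal U) (at y within frontier U)) (at y within frontier U)"
    using frechet_derivative_works differentiable_def by blast
  have "d \<in> tangent_space S y" using tangent_space_center assms(3) by simp
  then obtain c e where e: "e > 0" and c: "c ` {-e<..<e} \<subseteq> S" "c 0 = y" "(c has_vector_derivative d) (at (0::real))"
    unfolding tangent_space_def by blast
  have Dc: "(c has_derivative (\<lambda>t. t *\<^sub>R d)) (at 0)" using c(3) by (simp add: has_vector_derivative_def)
  have "isCont c 0" using c(3) has_vector_derivative_continuous by blast
  then have "\<forall>\<^sub>F t in nhds 0. c t \<in> W"
    using open_W center c(2) by (intro isCont_eventually_in_open) auto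
  then obtain e1 where e1: "e1 > 0" "\<And>t. dist t 0 < e1 \<Longrightarrow> c t \<in> W" unfolding eventually_nhds_metric by blast
  define m where "m = min e e1"
  have m: "m > 0" "m \<le> e" "m \<le> e1" using e e1 by (auto simp: m_def)
  define I where "I = {- m<..<m}"
  have I: "open I" "0 \<in> I" "c ` I \<subseteq> frontier U" "\<And>t. t \<in> I \<Longrightarrow> c t \<in> W"
    using m e1(2) c(1) S_def by (auto simp: I_def image_subset_iff)
  have "((\<lambda>t. outer_normal U (c t)) has_derivative
      (\<lambda>t. frechet_derivative (outer_normal U) (at y within frontier U) (t *\<^sub>R d))) (at 0 within I)"
    using F c(2) by (intro has_derivative_in_compose[OF has_derivative_at_withinI[OF Dc]] has_derivative_subset[OF _ I(3)]) auto
  then have "((\<lambda>t. outer_normal U (c t)) has_derivative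
      (\<lambda>t. frechet_derivative (outer_normal U) (at y within frontier U) (t *\<^sub>R d))) (at 0)"
    using I at_within_open by metis
  then have "((\<lambda>t. \<nu> (c t)) has_derivative
      (\<lambda>t. frechet_derivative (outer_normal U) (at y within frontier U) (t *\<^sub>R d))) (at 0)"
    by (rule has_derivative_transform_within_open[OF _ I(1,2)]) (use \<nu>_eq I in auto)
  moreover have "((\<lambda>t. \<nu> (c t)) has_derivative (\<lambda>t. \<nu>' (t *\<^sub>R d))) (at 0)"
    using D\<nu> c(2) by (intro has_derivative_compose[OF Dc]) simp
  ultimately have "frechet_derivative (outer_normal U) (at y within frontier U) d = \<nu>' d"
    by (metis has_derivative_unique scaleR_one)
  moreover have "second_fundamental_form U y d d > 0"
    using assms y S_def \<open>d \<in> tangent_space S y\<close> unfolding strictly_convex_def by auto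
  ultimately have "\<nu>' d \<bullet> d > 0" by (simp add: second_fundamental_form_def)
  moreover have "\<nu>' d \<bullet> d = - ?D2 d d"
    using second_derivative_linear[OF center(1), of d d] assms(3)
    by (simp add: \<nu>'_def G'_def inner_diff_right inner_sum_right mult.commute inner_commute[of _ d])
  ultimately show ?thesis by simp
qed

text \<open>Along a tangent line the first derivative of \<open>\<tau>\<close> starts at 0 and has
  negative slope there, so \<open>\<tau>\<close> becomes negative at once.\<close>

lemma tangent_line_leaves:
  assumes "strictly_convex U" "d \<noteq> 0" "n \<bullet> d = 0" "e > 0"
  shows "\<exists>t\<in>{0<..<e}. y + t *\<^sub>R d \<notin> U"
proof -
  let ?D = "\<lambda>x. frechet_derivative \<tau> (at x) d"
  obtain r where "r > 0" and r: "\<And>t. \<bar>t\<bar> < r \<Longrightarrow> y + t *\<^sub>R d \<in> W"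
    using open_line[OF open_W center(1)] by metis
  have "((\<lambda>t::real. y + t *\<^sub>R d) has_derivative (\<lambda>t. t *\<^sub>R d)) (at 0)"
    by (auto intro!: derivative_eq_intros)
  moreover have "(?D has_derivative frechet_derivative ?D (at y)) (at (y + 0 *\<^sub>R d))"
    using smooth_on_has_derivative[OF smooth_on_Suc[OF smooth] center(1)] by simp
  ultimately have "((\<lambda>t. ?D (y + t *\<^sub>R d)) has_derivative (\<lambda>t. frechet_derivative ?D (at y) (t *\<^sub>R d))) (at 0)"
    by (rule has_derivative_compose)
  then have "((\<lambda>t. ?D (y + t *\<^sub>R d)) has_real_derivative frechet_derivative ?D (at y) d) (at 0)"
    by (simp add: has_field_derivative_def mult_commute_abs
        linear_scale[OF linear_frechet_derivative[OF smooth_on_differentiable[OF smooth_on_Suc[OF smooth] center(1)]]])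
  from DERIV_neg_dec_right[OF this second_derivative_neg[OF assms(1-3)]]
  obtain \<delta> where "\<delta> > 0" and \<delta>: "\<And>t. 0 < t \<Longrightarrow> t < \<delta> \<Longrightarrow> ?D (y + t *\<^sub>R d) < 0"
    using deriv_center[of d] assms(3) by auto
  define t where "t = min e (min r \<delta>) / 2"
  have t: "0 < t" "t < e" "t < r" "t < \<delta>" using \<open>e > 0\<close> \<open>r > 0\<close> \<open>\<delta> > 0\<close> by (auto simp: t_def)
  have line: "((\<lambda>t. \<tau> (y + t *\<^sub>R d)) has_real_derivative ?D (y + s *\<^sub>R d)) (at s)" if "\<bar>s\<bar> < r" for s
  proof -
    have "((\<lambda>t. \<tau> (y + s *\<^sub>R d + (t - s) *\<^sub>R d)) has_real_derivative ?D (y + s *\<^sub>R d)) (at s)"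
      using DERIV_shift[of "\<lambda>t. \<tau> (y + s *\<^sub>R d + (t - s) *\<^sub>R d)" _ 0 s] derivative_line[OF r[OF that], of d] by simp
    then show ?thesis by (simp add: algebra_simps)
  qed
  have "\<exists>z>0. z < t \<and> \<tau> (y + t *\<^sub>R d) - \<tau> (y + 0 *\<^sub>R d) = (t - 0) * ?D (y + z *\<^sub>R d)"
    using t by (intro MVT2[of 0 t "\<lambda>s. \<tau> (y + s *\<^sub>R d)" "\<lambda>s. ?D (y + s *\<^sub>R d)"] line) auto
  then obtain z where z: "0 < z" "z < t" "\<tau> (y + t *\<^sub>R d) - \<tau> (y + 0 *\<^sub>R d) = (t - 0) * ?D (y + z *\<^sub>R d)"
    by blast
  have "t * ?D (y + z *\<^sub>R d) < 0" using \<delta>[of z] z(1,2) t by (intro mult_pos_neg) auto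
  then have "\<tau> (y + t *\<^sub>R d) < 0" using z(3) center by simp
  then show ?thesis using in_U_iff[OF r[of t]] t by (intro bexI[of _ t]) auto
qed

end


subsection \<open>Convexity of the billiard table\<close>

text \<open>Strict differentiability: near \<open>y\<close> the difference of \<open>f\<close> and
  its linear part at \<open>y\<close> has small derivative, and the ball is convex. Both
  \<open>a\<close> and \<open>b\<close> are free, as needed when two neighbouring points of a
  configuration are close to \<open>y\<close>.\<close>

lemma smooth_strictly_differentiable:
  fixes f :: "'a::euclidean_space \<Rightarrow> real"
  assumes "open W" "smooth_on W f" "y \<in> W" "\<eta> > 0"
  obtains r where "r > 0" "ball y r \<subseteq> W"
    "\<And>a b. a \<in> ball y r \<Longrightarrow> b \<in> ball y r \<Longrightarrow>
      \<bar>f a - f b - frechet_derivative f (at y) (a - b)\<bar> \<le> \<eta> * norm (a - b)"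
proof -
  let ?f' = "\<lambda>x. frechet_derivative f (at x)"
  have lin: "linear (?f' x)" if "x \<in> W" for x
    using linear_frechet_derivative[OF smooth_on_differentiable[OF assms(2) that]] .
  define s where "s x = (\<Sum>b\<in>Basis. \<bar>?f' x b - ?f' y b\<bar>)" for x
  have "continuous_on W s"
    unfolding s_def by (intro continuous_intros smooth_on_continuous[OF smooth_on_Suc[OF assms(2)]])
  then have "isCont s y" using assms by (simp add: continuous_on_eq_continuous_at)
  moreover have "s y < \<eta>" using \<open>\<eta> > 0\<close> by (simp add: s_def)
  ultimately have "\<forall>\<^sub>F x in nhds y. s x < \<eta> \<and> x \<in> W"
    using eventually_nhds_in_open[OF assms(1,3)] by (intro eventually_conj isCont_eventually_gt(2)) auto
  then obtain r where "r > 0" and r: "\<And>x. dist x y < r \<Longrightarrow> s x < \<eta> \<and> x \<in> W"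
    unfolding eventually_nhds_metric by blast
  have "\<bar>f a - f b - ?f' y (a - b)\<bar> \<le> \<eta> * norm (a - b)" if ab: "a \<in> ball y r" "b \<in> ball y r" for a b
  proof -
    have "norm ((f a - ?f' y a) - (f b - ?f' y b)) \<le> \<eta> * norm (a - b)"
    proof (rule differentiable_bound[OF convex_ball[of y r] _ _ ab])
      fix x assume "x \<in> ball y r"
      then have x: "s x < \<eta>" "x \<in> W" using r[of x] by (auto simp: dist_commute)
      show "((\<lambda>x. f x - ?f' y x) has_derivative (\<lambda>h. ?f' x h - ?f' y h)) (at x within ball y r)"
        by (rule has_derivative_at_withinI, rule has_derivative_diff,
            rule smooth_on_has_derivative[OF assms(2) x(2)], rule linear_imp_has_derivative, rule lin[OF assms(3)])
      show "onorm (\<lambda>h. ?f' x h - ?f' y h) \<le> \<eta>"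
      proof (rule onorm_le)
        fix h
        have "?f' x h - ?f' y h = (\<Sum>b\<in>Basis. (h \<bullet> b) * (?f' x b - ?f' y b))"
          using linear_eq_sum_Basis[OF lin[OF x(2)], of h] linear_eq_sum_Basis[OF lin[OF assms(3)], of h]
          by (simp add: sum_subtractf right_diff_distrib)
        also have "norm \<dots> \<le> (\<Sum>b\<in>Basis. norm h * \<bar>?f' x b - ?f' y b\<bar>)"
          by (rule sum_norm_le) (auto simp: abs_mult Basis_le_norm intro!: mult_right_mono)
        also have "\<dots> = norm h * s x" by (simp add: s_def sum_distrib_left)
        also have "\<dots> \<le> \<eta> * norm h" using mult_left_mono[OF less_imp_le[OF x(1)] norm_ge_zero[of h]] by (simp add: mult.commute)
        finally show "norm (?f' x h - ?f' y h) \<le> \<eta> * norm h" .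
      qed
    qed
    then show ?thesis using lin[OF assms(3)] by (simp add: linear_diff)
  qed
  then show thesis using that[of r] \<open>r > 0\<close> r by (auto simp: subset_iff dist_commute)
qed

locale convex_table =
  fixes S U :: "'a::euclidean_space set"
  assumes hyper: "smooth_hypersurface S" and encl: "encloses S U" and strict: "strictly_convex U"
begin

abbreviation "normal \<equiv> outer_normal U"

lemma S_def: "S = frontier U" and compact_U: "compact U" and closed_U: "closed U"
  and int_ne: "interior U \<noteq> {}" and conn_int: "connected (interior U)" and closure_int: "closure (interior U) = U"
  using encl by (auto simp: encloses_def compact_imp_closed)

lemma S_subset_U: "S \<subseteq> U" and compact_S: "compact S"
  using S_def closed_U compact_U frontier_subset_closed compact_frontier by auto

lemma in_interior_iff: "x \<in> interior U \<longleftrightarrow> x \<in> U \<and> x \<notin> S"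
  using S_def closed_U interior_subset by (auto simp: frontier_def)

lemma chart: "y \<in> S \<Longrightarrow> \<exists>W \<tau>. boundary_chart S U y (normal y) W \<tau>"
  using boundary_chart_exists[OF hyper encl] boundary_chart.outer_normal_center by metis

lemma norm_normal: "y \<in> S \<Longrightarrow> norm (normal y) = 1"
  using chart boundary_chart.unit by blast

lemma tangent_space: "y \<in> S \<Longrightarrow> tangent_space S y = {v. normal y \<bullet> v = 0}"
  using chart boundary_chart.tangent_space_center by blast

text \<open>A tangent direction leaves \<open>U\<close> at arbitrarily small times by strict
  convexity, an outward one because \<open>\<tau>\<close> decreases along it; only inward directions
  remain.\<close>

lemma chord_transversal:
  assumes "y \<in> S" "d \<noteq> 0" "e > 0" "\<And>t. 0 < t \<Longrightarrow> t < e \<Longrightarrow> y + t *\<^sub>R d \<in> U"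
  shows "normal y \<bullet> d < 0"
proof (rule ccontr)
  assume "\<not> ?thesis"
  then consider "normal y \<bullet> d = 0" | "normal y \<bullet> d > 0" by linarith
  then show False
  proof cases
    case 1
    then show False
      using chart[OF assms(1)] boundary_chart.tangent_line_leaves[OF _ strict assms(2) _ assms(3)] assms(4) by force
  next
    case 2
    obtain W \<tau> where c: "boundary_chart S U y (normal y) W \<tau>" using chart[OF assms(1)] by blast
    interpret boundary_chart S U y "normal y" W \<tau> by (rule c)
    obtain r where r: "r > 0" "\<And>t. \<bar>t\<bar> < r \<Longrightarrow> y + t *\<^sub>R d \<in> W"
      using open_line[OF open_W center(1)] by metis
    from DERIV_neg_dec_right[OF derivative_line[OF center(1), of d]]
    obtain \<delta> where \<delta>: "\<delta> > 0" "\<And>t. 0 < t \<Longrightarrow> t < \<delta> \<Longrightarrow> \<tau> (y + t *\<^sub>R d) < 0"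
      using 2 deriv_center center by auto
    define t where "t = min e (min r \<delta>) / 2"
    have "0 < t" "t < e" "t < r" "t < \<delta>" using assms(3) r(1) \<delta>(1) by (auto simp: t_def)
    then show False using assms(4)[of t] \<delta>(2)[of t] in_U_iff[OF r(2)[of t]] by auto
  qed
qed

text \<open>By transversality both \<open>d\<close> and \<open>- d\<close> would point
  inwards.\<close>

lemma no_segment_through_boundary:
  assumes "y \<in> S" "d \<noteq> 0" "e > 0" "\<And>t. \<bar>t\<bar> < e \<Longrightarrow> y + t *\<^sub>R d \<in> U"
  shows False
proof -
  have "normal y \<bullet> d < 0" by (rule chord_transversal[OF assms(1-3)]) (use assms(4) in auto)
  moreover have "normal y \<bullet> (- d) < 0"
  proof (rule chord_transversal[OF assms(1) _ assms(3)])
    show "y + t *\<^sub>R - d \<in> U" if "0 < t" "t < e" for t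
      using assms(4)[of "- t"] that by auto
  qed (use assms(2) in auto)
  ultimately show False by simp
qed

lemma segment_point_in_interior:
  assumes "a \<noteq> b" "\<And>t. 0 \<le> t \<Longrightarrow> t \<le> 1 \<Longrightarrow> a + t *\<^sub>R (b - a) \<in> U" "0 < t" "t < 1"
  shows "a + t *\<^sub>R (b - a) \<in> interior U"
proof (rule ccontr)
  assume "a + t *\<^sub>R (b - a) \<notin> interior U"
  then have "a + t *\<^sub>R (b - a) \<in> S" using assms in_interior_iff by auto
  then show False
  proof (rule no_segment_through_boundary)
    show "b - a \<noteq> 0" "min t (1 - t) > 0" using assms by auto
    show "a + t *\<^sub>R (b - a) + s *\<^sub>R (b - a) \<in> U" if "\<bar>s\<bar> < min t (1 - t)" for s
    proof -
      have "0 \<le> t + s" "t + s \<le> 1" using that by linarith+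
      then show ?thesis using assms(2)[of "t + s"] by (simp add: scaleR_add_left add.assoc)
    qed
  qed
qed

text \<open>The pairs of interior points whose connecting segment is interior form an open set, and also
  a closed one: a limit of such segments stays in \<open>U\<close>, so it cannot touch \<open>S\<close> in an inner point.\<close>

lemma convex_interior: "convex (interior U)"
proof -
  let ?I = "interior U"
  define R where "R = {z \<in> ?I \<times> ?I. \<forall>t\<in>{0..1}. fst z + t *\<^sub>R (snd z - fst z) \<in> ?I}"
  have cont: "continuous_on UNIV (\<lambda>p. fst (fst p) + snd p *\<^sub>R (snd (fst p) - fst (fst p)) :: 'a)"
    by (intro continuous_intros)
  define P where "P = (\<lambda>p. fst (fst p) + snd p *\<^sub>R (snd (fst p) - fst (fst p))) -` ?I"
  have "open P" unfolding P_def by (intro open_vimage cont) auto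
  have "open R"
  proof (subst open_subopen, intro ballI)
    fix z assume "z \<in> R"
    then have z: "z \<in> ?I \<times> ?I" "{z} \<times> {0..1} \<subseteq> P" by (auto simp: R_def P_def)
    obtain X where "z \<in> X" "open X" "X \<times> {0..1} \<subseteq> P"
      using Elementary_Topology.tube_lemma[OF compact_Icc \<open>open P\<close> z(2)] by blast
    then show "\<exists>T. open T \<and> z \<in> T \<and> T \<subseteq> R"
      using z(1) by (intro exI[of _ "X \<inter> ?I \<times> ?I"]) (auto simp: R_def P_def open_Times intro!: open_Int)
  qed
  have closed: "closed {z. \<forall>t\<in>{0..1}. fst z + t *\<^sub>R (snd z - fst z) \<in> U}"
  proof -
    have "{z. \<forall>t\<in>{0..1}. fst z + t *\<^sub>R (snd z - fst z) \<in> U} =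
        (\<Inter>t\<in>{0..1}. (\<lambda>z. fst z + t *\<^sub>R (snd z - fst z)) -` U)" by auto
    also have "closed \<dots>"
      by (intro closed_INT ballI closed_vimage closed_U continuous_intros)
    finally show ?thesis .
  qed
  have R: "R = (?I \<times> ?I) \<inter> {z. \<forall>t\<in>{0..1}. fst z + t *\<^sub>R (snd z - fst z) \<in> U}"
  proof (intro equalityI subsetI)
    fix z assume "z \<in> R"
    then show "z \<in> (?I \<times> ?I) \<inter> {z. \<forall>t\<in>{0..1}. fst z + t *\<^sub>R (snd z - fst z) \<in> U}"
      using interior_subset by (auto simp: R_def)
  next
    fix z assume z: "z \<in> (?I \<times> ?I) \<inter> {z. \<forall>t\<in>{0..1}. fst z + t *\<^sub>R (snd z - fst z) \<in> U}"
    have "fst z + t *\<^sub>R (snd z - fst z) \<in> ?I" if "t \<in> {0..1}" for t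
    proof (cases "t = 0 \<or> t = 1 \<or> fst z = snd z")
      case True
      then show ?thesis using z by auto
    next
      case False
      then show ?thesis using z that by (intro segment_point_in_interior) auto
    qed
    then show "z \<in> R" using z by (auto simp: R_def)
  qed
  have "connected (?I \<times> ?I)" using conn_int by (intro connected_Times)
  moreover have "openin (top_of_set (?I \<times> ?I)) R"
    using \<open>open R\<close> by (intro open_openin_trans open_Times) (auto simp: R_def)
  moreover have "closedin (top_of_set (?I \<times> ?I)) R"
    unfolding R using closed by (rule closedin_closed_Int)
  ultimately have "R = {} \<or> R = ?I \<times> ?I" unfolding connected_clopen by blast
  moreover have "R \<noteq> {}"
  proof -
    obtain x where "x \<in> ?I" using int_ne by blast
    then have "(x, x) \<in> R" by (auto simp: R_def)
    then show ?thesis by blast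
  qed
  ultimately have "(a, b) \<in> R" if "a \<in> ?I" "b \<in> ?I" for a b using that by blast
  then show ?thesis
    unfolding convex_alt R_def by (force simp: algebra_simps)
qed

lemma convex_U: "convex U"
  using convex_closure[OF convex_interior] closure_int by simp

lemma chord_interior:
  assumes "a \<in> U" "b \<in> U" "a \<noteq> b" "0 < t" "t < 1"
  shows "a + t *\<^sub>R (b - a) \<in> interior U"
proof (rule segment_point_in_interior[OF assms(3) _ assms(4,5)])
  show "a + t *\<^sub>R (b - a) \<in> U" if "0 \<le> t" "t \<le> 1" for t
    using convexD[OF convex_U assms(1,2), of "1 - t" t] that by (simp add: algebra_simps)
qed

lemma chord_normal:
  assumes "a \<in> S" "b \<in> U" "a \<noteq> b"
  shows "normal a \<bullet> (b - a) < 0"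
  using chord_transversal[OF assms(1), of "b - a" 1] chord_interior[of a b] assms S_subset_U interior_subset[of U] by auto

text \<open>In this form the theorems on boundaries of bounded convex sets apply to \<open>S\<close>
  and yield its local and global path connectedness.\<close>

lemma S_rel_frontier: "S = rel_frontier U"
  using rel_frontier_nonempty_interior[OF int_ne] S_def by simp

lemma locally_path_connected_S: "locally path_connected S"
  unfolding S_rel_frontier by (intro locally_path_connected_sphere_gen compact_imp_bounded compact_U convex_U)

lemma path_connected_S: "DIM('a) \<noteq> 1 \<Longrightarrow> path_connected S"
  unfolding S_rel_frontier
  by (intro path_connected_sphere_gen compact_imp_bounded compact_U convex_U)
     (simp add: aff_dim_nonempty_interior[OF int_ne])

text \<open>\<open>m\<close> adds a vector tangent at \<open>y\<close> and projects back to
  \<open>S\<close> along the normal at \<open>y\<close>. The same vectors serve all base points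
  \<open>a\<close> near \<open>y\<close>, so \<open>m\<close> lives on a product; its error is small
  because the derivative of \<open>\<tau>\<close> at \<open>y\<close> vanishes on these vectors. The
  last property says that short chords near \<open>y\<close> are almost tangent.\<close>

lemma push:
  assumes "y \<in> S" "\<eta> > 0"
  obtains r m where "r > 0"
    "\<And>a v. a \<in> S \<inter> ball y r \<Longrightarrow> normal y \<bullet> v = 0 \<Longrightarrow> norm v < r \<Longrightarrow>
      m (a, v) \<in> S \<and> norm (m (a, v) - a - v) \<le> \<eta> * norm v"
    "continuous_on ((S \<inter> ball y r) \<times> {v. normal y \<bullet> v = 0 \<and> norm v < r}) m"
    "\<And>a b. a \<in> S \<inter> ball y r \<Longrightarrow> b \<in> S \<inter> ball y r \<Longrightarrow> \<bar>normal y \<bullet> (a - b)\<bar> \<le> \<eta> * norm (a - b)"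
proof -
  obtain W \<tau> where c: "boundary_chart S U y (normal y) W \<tau>" using chart[OF assms(1)] by blast
  interpret boundary_chart S U y "normal y" W \<tau> by (rule c)
  obtain R where "R > 0" and RW: "ball y R \<subseteq> W"
    and R: "\<And>a b. a \<in> ball y R \<Longrightarrow> b \<in> ball y R \<Longrightarrow> \<bar>\<tau> a - \<tau> b + normal y \<bullet> (a - b)\<bar> \<le> \<eta> * norm (a - b)"
    using smooth_strictly_differentiable[OF open_W smooth center(1) assms(2)] deriv_center by auto
  define m where "m = (\<lambda>p. fst p + snd p + \<tau> (fst p + snd p) *\<^sub>R normal y)"
  have inb: "a + v \<in> ball y R" "a \<in> ball y R" if "a \<in> S \<inter> ball y (R/2)" "norm v < R/2" for a v
  proof -
    have "norm (a - y) < R/2" using that by (simp add: dist_norm norm_minus_commute)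
    moreover have "norm (a + v - y) \<le> norm (a - y) + norm v"
      using norm_triangle_ineq[of "a - y" v] by (simp add: algebra_simps)
    moreover have "norm v \<ge> 0" by simp
    ultimately have "norm (a + v - y) < R" "norm (a - y) < R" using that(2) by linarith+
    then show "a + v \<in> ball y R" "a \<in> ball y R" by (auto simp: dist_norm norm_minus_commute)
  qed
  have \<tau>0: "\<tau> a = 0" if "a \<in> S \<inter> ball y R" for a using in_S_iff[of a] RW that by auto
  show thesis
  proof (rule that[of "R/2" m])
    show "R/2 > 0" using \<open>R > 0\<close> by simp
    show "m (a, v) \<in> S \<and> norm (m (a, v) - a - v) \<le> \<eta> * norm v"
      if "a \<in> S \<inter> ball y (R/2)" "normal y \<bullet> v = 0" "norm v < R/2" for a v
      using graph_in[of "a + v"] R[of "a + v" a] inb[OF that(1,3)] RW that \<tau>0[of a] unit by (auto simp: m_def)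
    show "continuous_on ((S \<inter> ball y (R/2)) \<times> {v. normal y \<bullet> v = 0 \<and> norm v < R/2}) m"
      unfolding m_def
      by (intro continuous_intros continuous_on_compose2[OF smooth_on_continuous[OF smooth]])
         (use inb RW in auto)
    show "\<bar>normal y \<bullet> (a - b)\<bar> \<le> \<eta> * norm (a - b)"
      if "a \<in> S \<inter> ball y (R/2)" "b \<in> S \<inter> ball y (R/2)" for a b
      using R[of a b] \<tau>0[of a] \<tau>0[of b] inb[OF that(1), of 0] inb[OF that(2), of 0] \<open>R > 0\<close> that by auto
  qed
qed

end


subsection \<open>A mountain pass theorem\<close>

text \<open>A passable point of level \<open>c\<close> is no obstruction to connecting points of \<open>{L > c}\<close>.\<close>

definition passable :: "'x::topological_space set \<Rightarrow> ('x \<Rightarrow> real) \<Rightarrow> real \<Rightarrow> 'x \<Rightarrow> bool" where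
  "passable X L c z \<longleftrightarrow>
     (\<forall>G. open G \<longrightarrow> z \<in> G \<longrightarrow> (\<exists>y\<in>X \<inter> G. L y > c)) \<and>
     (\<exists>G. open G \<and> z \<in> G \<and>
        (\<forall>a\<in>X \<inter> G. \<forall>b\<in>X \<inter> G. L a > c \<longrightarrow> L b > c \<longrightarrow> path_component {y \<in> X. L y > c} a b))"

text \<open>Path connectedness im kleinen at every point: \<open>P\<close> is a path connected
  neighbourhood of \<open>z\<close> in \<open>X\<close> and need not be open.\<close>

definition weakly_lpc :: "'x::topological_space set \<Rightarrow> bool" where
  "weakly_lpc X \<longleftrightarrow> (\<forall>G z. open G \<longrightarrow> z \<in> X \<inter> G \<longrightarrow>
     (\<exists>V P. open V \<and> z \<in> V \<and> path_connected P \<and> X \<inter> V \<subseteq> P \<and> P \<subseteq> X \<inter> G))"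

text \<open>Suppose the conclusion fails: every point above \<open>c0\<close> is passable or is a
  local maximum in \<open>C\<close>. Let \<open>cs\<close> be the supremum of the levels above which
  \<open>x\<close> and \<open>x'\<close> are joined by a path. Then the closure of the path
  component of \<open>x\<close> above \<open>cs\<close>, with \<open>x\<close> added, is relatively
  open in \<open>{L \<ge> cs}\<close>. So this set and its complement there have disjoint open
  neighbourhoods, outside of which \<open>L\<close> is at most some \<open>c < cs\<close>; a path
  from \<open>x\<close> to \<open>x'\<close> above \<open>c\<close> would be split by them.\<close>

lemma mountain_pass:
  fixes X :: "'x::metric_space set" and L :: "'x \<Rightarrow> real"
  assumes X: "compact X" "weakly_lpc X" and L: "continuous_on X L"
    and x: "x \<in> X" "x' \<in> X" "x \<noteq> x'" and max: "\<And>y. y \<in> X \<Longrightarrow> L y \<le> L x" "L x' = L x"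
    and c0: "path_component {y \<in> X. L y > c0} x x'" and "finite C"
    and pass: "\<And>z. z \<in> X \<Longrightarrow> z \<notin> C \<Longrightarrow> L z > c0 \<Longrightarrow> passable X L (L z) z"
  obtains z where "z \<in> C" "z \<in> X" "L z > c0" "\<not> passable X L (L z) z"
    "\<And>G. open G \<Longrightarrow> z \<in> G \<Longrightarrow> \<exists>y\<in>X \<inter> G. L y > L z"
proof (rule ccontr)
  assume "\<not> thesis"
  with that have alt: "passable X L (L z) z \<or> (\<exists>G. open G \<and> z \<in> G \<and> (\<forall>y\<in>X \<inter> G. L y \<le> L z))"
    if "z \<in> C" "z \<in> X" "L z > c0" for z
    using that by (meson not_le)
  let ?A = "\<lambda>c. path_component {y \<in> X. L y > c} x x'"
  have A_lt: "c < L x" if "?A c" for c using path_component_mem(1)[OF that] by simp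
  have A_mono: "?A c" if "?A d" "c \<le> d" for c d
    by (rule path_component_of_subset[OF _ that(1)]) (use that(2) in auto)
  define cs where "cs = Sup (Collect ?A)"
  have bdd: "bdd_above (Collect ?A)" by (rule bdd_aboveI[of _ "L x"]) (simp add: A_lt less_imp_le)
  have below: "?A c" if "c < cs" for c
  proof -
    have "Collect ?A \<noteq> {}" using c0 by blast
    then obtain d where "d \<in> Collect ?A" "c < d" using less_cSupE[of c "Collect ?A"] \<open>c < cs\<close> unfolding cs_def by blast
    then show ?thesis using A_mono[of d c] by simp
  qed
  \<comment> \<open>The supremum is not attained: on a compact path in \<open>{L > c}\<close> the
    minimum of \<open>L\<close> exceeds \<open>c\<close>, so the level can be raised halfway towards
    it.\<close>
  have A_less: "c < cs" if Ac: "?A c" for c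
  proof -
    obtain g where g: "path g" "path_image g \<subseteq> {y \<in> X. L y > c}" "pathstart g = x" "pathfinish g = x'"
      using Ac unfolding path_component_def by blast
    have "continuous_on (path_image g) L" using g(2) L by (auto intro: continuous_on_subset)
    then obtain y where y: "y \<in> path_image g" "\<And>u. u \<in> path_image g \<Longrightarrow> L y \<le> L u"
      using continuous_attains_inf[OF compact_path_image[OF g(1)] path_image_nonempty] by blast
    have "L y > c" using y(1) g(2) by auto
    then have "path_image g \<subseteq> {u \<in> X. L u > (L y + c) / 2}" using y(2) g(2) by fastforce
    then have "?A ((L y + c) / 2)" using g unfolding path_component_def by blast
    then have "(L y + c) / 2 \<le> cs" unfolding cs_def by (intro cSup_upper bdd) auto
    then show ?thesis using \<open>L y > c\<close> by simp
  qed
  have "c0 < cs" using A_less c0 by blast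
  have notA: "\<not> ?A cs" using A_less by blast
  have "cs \<le> L x" unfolding cs_def by (rule cSup_least) (use c0 A_lt in \<open>auto intro: less_imp_le\<close>)
  define Q where "Q = {y \<in> X. L y > cs}"
  define W where "W = Collect (path_component Q x)"
  have WQ: "W \<subseteq> Q" using path_component_mem(2) by (auto simp: W_def)
  define K where "K = {y \<in> X. L y \<ge> cs}"
  have "compact K"
  proof -
    have "closedin (top_of_set X) (X \<inter> L -` {cs..})" using L by (intro continuous_closedin_preimage) auto
    moreover have "X \<inter> L -` {cs..} = K" by (auto simp: K_def)
    ultimately show ?thesis using X(1) closedin_compact by metis
  qed
  have clW: "closure W \<subseteq> K"
    using WQ \<open>compact K\<close> by (intro closure_minimal compact_imp_closed) (auto simp: K_def Q_def)
  have x_top: "W = {}" if "L x = cs"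
    using that path_component_mem(1)[of Q x] by (auto simp: W_def Q_def)
  have upper: "\<exists>G. open G \<and> y \<in> G \<and> X \<inter> G \<subseteq> W" if y: "y \<in> closure W" "L y > cs" for y
  proof -
    have "openin (top_of_set X) (X \<inter> L -` {cs<..})" using L by (intro continuous_openin_preimage_gen) auto
    then obtain G where G: "open G" "X \<inter> L -` {cs<..} = X \<inter> G" unfolding openin_open by blast
    have "y \<in> X \<inter> G" using y clW G(2) by (auto simp: K_def)
    then obtain V P where V: "open V" "y \<in> V" "path_connected P" "X \<inter> V \<subseteq> P" "P \<subseteq> X \<inter> G"
      using X(2) G(1) unfolding weakly_lpc_def by meson
    have "P \<subseteq> Q" using V(5) G(2) by (auto simp: Q_def)
    obtain w where w: "w \<in> W" "w \<in> V"
      using y(1) V(1,2) by (meson closure_iff_nhds_not_empty disjoint_iff subset_refl)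
    then have "w \<in> P" using WQ V(4) by (auto simp: Q_def)
    have "X \<inter> V \<subseteq> W"
    proof
      fix u assume "u \<in> X \<inter> V"
      then have "path_component P w u" using V(3,4) \<open>w \<in> P\<close> path_connected_component by blast
      then have "path_component Q w u" using path_component_of_subset[OF \<open>P \<subseteq> Q\<close>] by blast
      then show "u \<in> W" using w(1) by (auto simp: W_def intro: path_component_trans)
    qed
    then show ?thesis using V by blast
  qed
  \<comment> \<open>If \<open>L x = cs\<close>, then \<open>W\<close> is empty, and \<open>x\<close>
    has to be put in separately.\<close>
  define A where "A = insert x (closure W)"
  have AK: "A \<subseteq> K" using clW x \<open>cs \<le> L x\<close> by (auto simp: A_def K_def)
  have A_open: "\<exists>G. open G \<and> y \<in> G \<and> K \<inter> G \<subseteq> A" if "y \<in> A" for y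
  proof -
    have yX: "y \<in> X" "L y \<ge> cs" using that AK by (auto simp: K_def)
    show ?thesis
    proof (cases "L y > cs")
      case True
      have "y \<in> closure W"
      proof (cases "y = x")
        case yx: True
        then have "x \<in> Q" using x True by (simp add: Q_def)
        then have "x \<in> W" by (simp add: W_def path_component_refl)
        then show ?thesis using yx closure_subset by blast
      qed (use that in \<open>simp add: A_def\<close>)
      then obtain G where "open G" "y \<in> G" "X \<inter> G \<subseteq> W" using upper True by blast
      then show ?thesis using closure_subset[of W] by (intro exI[of _ G]) (auto simp: A_def K_def)
    next
      case False
      then have Ly: "L y = cs" using yX by simp
      have other: "passable X L cs z" if "z \<in> X" "L z = cs" "z \<notin> C" for z
        using pass[of z] that \<open>c0 < cs\<close> by simp
      have "open (- (C - {y}))" using \<open>finite C\<close> finite_imp_closed[of "C - {y}"] open_Compl by blast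
      show ?thesis
      proof (cases "passable X L cs y")
        case True
        \<comment> \<open>A passable point has higher points nearby, so \<open>y\<close> cannot be
          the maximum \<open>x\<close>.\<close>
        have "y \<in> closure W"
        proof (cases "y = x")
          case True': True
          then show ?thesis using True max(1) Ly unfolding passable_def
            by (metis IntD1 UNIV_I leD open_UNIV)
        qed (use that in \<open>simp add: A_def\<close>)
        obtain G where G: "open G" "y \<in> G"
          "\<And>a b. a \<in> X \<inter> G \<Longrightarrow> b \<in> X \<inter> G \<Longrightarrow> L a > cs \<Longrightarrow> L b > cs \<Longrightarrow> path_component Q a b"
          using True unfolding passable_def Q_def by blast
        \<comment> \<open>As \<open>C\<close> is finite, its other points can be removed: every
          point of level \<open>cs\<close> left in \<open>G'\<close>, except possibly
          \<open>y\<close>, is passable and hence a limit of points above \<open>cs\<close> in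
          \<open>G'\<close>, which all belong to \<open>W\<close>.\<close>
        define G' where "G' = G \<inter> - (C - {y})"
        have G': "open G'" "y \<in> G'"
          using open_Int[OF G(1) \<open>open (- (C - {y}))\<close>] G(2) unfolding G'_def by blast+
        obtain w where "w \<in> W" "w \<in> G'"
          using \<open>y \<in> closure W\<close> G' by (meson closure_iff_nhds_not_empty disjoint_iff subset_refl)
        have up: "z \<in> W" if "z \<in> X" "z \<in> G'" "L z > cs" for z
        proof -
          have "path_component Q w z"
            using G(3)[of w z] \<open>w \<in> W\<close> \<open>w \<in> G'\<close> WQ that by (auto simp: G'_def Q_def)
          then show ?thesis using \<open>w \<in> W\<close> by (auto simp: W_def intro: path_component_trans)
        qed
        have "z \<in> A" if zK: "z \<in> K" "z \<in> G'" for z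
        proof (cases "L z > cs")
          case True
          then show ?thesis using up that closure_subset[of W] by (auto simp: A_def K_def)
        next
          case False
          then have "L z = cs" "z \<in> X" using that by (auto simp: K_def)
          show ?thesis
          proof (cases "z = y")
            case False
            then have "z \<notin> C" using that by (auto simp: G'_def)
            then have "passable X L cs z" using other \<open>L z = cs\<close> \<open>z \<in> X\<close> by blast
            have "z \<in> closure W"
              unfolding closure_iff_nhds_not_empty
            proof (intro allI impI)
              fix B V assume "V \<subseteq> B" "open V" "z \<in> V"
              then obtain u where "u \<in> X \<inter> (V \<inter> G')" "L u > cs"
                using \<open>passable X L cs z\<close> G'(1) zK(2) unfolding passable_def by (meson IntI open_Int)
              then show "W \<inter> B \<noteq> {}" using up \<open>V \<subseteq> B\<close> by blast
            qed
            then show ?thesis by (simp add: A_def)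
          qed (use \<open>y \<in> A\<close> in simp)
        qed
        then show ?thesis using G' by blast
      next
        case False
        then have "y \<in> C" using other yX(1) Ly by blast
        then obtain G where G: "open G" "y \<in> G" "\<And>u. u \<in> X \<inter> G \<Longrightarrow> L u \<le> cs"
          using alt[of y] yX(1) Ly False \<open>c0 < cs\<close> by auto
        have "y \<notin> closure W"
        proof
          assume "y \<in> closure W"
          then obtain w where "w \<in> W" "w \<in> G"
            using G by (meson closure_iff_nhds_not_empty disjoint_iff subset_refl)
          then show False using G(3)[of w] WQ by (auto simp: Q_def)
        qed
        \<comment> \<open>A local maximum of level \<open>cs\<close> is no limit of
          \<open>W\<close>, so it is \<open>x\<close> itself. Any other point of \<open>K\<close>
          close to it has level \<open>cs\<close> and lies outside \<open>C\<close>, so it would be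
          passable and have points above \<open>cs\<close> nearby, against the local
          maximality.\<close>
        then have "y = x" using that by (simp add: A_def)
        have "z = x" if zK: "z \<in> K" "z \<in> G \<inter> - (C - {y})" for z
        proof (rule ccontr)
          assume "z \<noteq> x"
          have "L z = cs" "z \<in> X" using that G(3)[of z] by (auto simp: K_def)
          then have "passable X L cs z" using other[of z] that \<open>z \<noteq> x\<close> \<open>y = x\<close> by auto
          then obtain u where "u \<in> X \<inter> G" "L u > cs" using G(1) zK(2) unfolding passable_def by blast
          then show False using G(3)[of u] by simp
        qed
        then show ?thesis
          using open_Int[OF G(1) \<open>open (- (C - {y}))\<close>] G(2) unfolding A_def by blast
      qed
    qed
  qed
  define B where "B = K - A"
  have "closed B"
  proof -
    obtain G where G: "\<And>y. y \<in> A \<Longrightarrow> open (G y) \<and> y \<in> G y \<and> K \<inter> G y \<subseteq> A" using A_open by metis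
    have "B = K - (\<Union>y\<in>A. G y)" using G by (auto simp: B_def)
    then show ?thesis using G \<open>compact K\<close> by (simp add: compact_imp_closed closed_Diff open_UN)
  qed
  have "compact B" using \<open>closed B\<close> \<open>compact K\<close> by (metis B_def Diff_subset closed_Int_compact inf.absorb1 inf_commute)
  \<comment> \<open>If \<open>x'\<close> were in the closure of \<open>W\<close>, then
    \<open>W\<close> would be nonempty, the level of \<open>x'\<close> would exceed
    \<open>cs\<close>, and \<open>x'\<close> would belong to \<open>W\<close>; but the supremum is
    not attained.\<close>
  have "x' \<in> B"
  proof -
    have "x' \<notin> closure W"
    proof
      assume x'W: "x' \<in> closure W"
      then have "cs \<noteq> L x" using x_top by auto
      then have "L x' > cs" using \<open>cs \<le> L x\<close> max(2) by simp
      then have "x' \<in> W" using upper[OF x'W] x(2) by blast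
      then show False using notA by (simp add: W_def Q_def)
    qed
    then show ?thesis using x max(2) \<open>cs \<le> L x\<close> by (auto simp: B_def A_def K_def)
  qed
  have "closed A" by (simp add: A_def)
  have "continuous_on B (\<lambda>b. infdist b A)" by (intro continuous_intros)
  then obtain b0 where b0: "b0 \<in> B" "\<And>b. b \<in> B \<Longrightarrow> infdist b0 A \<le> infdist b A"
    using continuous_attains_inf[OF \<open>compact B\<close>] \<open>x' \<in> B\<close> by blast
  define d where "d = infdist b0 A"
  have d: "d > 0" "\<And>a b. a \<in> A \<Longrightarrow> b \<in> B \<Longrightarrow> d \<le> dist a b"
  proof -
    show "d > 0" unfolding d_def
      by (rule infdist_pos_not_in_closed[OF \<open>closed A\<close>]) (use b0(1) in \<open>auto simp: A_def B_def\<close>)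
    show "d \<le> dist a b" if "a \<in> A" "b \<in> B" for a b
      using b0(2)[OF that(2)] infdist_le[OF that(1), of b] by (simp add: d_def dist_commute)
  qed
  define GA where "GA = (\<Union>a\<in>A. ball a (d/2))"
  define GB where "GB = (\<Union>b\<in>B. ball b (d/2))"
  have "GA \<inter> GB = {}"
  proof -
    have False if "a \<in> A" "b \<in> B" "dist a u < d/2" "dist b u < d/2" for a b u
      using d(2)[OF that(1,2)] dist_triangle2[of a b u] that(3,4) by linarith
    then show ?thesis by (auto simp: GA_def GB_def)
  qed
  have AG: "A \<subseteq> GA" "B \<subseteq> GB" using d(1) by (auto simp: GA_def GB_def)
  have opG: "open GA" "open GB" by (auto simp: GA_def GB_def)
  \<comment> \<open>\<open>R\<close> is compact and misses \<open>K\<close>, so the maximum of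
    \<open>L\<close> on it is strictly below \<open>cs\<close>.\<close>
  define R where "R = X - (GA \<union> GB)"
  have "compact R" unfolding R_def using X(1) opG by (intro compact_diff) auto
  have R_lt: "L u < cs" if "u \<in> R" for u
    using that AG AK by (force simp: R_def B_def K_def)
  obtain c where "c < cs" "\<And>u. u \<in> R \<Longrightarrow> L u \<le> c"
  proof (cases "R = {}")
    case True
    then show thesis using that[of "cs - 1"] by simp
  next
    case False
    have "continuous_on R L" using L by (rule continuous_on_subset) (auto simp: R_def)
    then obtain u where "u \<in> R" "\<And>v. v \<in> R \<Longrightarrow> L v \<le> L u"
      using continuous_attains_sup[OF \<open>compact R\<close> False] by blast
    then show thesis using that[of "L u"] R_lt by blast
  qed
  then obtain g where g: "path g" "path_image g \<subseteq> {y \<in> X. L y > c}" "pathstart g = x" "pathfinish g = x'"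
    using below unfolding path_component_def by blast
  have sub: "path_image g \<subseteq> GA \<union> GB"
  proof
    fix u assume "u \<in> path_image g"
    then have "u \<in> X" "L u > c" using g(2) by auto
    then show "u \<in> GA \<union> GB" using \<open>\<And>u. u \<in> R \<Longrightarrow> L u \<le> c\<close>[of u] by (auto simp: R_def)
  qed
  have "x \<in> path_image g" "x' \<in> path_image g"
    using g(3,4) pathstart_in_path_image pathfinish_in_path_image by metis+
  moreover have "x \<in> GA" "x' \<in> GB" using AG \<open>x' \<in> B\<close> by (auto simp: A_def)
  ultimately show False
    using connectedD[OF connected_path_image[OF g(1)] opG] \<open>GA \<inter> GB = {}\<close> sub by blast
qed

text \<open>Read \<open>M (y, v)\<close> as \<open>y\<close> moved by \<open>v\<close>. Over a
  neighbourhood of \<open>z\<close> the full moves with \<open>u \<in> K\<close> form a roof above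
  the level of \<open>z\<close>, by compactness of \<open>K\<close>; the roof is path connected as
  the image of a product. A point above this level near \<open>z\<close> climbs to the roof along a
  direction in which \<open>L\<close> does not fall below its initial value. One such direction per
  point is enough, and it may depend discontinuously on the point.\<close>

lemma passable_of_mover:
  fixes X :: "'x::metric_space set" and L :: "'x \<Rightarrow> real" and M :: "'x \<times> 'v::real_normed_vector \<Rightarrow> 'x"
  assumes X: "weakly_lpc X" and L: "continuous_on X L" and z: "z \<in> X"
    and K: "compact K" "path_connected K" "K \<noteq> {}"
    and star: "\<And>u t. u \<in> K \<Longrightarrow> 0 \<le> t \<Longrightarrow> t \<le> 1 \<Longrightarrow> t *\<^sub>R u \<in> V"
    and G0: "open G0" "z \<in> G0"
    and M: "continuous_on ((X \<inter> G0) \<times> V) M" "\<And>y v. y \<in> X \<Longrightarrow> y \<in> G0 \<Longrightarrow> v \<in> V \<Longrightarrow> M (y, v) \<in> X"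
      "\<And>y. y \<in> X \<Longrightarrow> y \<in> G0 \<Longrightarrow> M (y, 0) = y"
    and up: "\<And>u. u \<in> K \<Longrightarrow> L (M (z, u)) > L z"
    and asc: "\<And>y. y \<in> X \<Longrightarrow> y \<in> G0 \<Longrightarrow> \<exists>u\<in>K. \<forall>t. 0 < t \<longrightarrow> t \<le> 1 \<longrightarrow> L (M (y, t *\<^sub>R u)) > L y"
  shows "passable X L (L z) z"
proof -
  define c where "c = L z"
  have KV: "K \<subseteq> V" using star[of _ 1] by auto
  have line: "continuous_on {0..1} (\<lambda>t. M (y, t *\<^sub>R u))" if "y \<in> X" "y \<in> G0" "u \<in> K" for y u
    by (rule continuous_on_compose2[OF M(1)]) (use that star in \<open>auto intro!: continuous_intros\<close>)
  have "continuous_on ((X \<inter> G0) \<times> K) (\<lambda>p. L (M p))"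
    by (rule continuous_on_compose2[OF L continuous_on_subset[OF M(1)]]) (use KV M(2) in auto)
  then have "openin (top_of_set ((X \<inter> G0) \<times> K)) (((X \<inter> G0) \<times> K) \<inter> (\<lambda>p. L (M p)) -` {c<..})"
    by (rule continuous_openin_preimage_gen) auto
  then obtain T where T: "open T" "((X \<inter> G0) \<times> K) \<inter> (\<lambda>p. L (M p)) -` {c<..} = ((X \<inter> G0) \<times> K) \<inter> T"
    unfolding openin_open by blast
  have "(z, u) \<in> T" if "u \<in> K" for u
  proof -
    have "(z, u) \<in> ((X \<inter> G0) \<times> K) \<inter> (\<lambda>p. L (M p)) -` {c<..}"
      using up[OF that] z G0 that by (simp add: c_def)
    then show ?thesis unfolding T(2) by blast
  qed
  \<comment> \<open>The tube lemma extends the strict inequality from \<open>z\<close> to a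
    neighbourhood \<open>X0\<close>, simultaneously for all \<open>u \<in> K\<close>.\<close>
  then have "{z} \<times> K \<subseteq> T" by blast
  then obtain X0 where X0: "z \<in> X0" "open X0" "X0 \<times> K \<subseteq> T"
    using Elementary_Topology.tube_lemma[OF K(1) T(1)] by blast
  have high: "L (M (y, u)) > c" if "y \<in> X" "y \<in> G0" "y \<in> X0" "u \<in> K" for y u
  proof -
    have "(y, u) \<in> ((X \<inter> G0) \<times> K) \<inter> T" using that X0(3) by auto
    then show ?thesis unfolding T(2)[symmetric] by simp
  qed
  obtain G P where G: "open G" "z \<in> G" "path_connected P" "X \<inter> G \<subseteq> P" "P \<subseteq> X \<inter> (G0 \<inter> X0)"
    using X z G0 X0 unfolding weakly_lpc_def by (meson IntI open_Int)
  let ?Q = "{y \<in> X. L y > c}"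
  show ?thesis
    unfolding passable_def c_def[symmetric]
  proof (intro conjI allI impI)
    fix H assume H: "open H" "z \<in> H"
    obtain u where u: "u \<in> K" "\<And>t. 0 < t \<Longrightarrow> t \<le> 1 \<Longrightarrow> L (M (z, t *\<^sub>R u)) > c"
      using asc[OF z G0(2)] by (auto simp: c_def)
    have "openin (top_of_set {0..1}) ({0..1} \<inter> (\<lambda>t. M (z, t *\<^sub>R u)) -` H)"
      by (rule continuous_openin_preimage_gen[OF line[OF z G0(2) u(1)] H(1)])
    moreover have "0 \<in> {0..1} \<inter> (\<lambda>t. M (z, t *\<^sub>R u)) -` H" using M(3)[OF z G0(2)] H by simp
    ultimately obtain e where e: "e > 0" "\<And>t. t \<in> {0..1} \<Longrightarrow> dist t 0 < e \<Longrightarrow> M (z, t *\<^sub>R u) \<in> H"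
      unfolding openin_euclidean_subtopology_iff by (metis IntD2 vimage_eq)
    define t where "t = min 1 (e / 2)"
    have t: "0 < t" "t \<le> 1" "t < e" using e(1) by (auto simp: t_def)
    then have "M (z, t *\<^sub>R u) \<in> X \<inter> H" using e(2)[of t] M(2)[OF z G0(2) star[OF u(1)], of t] by auto
    then show "\<exists>y\<in>X \<inter> H. L y > c" using u(2)[OF t(1,2)] by blast
  next
    have to_top: "\<exists>u\<in>K. path_component ?Q a (M (a, u))" if a: "a \<in> X \<inter> G" "L a > c" for a
    proof -
      have aX: "a \<in> X" "a \<in> G0" using a(1) G(4,5) by auto
      obtain u where u: "u \<in> K" "\<And>t. 0 < t \<Longrightarrow> t \<le> 1 \<Longrightarrow> L (M (a, t *\<^sub>R u)) > L a"
        using asc[OF aX] by auto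
      have "L (M (a, t *\<^sub>R u)) > c \<and> M (a, t *\<^sub>R u) \<in> X" if "0 \<le> t" "t \<le> 1" for t
        using u(2)[of t] M(2)[OF aX star[OF u(1) that]] M(3)[OF aX] a(2) that by (cases "t = 0") auto
      then have "path_component ?Q a (M (a, u))"
        unfolding path_component_def path_def path_image_def pathstart_def pathfinish_def
        by (intro exI[of _ "\<lambda>t. M (a, t *\<^sub>R u)"]) (auto simp: line[OF aX u(1)] M(3)[OF aX])
      then show ?thesis using u(1) by blast
    qed
    have "continuous_on (P \<times> K) M" by (rule continuous_on_subset[OF M(1)]) (use G(5) KV in auto)
    then have "path_connected (M ` (P \<times> K))"
      by (rule path_connected_continuous_image) (intro path_connected_Times G(3) K(2))
    moreover have "M ` (P \<times> K) \<subseteq> ?Q"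
    proof -
      have "M (y, u) \<in> ?Q" if "y \<in> P" "u \<in> K" for y u
      proof -
        have y: "y \<in> X" "y \<in> G0" "y \<in> X0" using that(1) G(5) by auto
        show ?thesis using M(2)[OF y(1,2)] high[OF y that(2)] that(2) KV by auto
      qed
      then show ?thesis by auto
    qed
    ultimately have top: "path_component ?Q (M (a, u)) (M (b, v))" if "a \<in> P" "b \<in> P" "u \<in> K" "v \<in> K" for a b u v
      using that path_component_of_subset unfolding path_connected_component
      by (metis (no_types, lifting) SigmaI image_eqI)
    have "path_component ?Q a b" if ab: "a \<in> X \<inter> G" "b \<in> X \<inter> G" "L a > c" "L b > c" for a b
    proof -
      obtain u v where uv: "u \<in> K" "v \<in> K" "path_component ?Q a (M (a, u))" "path_component ?Q b (M (b, v))"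
        using to_top ab by meson
      moreover have "path_component ?Q (M (a, u)) (M (b, v))"
        by (rule top[OF _ _ uv(1,2)]) (use ab G(4) in auto)
      ultimately show ?thesis by (meson path_component_sym path_component_trans)
    qed
    then show "\<exists>G. open G \<and> z \<in> G \<and> (\<forall>a\<in>X \<inter> G. \<forall>b\<in>X \<inter> G. L a > c \<longrightarrow> L b > c \<longrightarrow> path_component ?Q a b)"
      using G by (intro exI[of _ G]) auto
  qed
qed


subsection \<open>The space of configurations\<close>

text \<open>With singleton factors from \<open>n\<close> on, the configurations become a product
  over all indices, to which the theorems on the topology of the function space apply.\<close>

lemma PiE_lessThan_eq: "PiE {..<n::nat} P = PiE UNIV (\<lambda>i. if i < n then P i else {undefined})"
proof (intro equalityI subsetI)
  fix y assume "y \<in> PiE UNIV (\<lambda>i. if i < n then P i else {undefined})"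
  then have y: "y i \<in> (if i < n then P i else {undefined})" for i by (auto simp only: PiE_iff)
  have "y i \<in> P i" if "i < n" for i using y[of i] that by simp
  moreover have "y i = undefined" if "\<not> i < n" for i using y[of i] that by simp
  ultimately show "y \<in> PiE {..<n} P" by (simp add: PiE_iff extensional_def)
qed (simp add: PiE_iff extensional_def)

lemma compact_PiE_lessThan:
  fixes P :: "nat \<Rightarrow> 'a::topological_space set"
  assumes "\<And>i. i < n \<Longrightarrow> compact (P i)"
  shows "compact (PiE {..<n} P)"
proof -
  have "compactin (product_topology (\<lambda>i. euclidean) UNIV) (PiE UNIV (\<lambda>i. if i < n then P i else {undefined}))"
    using assms by (auto simp: compactin_PiE)
  then show ?thesis by (simp add: euclidean_product_topology PiE_lessThan_eq)
qed

lemma path_connected_PiE_lessThan: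
  fixes P :: "nat \<Rightarrow> 'a::topological_space set"
  assumes "\<And>i. i < n \<Longrightarrow> path_connected (P i)"
  shows "path_connected (PiE {..<n} P)"
proof -
  have "path_connectedin (product_topology (\<lambda>i. euclidean) UNIV) (PiE UNIV (\<lambda>i. if i < n then P i else {undefined}))"
    using assms by (auto simp: path_connectedin_PiE)
  then show ?thesis by (simp add: euclidean_product_topology PiE_lessThan_eq)
qed

lemma weakly_lpc_PiE:
  fixes S :: "'a::topological_space set"
  assumes "locally path_connected S"
  shows "weakly_lpc ({..<n::nat} \<rightarrow>\<^sub>E S)"
  unfolding weakly_lpc_def
proof (intro allI impI)
  fix G :: "(nat \<Rightarrow> 'a) set" and z assume G: "open G" and z: "z \<in> ({..<n} \<rightarrow>\<^sub>E S) \<inter> G"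
  obtain B where B: "z \<in> PiE UNIV B" "\<And>i. open (B i)" "PiE UNIV B \<subseteq> G"
    using product_topology_open_contains_basis[of "\<lambda>i. euclidean" UNIV G z] G z by (auto simp: open_fun_def)
  have "\<exists>P T. path_connected P \<and> open T \<and> P = S \<inter> T \<and> z i \<in> P \<and> P \<subseteq> B i" if "i < n" for i
  proof -
    have "openin (top_of_set S) (S \<inter> B i)" "z i \<in> S \<inter> B i"
      using B z that by (auto simp: PiE_iff openin_open_Int)
    then obtain P where "openin (top_of_set S) P" "path_connected P" "z i \<in> P" "P \<subseteq> S \<inter> B i"
      using assms unfolding locally_path_connected by meson
    then show ?thesis unfolding openin_open by blast
  qed
  then obtain P T where PT: "\<And>i. i < n \<Longrightarrow> path_connected (P i) \<and> open (T i) \<and> P i = S \<inter> T i \<and> z i \<in> P i \<and> P i \<subseteq> B i"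
    by metis
  define V where "V = (\<Inter>i<n. (\<lambda>y. y i) -` T i)"
  have "open V"
    unfolding V_def by (intro open_INT ballI open_vimage continuous_on_product_coordinates) (use PT in auto)
  moreover have "z \<in> V" "({..<n} \<rightarrow>\<^sub>E S) \<inter> V \<subseteq> PiE {..<n} P"
    using PT by (auto simp: V_def PiE_iff)
  moreover have "PiE {..<n} P \<subseteq> ({..<n} \<rightarrow>\<^sub>E S) \<inter> G"
  proof
    fix y assume y: "y \<in> PiE {..<n} P"
    have "y i \<in> B i" for i
    proof (cases "i < n")
      case True
      then show ?thesis using PT y by (auto simp: PiE_iff)
    next
      case False
      then have "y i = z i" using y z by (auto simp: PiE_iff extensional_def)
      then show ?thesis using B(1) by auto
    qed
    then have "y \<in> G" using B(3) by auto
    moreover have "y \<in> {..<n} \<rightarrow>\<^sub>E S" using PT y by (auto simp: PiE_iff)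
    ultimately show "y \<in> ({..<n} \<rightarrow>\<^sub>E S) \<inter> G" by blast
  qed
  moreover have "path_connected (PiE {..<n} P)"
    by (rule path_connected_PiE_lessThan) (use PT in blast)
  ultimately show "\<exists>V P. open V \<and> z \<in> V \<and> path_connected P \<and> ({..<n} \<rightarrow>\<^sub>E S) \<inter> V \<subseteq> P \<and> P \<subseteq> ({..<n} \<rightarrow>\<^sub>E S) \<inter> G"
    by - (rule exI[of _ V], rule exI[of _ "PiE {..<n} P"], intro conjI; assumption)
qed

lemma continuous_on_length: "continuous_on A (length_functional n)"
  unfolding length_functional_def
  by (intro continuous_intros continuous_on_subset[OF continuous_on_product_coordinates]) auto

abbreviation nxt :: "nat \<Rightarrow> nat \<Rightarrow> nat" where "nxt n j \<equiv> Suc j mod n"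
abbreviation prv :: "nat \<Rightarrow> nat \<Rightarrow> nat" where "prv n j \<equiv> (j + (n - 1)) mod n"

lemma nxt_prv:
  assumes "n \<ge> 3" "j < n"
  shows "nxt n j < n" "prv n j < n" "nxt n (prv n j) = j" "prv n (nxt n j) = j" "nxt n j \<noteq> j" "prv n j \<noteq> j" "nxt n j \<noteq> prv n j"
proof -
  have n: "nxt n j = (if Suc j = n then 0 else Suc j)" using assms by auto
  have p: "prv n k = (if k = 0 then n - 1 else k - 1)" if "k < n" for k
  proof (cases k)
    case (Suc m)
    then have "(k + (n - 1)) mod n = (m + n) mod n" using assms by simp
    then show ?thesis using Suc that by simp
  qed (use assms in auto)
  show "nxt n j < n" "prv n j < n" using assms by auto
  show "nxt n (prv n j) = j" "prv n j \<noteq> j" "nxt n j \<noteq> prv n j" "nxt n j \<noteq> j" using assms p[of j] n by auto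
  show "prv n (nxt n j) = j" using p[of "nxt n j"] n assms by auto
qed

lemma length_functional_update:
  assumes "n \<ge> 3" "j < n"
  shows "length_functional n (q(j := y)) = length_functional n q
    + (norm (y - q (prv n j)) - norm (q j - q (prv n j))) + (norm (q (nxt n j) - y) - norm (q (nxt n j) - q j))"
proof -
  note N = nxt_prv[OF assms]
  let ?d = "\<lambda>i. norm ((q(j := y)) (nxt n i) - (q(j := y)) i) - norm (q (nxt n i) - q i)"
  have "length_functional n (q(j := y)) - length_functional n q = (\<Sum>i<n. ?d i)"
    by (simp add: length_functional_def sum_subtractf)
  also have "\<dots> = (\<Sum>i\<in>{prv n j, j}. ?d i)"
  proof (rule sum.mono_neutral_right)
    show "\<forall>i\<in>{..<n} - {prv n j, j}. ?d i = 0"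
    proof
      fix i assume i: "i \<in> {..<n} - {prv n j, j}"
      then have "nxt n i \<noteq> j" using nxt_prv(4)[OF assms(1), of i] by auto
      then show "?d i = 0" using i by simp
    qed
  qed (use N(2) assms(2) in simp_all)
  also have "\<dots> = ?d (prv n j) + ?d j" using N(6) by simp
  also have "\<dots> = (norm (y - q (prv n j)) - norm (q j - q (prv n j))) + (norm (q (nxt n j) - y) - norm (q (nxt n j) - q j))"
    using N by simp
  finally show ?thesis by simp
qed

text \<open>\<open>sgn y\<close> is a subgradient of the norm, also at 0. Lower estimates of the
  length therefore have no second order remainder and remain valid at collisions.\<close>

lemma norm_add_ge:
  fixes y d :: "'a::real_inner"
  shows "norm (y + d) \<ge> norm y + sgn y \<bullet> d"
proof (cases "y = 0")
  case False
  have "sgn y \<bullet> (y + d) \<le> norm (sgn y) * norm (y + d)" by (rule norm_cauchy_schwarz)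
  moreover have "sgn y \<bullet> y = norm y"
    using False by (simp add: sgn_div_norm power2_norm_eq_inner[symmetric] power2_eq_square)
  ultimately show ?thesis using False by (simp add: norm_sgn inner_add_right)
qed simp

lemma inner_sgn_ge:
  fixes y d :: "'a::real_inner"
  shows "sgn y \<bullet> d \<ge> - norm d"
proof -
  have "\<bar>sgn y \<bullet> d\<bar> \<le> norm (sgn y) * norm d" by (rule Cauchy_Schwarz_ineq2)
  also have "\<dots> \<le> norm d" by (cases "y = 0") (auto simp: norm_sgn)
  finally show ?thesis by linarith
qed

lemma isCont_sgn:
  fixes f :: "'x::t2_space \<Rightarrow> 'a::real_normed_vector"
  shows "isCont f x \<Longrightarrow> f x \<noteq> 0 \<Longrightarrow> isCont (\<lambda>x. sgn (f x)) x"
  unfolding sgn_div_norm by (intro continuous_intros) auto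

lemma isCont_coordinate: "isCont (\<lambda>q::nat \<Rightarrow> 'a::metric_space. q i) z"
  by (rule continuous_on_interior[OF continuous_on_product_coordinates]) simp

lemma continuous_on_fst_coordinate:
  fixes A :: "((nat \<Rightarrow> 'a::topological_space) \<times> 'b::topological_space) set"
  shows "continuous_on A (\<lambda>p. fst p i)"
  by (rule continuous_on_product_then_coordinatewise[of A fst]) (rule continuous_on_fst[OF continuous_on_id])

section \<open>Passable configurations: moving a single point\<close>

context convex_table
begin

abbreviation "configs n \<equiv> {..<n::nat} \<rightarrow>\<^sub>E S"

lemma compact_configs: "compact (configs n)"
  by (rule compact_PiE_lessThan) (rule compact_S)

lemma weakly_lpc_configs: "weakly_lpc (configs n)"
  by (rule weakly_lpc_PiE[OF locally_path_connected_S])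

text \<open>The mover displaces only the point \<open>j\<close>, by vectors tangent at a fixed
  \<open>y\<close>. The radius \<open>r / 2\<close> keeps all fractions of a move in the domain of
  \<open>m\<close>.\<close>

lemma passable_of_push:
  assumes n: "n \<ge> 3" "j < n" and q: "q \<in> configs n" and "r > 0"
    and m: "\<And>a v. a \<in> S \<inter> ball y r \<Longrightarrow> normal y \<bullet> v = 0 \<Longrightarrow> norm v < r \<Longrightarrow>
      m (a, v) \<in> S \<and> norm (m (a, v) - a - v) \<le> \<eta> * norm v"
    and contm: "continuous_on ((S \<inter> ball y r) \<times> {v. normal y \<bullet> v = 0 \<and> norm v < r}) m"
    and G0: "open G0" "q \<in> G0" "\<And>\<zeta>. \<zeta> \<in> G0 \<Longrightarrow> \<zeta> j \<in> ball y r"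
    and K: "compact K" "path_connected K" "K \<noteq> {}" "\<And>u. u \<in> K \<Longrightarrow> normal y \<bullet> u = 0 \<and> norm u = r / 2"
    and up: "\<And>u. u \<in> K \<Longrightarrow> length_functional n (q(j := m (q j, u))) > length_functional n q"
    and asc: "\<And>\<zeta>. \<zeta> \<in> configs n \<Longrightarrow> \<zeta> \<in> G0 \<Longrightarrow>
      \<exists>u\<in>K. \<forall>t. 0 < t \<longrightarrow> t \<le> 1 \<longrightarrow> length_functional n (\<zeta>(j := m (\<zeta> j, t *\<^sub>R u))) > length_functional n \<zeta>"
  shows "passable (configs n) (length_functional n) (length_functional n q) q"
proof -
  define V where "V = {v. normal y \<bullet> v = 0 \<and> norm v < r}"
  define M where "M = (\<lambda>(\<zeta>, v). \<zeta>(j := m (\<zeta> j, v)))"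
  have at_j: "\<zeta> j \<in> S \<inter> ball y r" if "\<zeta> \<in> configs n" "\<zeta> \<in> G0" for \<zeta>
    using PiE_mem[OF that(1)] n(2) G0(3)[OF that(2)] by simp
  show ?thesis
  proof (rule passable_of_mover[where K = K and V = V and ?G0.0 = G0 and M = M])
    show "continuous_on ((configs n \<inter> G0) \<times> V) M"
    proof (rule continuous_on_coordinatewise_then_product)
      fix i
      have "continuous_on ((configs n \<inter> G0) \<times> V) (\<lambda>p. m (fst p j, snd p))"
        by (rule continuous_on_compose2[OF contm])
           (use at_j in \<open>auto simp: V_def intro!: continuous_on_Pair continuous_on_fst_coordinate continuous_on_snd continuous_on_id\<close>)
      moreover have "continuous_on ((configs n \<inter> G0) \<times> V) (\<lambda>p. fst p i)"
        by (rule continuous_on_fst_coordinate)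
      ultimately show "continuous_on ((configs n \<inter> G0) \<times> V) (\<lambda>p. M p i)"
        by (cases "i = j") (auto simp: M_def case_prod_unfold)
    qed
    show "M (\<zeta>, v) \<in> configs n" if "\<zeta> \<in> configs n" "\<zeta> \<in> G0" "v \<in> V" for \<zeta> v
      using m[OF at_j[OF that(1,2)], of v] that n by (auto simp: M_def V_def PiE_iff extensional_def)
    show "M (\<zeta>, 0) = \<zeta>" if "\<zeta> \<in> configs n" "\<zeta> \<in> G0" for \<zeta>
      using m[OF at_j[OF that], of 0] \<open>r > 0\<close> by (simp add: M_def)
    show "t *\<^sub>R u \<in> V" if "u \<in> K" "0 \<le> t" "t \<le> 1" for t u
    proof -
      have "t * (r / 2) \<le> 1 * (r / 2)" using that \<open>r > 0\<close> by (intro mult_right_mono) auto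
      moreover have "norm (t *\<^sub>R u) = t * (r / 2)" using K(4)[OF that(1)] that(2) by simp
      ultimately have "norm (t *\<^sub>R u) < r" using \<open>r > 0\<close> by linarith
      moreover have "normal y \<bullet> (t *\<^sub>R u) = 0" using K(4)[OF that(1)] by simp
      ultimately show ?thesis unfolding V_def by blast
    qed
  qed (use K(1-3) G0 q up asc in \<open>auto simp: weakly_lpc_configs continuous_on_length M_def\<close>)
qed

text \<open>The point \<open>j\<close> can be pushed along \<open>v\<close> or \<open>- v\<close>
  with positive slope, and the same direction works for all configurations near \<open>q\<close>. So
  a single vector serves as \<open>K\<close>.\<close>

lemma passable_noncritical:
  assumes n: "n \<ge> 3" "j < n" and q: "q \<in> configs n" "q j \<noteq> q (prv n j)" "q (nxt n j) \<noteq> q j"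
    and v: "normal (q j) \<bullet> v = 0" "(sgn (q j - q (prv n j)) - sgn (q (nxt n j) - q j)) \<bullet> v \<noteq> 0"
  shows "passable (configs n) (length_functional n) (length_functional n q) q"
proof -
  note N = nxt_prv[OF n]
  let ?f = "\<lambda>q v. (sgn (q j - q (prv n j)) - sgn (q (nxt n j) - q j)) \<bullet> (v::'a)"
  obtain v where v: "normal (q j) \<bullet> v = 0" "norm v = 1" "?f q v > 0"
  proof -
    have "v \<noteq> 0" using v by auto
    define w where "w = sgn (?f q v) *\<^sub>R sgn v"
    have "normal (q j) \<bullet> w = 0" using v by (simp add: w_def sgn_div_norm)
    moreover have "norm w = 1" using v(2) \<open>v \<noteq> 0\<close> by (simp add: w_def norm_sgn abs_sgn_eq)
    moreover have "?f q w = \<bar>?f q v\<bar> / norm v"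
      by (simp add: w_def sgn_div_norm[of v] abs_sgn field_simps)
    ultimately show thesis using that[of w] v(2) \<open>v \<noteq> 0\<close> by simp
  qed
  define \<mu> where "\<mu> = ?f q v"
  \<comment> \<open>Near \<open>q\<close> the slope stays above
    \<open>\<mu> / 2 = 4 * \<eta>\<close>, and each of the two edges at \<open>j\<close> loses at
    most \<open>\<eta>\<close> per unit of displacement through the error of
    \<open>m\<close>.\<close>
  define \<eta> where "\<eta> = \<mu> / 8"
  have "\<eta> > 0" using v by (simp add: \<eta>_def \<mu>_def)
  have y: "q j \<in> S" using q n by auto
  obtain r m where "r > 0"
    and m: "\<And>a v. a \<in> S \<inter> ball (q j) r \<Longrightarrow> normal (q j) \<bullet> v = 0 \<Longrightarrow> norm v < r \<Longrightarrow>
      m (a, v) \<in> S \<and> norm (m (a, v) - a - v) \<le> \<eta> * norm v"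
    and contm: "continuous_on ((S \<inter> ball (q j) r) \<times> {v. normal (q j) \<bullet> v = 0 \<and> norm v < r}) m"
    by (rule push[OF y \<open>\<eta> > 0\<close>]) (rule that)
  have "isCont (\<lambda>q. ?f q v) q"
    using q by (intro continuous_intros isCont_sgn isCont_coordinate) auto
  then have "\<forall>\<^sub>F \<zeta> in nhds q. \<mu> / 2 < ?f \<zeta> v"
    by (rule isCont_eventually_gt(1)) (use v in \<open>simp add: \<mu>_def\<close>)
  moreover have "\<forall>\<^sub>F \<zeta> in nhds q. \<zeta> j \<in> ball (q j) r"
    by (rule isCont_eventually_in_open[OF isCont_coordinate]) (use \<open>r > 0\<close> in auto)
  ultimately have "\<forall>\<^sub>F \<zeta> in nhds q. \<mu> / 2 < ?f \<zeta> v \<and> \<zeta> j \<in> ball (q j) r"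
    by (rule eventually_conj)
  then obtain G0 where G0: "open G0" "q \<in> G0" "\<And>\<zeta>. \<zeta> \<in> G0 \<Longrightarrow> \<mu> / 2 < ?f \<zeta> v \<and> \<zeta> j \<in> ball (q j) r"
    unfolding eventually_nhds by blast
  define V where "V = {v. normal (q j) \<bullet> v = 0 \<and> norm v < r}"
  define u where "u = (r / 2) *\<^sub>R v"
  have tu: "t *\<^sub>R u \<in> V" "norm (t *\<^sub>R u) = t * r / 2" if "0 \<le> t" "t \<le> 1" for t
  proof -
    show nm: "norm (t *\<^sub>R u) = t * r / 2" using that v \<open>r > 0\<close> by (simp add: u_def)
    have "t * r \<le> 1 * r" using that \<open>r > 0\<close> by (intro mult_right_mono) auto
    then show "t *\<^sub>R u \<in> V" using nm v \<open>r > 0\<close> by (simp add: V_def u_def)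
  qed
  have gain: "length_functional n (\<zeta>(j := m (\<zeta> j, t *\<^sub>R u))) > length_functional n \<zeta>"
    if \<zeta>: "\<zeta> \<in> configs n" "\<zeta> \<in> G0" and t: "0 < t" "t \<le> 1" for \<zeta> t
  proof -
    define d where "d = m (\<zeta> j, t *\<^sub>R u) - \<zeta> j"
    define s where "s = t * r / 2"
    have s: "s > 0" "t *\<^sub>R u = s *\<^sub>R v" using t \<open>r > 0\<close> by (auto simp: s_def u_def)
    have "norm (m (\<zeta> j, t *\<^sub>R u) - \<zeta> j - t *\<^sub>R u) \<le> \<eta> * norm (t *\<^sub>R u)"
      using m[of "\<zeta> j" "t *\<^sub>R u"] tu(1)[of t] \<zeta> G0(3)[of \<zeta>] n t by (auto simp: V_def)
    then have err: "norm (d - s *\<^sub>R v) \<le> \<eta> * s" using tu(2)[of t] t by (simp add: d_def s(2) flip: s_def)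
    define a where "a = sgn (\<zeta> j - \<zeta> (prv n j))"
    define b where "b = sgn (\<zeta> (nxt n j) - \<zeta> j)"
    have "norm (\<zeta> j - \<zeta> (prv n j) + d) \<ge> norm (\<zeta> j - \<zeta> (prv n j)) + a \<bullet> d"
      "norm (\<zeta> (nxt n j) - \<zeta> j + (- d)) \<ge> norm (\<zeta> (nxt n j) - \<zeta> j) + b \<bullet> (- d)"
      unfolding a_def b_def by (rule norm_add_ge)+
    then have "length_functional n (\<zeta>(j := m (\<zeta> j, t *\<^sub>R u))) \<ge> length_functional n \<zeta> + (a - b) \<bullet> d"
      by (simp add: length_functional_update[OF n] d_def algebra_simps)
    moreover have "(a - b) \<bullet> d = s * ((a - b) \<bullet> v) + a \<bullet> (d - s *\<^sub>R v) + b \<bullet> (- (d - s *\<^sub>R v))"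
      by (simp add: algebra_simps)
    moreover have "a \<bullet> (d - s *\<^sub>R v) \<ge> - (\<eta> * s)" "b \<bullet> (- (d - s *\<^sub>R v)) \<ge> - (\<eta> * s)"
      using inner_sgn_ge[where y = "\<zeta> j - \<zeta> (prv n j)" and d = "d - s *\<^sub>R v"]
        inner_sgn_ge[where y = "\<zeta> (nxt n j) - \<zeta> j" and d = "- (d - s *\<^sub>R v)"] err
      unfolding a_def b_def norm_minus_cancel by linarith+
    moreover have "s * ((a - b) \<bullet> v) > s * (\<mu> / 2)"
      using G0(3)[OF \<zeta>(2)] s(1) by (simp add: a_def b_def)
    moreover have "s * (\<mu> / 2) = 4 * (\<eta> * s)" by (simp add: \<eta>_def)
    moreover have "\<eta> * s > 0" using s(1) \<open>\<eta> > 0\<close> by simp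
    ultimately show ?thesis by linarith
  qed
  show ?thesis
    by (rule passable_of_push[OF n q(1) \<open>r > 0\<close> m contm G0(1,2), of "{u}"])
       (use G0 gain[OF q(1) G0(2), of 1] gain tu(2)[of 1] v in \<open>auto simp: u_def\<close>)
qed

end


text \<open>In dimension at least 3 a hyperplane has dimension at least 2, so it remains path
  connected without the origin; normalisation maps it onto the sphere.\<close>

lemma hyperplane_sphere:
  fixes \<nu> :: "'a::euclidean_space"
  assumes "\<nu> \<noteq> 0" "DIM('a) \<ge> 3" "r > 0"
  defines "K \<equiv> {u. \<nu> \<bullet> u = 0 \<and> norm u = r}"
  shows "path_connected K" "K \<noteq> {}" "compact K"
proof -
  let ?T = "{u. \<nu> \<bullet> u = 0}"
  have aff: "aff_dim ?T \<ge> 2" using assms(1,2) aff_dim_hyperplane[OF assms(1), of 0] by simp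
  have "convex ?T" by (rule convex_hyperplane)
  have pc: "path_connected (?T - {0})"
    by (rule path_connected_punctured_convex[OF \<open>convex ?T\<close>]) (use aff in auto)
  have eq: "K = (\<lambda>v. r *\<^sub>R sgn v) ` (?T - {0})"
  proof (intro equalityI subsetI)
    fix u assume "u \<in> K"
    then have "u \<in> ?T - {0}" "u = r *\<^sub>R sgn u" using assms(3) by (auto simp: K_def sgn_div_norm)
    then show "u \<in> (\<lambda>v. r *\<^sub>R sgn v) ` (?T - {0})" by blast
  qed (use assms(3) in \<open>auto simp: K_def norm_sgn sgn_div_norm[of _ ]\<close>)
  show "path_connected K"
    unfolding eq sgn_div_norm by (rule path_connected_continuous_image[OF _ pc]) (intro continuous_intros; simp)
  have "?T \<noteq> {0}"
  proof
    assume "?T = {0}"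
    then have "aff_dim ?T = 0" by simp
    then show False using aff by simp
  qed
  then show "K \<noteq> {}" unfolding eq by (auto intro: exI[of _ 0])
  have "K = ?T \<inter> sphere 0 r" by (auto simp: K_def)
  then show "compact K" using closed_Int_compact[OF closed_hyperplane[of \<nu> 0] compact_sphere] by simp
qed

lemma inner_tangential_part:
  fixes e \<nu> u :: "'a::real_inner"
  assumes "\<nu> \<bullet> u = 0"
  shows "e \<bullet> u = (e - (\<nu> \<bullet> e) *\<^sub>R \<nu>) \<bullet> u"
  using assms by (simp add: inner_diff_left)

lemma norm_tangential_part:
  fixes e \<nu> :: "'a::real_inner"
  assumes "norm \<nu> = 1"
  shows "(norm (e - (\<nu> \<bullet> e) *\<^sub>R \<nu>))\<^sup>2 = (norm e)\<^sup>2 - (\<nu> \<bullet> e)\<^sup>2"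
proof -
  have "\<nu> \<bullet> \<nu> = 1" using assms by (simp add: norm_eq_1)
  then show ?thesis
    unfolding power2_norm_eq_inner
    by (simp add: inner_diff_left inner_diff_right inner_commute[of e \<nu>] power2_eq_square)
qed

context convex_table
begin

text \<open>Near \<open>q\<close> the point \<open>j\<close> and its successor may be distinct
  though close, and then a safe choice is to move away from the successor. This direction depends on
  the nearby configuration and can be any tangent direction, so \<open>K\<close> has to be a whole
  sphere. The predecessor is a different point, so its edge meets \<open>S\<close>
  transversally.\<close>

lemma passable_collision:
  assumes n: "n \<ge> 3" "j < n" and q: "q \<in> configs n" "q (nxt n j) = q j" "q (prv n j) \<noteq> q j"
    and dim: "DIM('a) \<ge> 3"
  shows "passable (configs n) (length_functional n) (length_functional n q) q"
proof -
  note N = nxt_prv[OF n]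
  define y where "y = q j"
  define \<nu> where "\<nu> = normal y"
  have y: "y \<in> S" unfolding y_def by (rule PiE_mem[OF q(1)]) (use n in simp)
  have \<nu>: "norm \<nu> = 1" "\<nu> \<noteq> 0" using norm_normal[OF y] by (auto simp: \<nu>_def)
  define e where "e = sgn (y - q (prv n j))"
  have "q (prv n j) \<in> S" by (rule PiE_mem[OF q(1)]) (use n in simp)
  then have "\<nu> \<bullet> (q (prv n j) - y) < 0"
    using chord_normal[OF y, of "q (prv n j)"] S_subset_U q(3) by (auto simp: \<nu>_def y_def)
  then have "\<nu> \<bullet> e \<noteq> 0" using q(3) by (auto simp: e_def sgn_div_norm inner_diff_right y_def)
  have ne: "norm e = 1" using q(3) by (simp add: e_def norm_sgn y_def)
  define \<theta> where "\<theta> = norm (e - (\<nu> \<bullet> e) *\<^sub>R \<nu>)"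
  have "\<theta>\<^sup>2 < 1\<^sup>2" using norm_tangential_part[OF \<nu>(1), of e] ne \<open>\<nu> \<bullet> e \<noteq> 0\<close> by (simp add: \<theta>_def)
  then have \<theta>: "\<theta> < 1" using power2_less_imp_less by fastforce
  have e_tan: "e \<bullet> u \<ge> - (\<theta> * norm u)" if "\<nu> \<bullet> u = 0" for u
    using Cauchy_Schwarz_ineq2[of "e - (\<nu> \<bullet> e) *\<^sub>R \<nu>" u] inner_tangential_part[OF that, of e] by (simp add: \<theta>_def)
  \<comment> \<open>A move by \<open>s\<close> gains at least \<open>s - 2 * \<eta> * s\<close> on
    the edge to the successor and loses at most \<open>\<theta> * s + 2 * \<eta> * s\<close> on the
    other one; this choice leaves a net gain of \<open>4 * \<eta> * s\<close>.\<close>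
  define \<eta> where "\<eta> = (1 - \<theta>) / 8"
  have "\<theta> \<ge> 0" by (simp add: \<theta>_def)
  then have \<eta>: "\<eta> > 0" "\<eta> < 1" using \<theta> by (auto simp: \<eta>_def)
  obtain r m where "r > 0"
    and m: "\<And>a v. a \<in> S \<inter> ball y r \<Longrightarrow> normal y \<bullet> v = 0 \<Longrightarrow> norm v < r \<Longrightarrow>
      m (a, v) \<in> S \<and> norm (m (a, v) - a - v) \<le> \<eta> * norm v"
    and contm: "continuous_on ((S \<inter> ball y r) \<times> {v. normal y \<bullet> v = 0 \<and> norm v < r}) m"
    and flat: "\<And>a b. a \<in> S \<inter> ball y r \<Longrightarrow> b \<in> S \<inter> ball y r \<Longrightarrow> \<bar>normal y \<bullet> (a - b)\<bar> \<le> \<eta> * norm (a - b)"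
    by (rule push[OF y \<eta>(1)]) (rule that)
  have "isCont (\<lambda>\<zeta>. sgn (\<zeta> j - \<zeta> (prv n j)) - e) q"
    using q by (intro continuous_intros isCont_sgn isCont_coordinate) (auto simp: y_def)
  then have "\<forall>\<^sub>F \<zeta> in nhds q. sgn (\<zeta> j - \<zeta> (prv n j)) - e \<in> ball 0 \<eta>"
    by (rule isCont_eventually_in_open) (use \<eta> in \<open>auto simp: e_def y_def\<close>)
  moreover have "\<forall>\<^sub>F \<zeta> in nhds q. \<zeta> j \<in> ball y r"
    by (rule isCont_eventually_in_open[OF isCont_coordinate]) (use \<open>r > 0\<close> in \<open>auto simp: y_def\<close>)
  moreover have "\<forall>\<^sub>F \<zeta> in nhds q. \<zeta> (nxt n j) \<in> ball y r"
    by (rule isCont_eventually_in_open[OF isCont_coordinate]) (use \<open>r > 0\<close> q(2) in \<open>auto simp: y_def\<close>)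
  ultimately have "\<forall>\<^sub>F \<zeta> in nhds q. norm (sgn (\<zeta> j - \<zeta> (prv n j)) - e) < \<eta> \<and> \<zeta> j \<in> ball y r \<and> \<zeta> (nxt n j) \<in> ball y r"
    by eventually_elim auto
  then obtain G0 where G0: "open G0" "q \<in> G0"
    "\<And>\<zeta>. \<zeta> \<in> G0 \<Longrightarrow> norm (sgn (\<zeta> j - \<zeta> (prv n j)) - e) < \<eta>"
    "\<And>\<zeta>. \<zeta> \<in> G0 \<Longrightarrow> \<zeta> j \<in> ball y r" "\<And>\<zeta>. \<zeta> \<in> G0 \<Longrightarrow> \<zeta> (nxt n j) \<in> ball y r"
    unfolding eventually_nhds by blast
  define V where "V = {v. normal y \<bullet> v = 0 \<and> norm v < r}"
  define K where "K = {u. \<nu> \<bullet> u = 0 \<and> norm u = r / 2}"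
  have K: "path_connected K" "K \<noteq> {}" "compact K"
    unfolding K_def by (rule hyperplane_sphere[OF \<nu>(2) dim], use \<open>r > 0\<close> in simp)+
  have tu: "t *\<^sub>R u \<in> V" "norm (t *\<^sub>R u) = t * r / 2" if "u \<in> K" "0 \<le> t" "t \<le> 1" for t u
  proof -
    show nm: "norm (t *\<^sub>R u) = t * r / 2" using that by (simp add: K_def)
    have "t * r \<le> 1 * r" using that \<open>r > 0\<close> by (intro mult_right_mono) auto
    then have "norm (t *\<^sub>R u) < r" using nm \<open>r > 0\<close> by linarith
    moreover have "normal y \<bullet> (t *\<^sub>R u) = 0" using that by (simp add: K_def \<nu>_def)
    ultimately show "t *\<^sub>R u \<in> V" by (simp add: V_def)
  qed
  text \<open>A point colliding with its successor gains length at rate almost 1 on that edge if it moves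
    straight away from it, and loses at most at rate \<open>\<theta>\<close> on the preceding, transversal edge.\<close>
  have gain: "length_functional n (\<zeta>(j := m (\<zeta> j, t *\<^sub>R u))) > length_functional n \<zeta>"
    if \<zeta>: "\<zeta> \<in> configs n" "\<zeta> \<in> G0" and t: "0 < t" "t \<le> 1" and u: "u \<in> K"
      and away: "\<zeta> j \<noteq> \<zeta> (nxt n j) \<Longrightarrow> sgn (\<zeta> j - \<zeta> (nxt n j)) \<bullet> u \<ge> (1 - \<eta>) * (r / 2)" for \<zeta> t u
  proof -
    define d where "d = m (\<zeta> j, t *\<^sub>R u) - \<zeta> j"
    define s where "s = t * r / 2"
    have s: "s > 0" "norm (t *\<^sub>R u) = s" using t \<open>r > 0\<close> tu(2)[OF u, of t] by (auto simp: s_def)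
    have \<eta>s: "\<eta> * s > 0" using s \<eta> by simp
    have "norm (m (\<zeta> j, t *\<^sub>R u) - \<zeta> j - t *\<^sub>R u) \<le> \<eta> * norm (t *\<^sub>R u)"
      using m[of "\<zeta> j" "t *\<^sub>R u"] tu(1)[OF u, of t] \<zeta> G0(4)[of \<zeta>] n t by (auto simp: V_def)
    then have err: "norm (d - t *\<^sub>R u) \<le> \<eta> * s" using s by (simp add: d_def)
    define a where "a = sgn (\<zeta> j - \<zeta> (prv n j))"
    have "norm (\<zeta> j + d - \<zeta> (prv n j)) \<ge> norm (\<zeta> j - \<zeta> (prv n j)) + a \<bullet> d"
      using norm_add_ge[of "\<zeta> j - \<zeta> (prv n j)" d] by (simp add: a_def diff_add_eq)
    moreover have "a \<bullet> d = e \<bullet> (t *\<^sub>R u) + (a - e) \<bullet> (t *\<^sub>R u) + a \<bullet> (d - t *\<^sub>R u)"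
      by (simp add: algebra_simps)
    moreover have "e \<bullet> (t *\<^sub>R u) \<ge> - (\<theta> * s)"
      using e_tan[of "t *\<^sub>R u"] s(2) u by (simp add: K_def)
    moreover have "(a - e) \<bullet> (t *\<^sub>R u) \<ge> - (\<eta> * s)"
    proof -
      have "\<bar>(a - e) \<bullet> (t *\<^sub>R u)\<bar> \<le> norm (a - e) * norm (t *\<^sub>R u)" by (rule Cauchy_Schwarz_ineq2)
      also have "\<dots> \<le> \<eta> * s" unfolding s(2) using G0(3)[OF \<zeta>(2)] s(1) by (intro mult_right_mono) (auto simp: a_def)
      finally show ?thesis by linarith
    qed
    moreover have "a \<bullet> (d - t *\<^sub>R u) \<ge> - (\<eta> * s)"
      using inner_sgn_ge[where y = "\<zeta> j - \<zeta> (prv n j)" and d = "d - t *\<^sub>R u"] err unfolding a_def by linarith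
    ultimately have A: "norm (\<zeta> j + d - \<zeta> (prv n j)) - norm (\<zeta> j - \<zeta> (prv n j)) \<ge> - (\<theta> * s) - 2 * (\<eta> * s)"
      by linarith
    have B: "norm (\<zeta> (nxt n j) - (\<zeta> j + d)) - norm (\<zeta> (nxt n j) - \<zeta> j) \<ge> s - 2 * (\<eta> * s)"
    proof (cases "\<zeta> j = \<zeta> (nxt n j)")
      case True
      have "norm d \<ge> norm (t *\<^sub>R u) - norm (d - t *\<^sub>R u)"
        using norm_triangle_ineq2[of "t *\<^sub>R u" "t *\<^sub>R u - d"] by (simp add: norm_minus_commute)
      then show ?thesis using True err s(2) \<eta>s by simp
    next
      case False
      define w where "w = \<zeta> j - \<zeta> (nxt n j)"
      have "norm (w + d) \<ge> norm w + sgn w \<bullet> d" by (rule norm_add_ge)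
      moreover have "sgn w \<bullet> d = t * (sgn w \<bullet> u) + sgn w \<bullet> (d - t *\<^sub>R u)" by (simp add: algebra_simps)
      moreover have "t * (sgn w \<bullet> u) \<ge> t * ((1 - \<eta>) * (r / 2))"
        using away[OF False] t unfolding w_def by (intro mult_left_mono) auto
      moreover have "t * ((1 - \<eta>) * (r / 2)) = s - \<eta> * s" by (simp add: s_def field_simps)
      moreover have "sgn w \<bullet> (d - t *\<^sub>R u) \<ge> - (\<eta> * s)"
        using inner_sgn_ge[where y = w and d = "d - t *\<^sub>R u"] err by linarith
      moreover have "norm (\<zeta> (nxt n j) - (\<zeta> j + d)) = norm (w + d)" "norm (\<zeta> (nxt n j) - \<zeta> j) = norm w"
        by (auto simp: w_def norm_minus_commute algebra_simps)
      ultimately show ?thesis by linarith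
    qed
    have "length_functional n (\<zeta>(j := m (\<zeta> j, t *\<^sub>R u))) = length_functional n \<zeta>
        + (norm (\<zeta> j + d - \<zeta> (prv n j)) - norm (\<zeta> j - \<zeta> (prv n j)))
        + (norm (\<zeta> (nxt n j) - (\<zeta> j + d)) - norm (\<zeta> (nxt n j) - \<zeta> j))"
      by (simp add: length_functional_update[OF n] d_def)
    moreover have "s - \<theta> * s - 4 * (\<eta> * s) = 4 * (\<eta> * s)" by (simp add: \<eta>_def field_simps)
    ultimately show ?thesis using A B \<eta>s by linarith
  qed
  have dirs: "\<exists>u\<in>K. \<zeta> j \<noteq> \<zeta> (nxt n j) \<longrightarrow> sgn (\<zeta> j - \<zeta> (nxt n j)) \<bullet> u \<ge> (1 - \<eta>) * (r / 2)"
    if \<zeta>: "\<zeta> \<in> configs n" "\<zeta> \<in> G0" for \<zeta>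
  proof (cases "\<zeta> j = \<zeta> (nxt n j)")
    case True
    then show ?thesis using K(2) by blast
  next
    case False
    define w where "w = \<zeta> j - \<zeta> (nxt n j)"
    \<comment> \<open>The tangential part of the vector from the successor to the point. Short
      chords are almost tangent, so \<open>p\<close> has nearly the full length of \<open>w\<close>
      and its direction leads away from the successor.\<close>
    define p where "p = w - (\<nu> \<bullet> w) *\<^sub>R \<nu>"
    have "w \<noteq> 0" using False by (simp add: w_def)
    have "\<bar>\<nu> \<bullet> w\<bar> \<le> \<eta> * norm w"
      unfolding w_def \<nu>_def by (rule flat) (use \<zeta> G0 n N in auto)
    moreover have "norm w - \<bar>\<nu> \<bullet> w\<bar> \<le> norm p"
      using norm_triangle_ineq2[of w "(\<nu> \<bullet> w) *\<^sub>R \<nu>"] \<nu> by (simp add: p_def)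
    ultimately have p: "norm p \<ge> (1 - \<eta>) * norm w" by (simp add: algebra_simps)
    have "(1 - \<eta>) * norm w > 0" using \<eta> \<open>w \<noteq> 0\<close> by simp
    then have "p \<noteq> 0" using p by auto
    have "\<nu> \<bullet> \<nu> = 1" using \<nu> by (simp add: norm_eq_1)
    then have \<nu>p: "\<nu> \<bullet> p = 0" by (simp add: p_def inner_diff_right)
    define u where "u = (r / 2) *\<^sub>R sgn p"
    have "u \<in> K" using \<nu>p \<open>p \<noteq> 0\<close> \<open>r > 0\<close> by (simp add: u_def K_def norm_sgn sgn_div_norm[of p])
    have "w \<bullet> p = (norm p)\<^sup>2" using inner_tangential_part[OF \<nu>p, of w] by (simp add: p_def power2_norm_eq_inner)
    then have "sgn w \<bullet> sgn p = norm p / norm w"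
      using \<open>p \<noteq> 0\<close> by (simp add: sgn_div_norm power2_eq_square field_simps)
    also have "\<dots> \<ge> 1 - \<eta>" using p \<open>w \<noteq> 0\<close> by (simp add: field_simps)
    finally have "sgn w \<bullet> sgn p * (r / 2) \<ge> (1 - \<eta>) * (r / 2)" using \<open>r > 0\<close> by (intro mult_right_mono) auto
    then show ?thesis using \<open>u \<in> K\<close> by (intro bexI[of _ u]) (auto simp: u_def w_def mult.commute)
  qed
  show ?thesis
  proof (rule passable_of_push[where ?G0.0 = G0 and K = K and j = j and y = y and m = m and r = r and \<eta> = \<eta>])
    show "m (a, v) \<in> S \<and> norm (m (a, v) - a - v) \<le> \<eta> * norm v"
      if "a \<in> S \<inter> ball y r" "normal y \<bullet> v = 0" "norm v < r" for a v
      by (rule m[OF that])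
    show "\<zeta> j \<in> ball y r" if "\<zeta> \<in> G0" for \<zeta> by (rule G0(4)[OF that])
    show "normal y \<bullet> u = 0 \<and> norm u = r / 2" if "u \<in> K" for u using that by (simp add: K_def \<nu>_def)
    show "length_functional n (q(j := m (q j, u))) > length_functional n q" if "u \<in> K" for u
      using gain[OF q(1) G0(2), of 1 u] that q(2) by simp
    show "\<exists>u\<in>K. \<forall>t. 0 < t \<longrightarrow> t \<le> 1 \<longrightarrow> length_functional n (\<zeta>(j := m (\<zeta> j, t *\<^sub>R u))) > length_functional n \<zeta>"
      if \<zeta>: "\<zeta> \<in> configs n" "\<zeta> \<in> G0" for \<zeta>
    proof -
      obtain u where "u \<in> K" "\<zeta> j \<noteq> \<zeta> (nxt n j) \<Longrightarrow> sgn (\<zeta> j - \<zeta> (nxt n j)) \<bullet> u \<ge> (1 - \<eta>) * (r / 2)"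
        using dirs[OF \<zeta>] by blast
      then show ?thesis using gain[OF \<zeta>] by blast
    qed
  qed (fact n q(1) \<open>r > 0\<close> contm G0(1,2) K)+
qed

text \<open>If every point that collides with its successor also collided with its predecessor, the
  collision would travel backwards around the whole cycle, and the length would be 0.\<close>

lemma collision_index:
  assumes n: "n \<ge> 3" and q: "length_functional n q \<noteq> 0" and i: "i < n" "q (nxt n i) = q i"
  obtains j where "j < n" "q (nxt n j) = q j" "q (prv n j) \<noteq> q j"
proof (rule ccontr)
  assume "\<not> thesis"
  with that have step: "q (prv n j) = q j" if "j < n" "q (nxt n j) = q j" for j
    using that by blast
  have collide: "q (nxt n ((i + k * (n - 1)) mod n)) = q ((i + k * (n - 1)) mod n)" for k
  proof (induction k)
    case (Suc k)
    define j where "j = (i + k * (n - 1)) mod n"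
    have "j < n" using n by (simp add: j_def)
    have eq: "(i + Suc k * (n - 1)) mod n = prv n j"
      unfolding j_def mod_add_left_eq by (simp add: ac_simps)
    have "q (prv n j) = q j" using step[OF \<open>j < n\<close>] Suc by (simp add: j_def)
    then show ?case unfolding eq nxt_prv(3)[OF n \<open>j < n\<close>] by simp
  qed (use i in simp)
  have "q (nxt n j) = q j" if "j < n" for j
  proof -
    obtain m where "n = j + Suc m" using less_imp_Suc_add[OF \<open>j < n\<close>] by auto
    \<comment> \<open>Modulo \<open>n\<close>, adding \<open>n - 1\<close> is one step back, and
      \<open>i + (n - j)\<close> such steps lead from \<open>i\<close> to \<open>j\<close>.\<close>
    then have "i + (i + (n - j)) * (n - 1) = j + n * (i + (n - j) - 1)"
      by (simp add: algebra_simps)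
    then have "(i + (i + (n - j)) * (n - 1)) mod n = j" using that by simp
    then show ?thesis using collide[of "i + (n - j)"] by simp
  qed
  then have "length_functional n q = 0" by (simp add: length_functional_def)
  then show False using q by simp
qed

end


subsection \<open>The second variation of the length\<close>

context boundary_chart
begin

abbreviation D1 :: "'a \<Rightarrow> 'a \<Rightarrow> real" where "D1 x v \<equiv> frechet_derivative \<tau> (at x) v"
abbreviation D2 :: "'a \<Rightarrow> 'a \<Rightarrow> 'a \<Rightarrow> real" where "D2 x v w \<equiv> frechet_derivative (\<lambda>x. D1 x v) (at x) w"

lemma has_derivative_D1: "x \<in> W \<Longrightarrow> (\<tau> has_derivative D1 x) (at x)"
  by (rule smooth_on_has_derivative[OF smooth])

lemma has_derivative_D2: "x \<in> W \<Longrightarrow> ((\<lambda>x. D1 x v) has_derivative D2 x v) (at x)"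
  by (rule smooth_on_has_derivative[OF smooth_on_Suc[OF smooth]])

lemma linear_D1: "x \<in> W \<Longrightarrow> linear (D1 x)"
  by (rule linear_frechet_derivative[OF smooth_on_differentiable[OF smooth]])

lemma linear_D2: "x \<in> W \<Longrightarrow> linear (D2 x v)"
  by (rule linear_frechet_derivative[OF smooth_on_differentiable[OF smooth_on_Suc[OF smooth]]])

lemma D2_commute: "x \<in> W \<Longrightarrow> D2 x v w = D2 x w v"
  by (rule second_derivative_symmetric[OF open_W smooth])

lemma linear_D2_left: "x \<in> W \<Longrightarrow> linear (\<lambda>v. D2 x v w)"
  using linear_D2[of x w] by (simp add: D2_commute[of x _ w])

lemma D1_expand: "x \<in> W \<Longrightarrow> D1 x v = (\<Sum>b\<in>Basis. (v \<bullet> b) * D1 x b)"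
  using linear_eq_sum_Basis[OF linear_D1, of x v] by simp

lemma D2_expand: "x \<in> W \<Longrightarrow> D2 x v w = (\<Sum>b\<in>Basis. \<Sum>c\<in>Basis. (v \<bullet> b) * ((w \<bullet> c) * D2 x b c))"
  using second_derivative_linear[of x v w] linear_eq_sum_Basis[OF linear_D2, of x _ w]
  by (simp add: sum_distrib_left)

text \<open>Smoothness gives continuity of the derivative in fixed directions; the basis expansion
  allows the direction \<open>Z p\<close> to vary with the parameter as well.\<close>

lemma isCont_D1:
  assumes "isCont Y p" "isCont Z p" "Y p \<in> W"
  shows "isCont (\<lambda>p::'p::t2_space. D1 (Y p) (Z p)) p"
proof -
  have "isCont (\<lambda>x. D1 x b) (Y p)" for b
    using smooth_on_continuous[OF smooth_on_Suc[OF smooth]] assms(3) open_W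
    by (simp add: continuous_on_eq_continuous_at)
  then have "isCont (\<lambda>p. D1 (Y p) b) p" for b by (rule isCont_o2[OF assms(1)])
  then have "isCont (\<lambda>p. \<Sum>b\<in>Basis. (Z p \<bullet> b) * D1 (Y p) b) p"
    by (intro continuous_intros assms)
  moreover have "\<forall>\<^sub>F p in nhds p. D1 (Y p) (Z p) = (\<Sum>b\<in>Basis. (Z p \<bullet> b) * D1 (Y p) b)"
    using isCont_eventually_in_open[OF assms(1) open_W assms(3)] by eventually_elim (rule D1_expand)
  ultimately show ?thesis by (simp add: isCont_cong)
qed

lemma isCont_D2:
  assumes "isCont Y p" "isCont Z p" "isCont Z' p" "Y p \<in> W"
  shows "isCont (\<lambda>p::'p::t2_space. D2 (Y p) (Z p) (Z' p)) p"
proof -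
  have "isCont (\<lambda>x. D2 x b c) (Y p)" for b c
    using smooth_on_continuous[OF smooth_on_Suc[OF smooth_on_Suc[OF smooth]]] assms(4) open_W
    by (simp add: continuous_on_eq_continuous_at)
  then have "isCont (\<lambda>p. D2 (Y p) b c) p" for b c by (rule isCont_o2[OF assms(1)])
  then have "isCont (\<lambda>p. \<Sum>b\<in>Basis. \<Sum>c\<in>Basis. (Z p \<bullet> b) * ((Z' p \<bullet> c) * D2 (Y p) b c)) p"
    by (intro continuous_intros assms)
  moreover have "\<forall>\<^sub>F p in nhds p. D2 (Y p) (Z p) (Z' p) =
      (\<Sum>b\<in>Basis. \<Sum>c\<in>Basis. (Z p \<bullet> b) * ((Z' p \<bullet> c) * D2 (Y p) b c))"
    using isCont_eventually_in_open[OF assms(1) open_W assms(4)] by eventually_elim (rule D2_expand)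
  ultimately show ?thesis by (simp add: isCont_cong)
qed

lemma isCont_\<tau>:
  assumes "isCont Y p" "Y p \<in> W"
  shows "isCont (\<lambda>p::'p::t2_space. \<tau> (Y p)) p"
proof -
  have "isCont \<tau> (Y p)"
    using smooth_on_continuous[OF smooth] assms(2) open_W by (simp add: continuous_on_eq_continuous_at)
  then show ?thesis by (rule isCont_o2[OF assms(1)])
qed

lemma D1_along:
  assumes "(c has_vector_derivative c') (at t)" "c t \<in> W"
  shows "((\<lambda>t. \<tau> (c t)) has_real_derivative D1 (c t) c') (at t)"
proof -
  have "((\<lambda>t. \<tau> (c t)) has_derivative (\<lambda>h. D1 (c t) (h *\<^sub>R c'))) (at t)"
    using assms(1) has_derivative_D1[OF assms(2)] unfolding has_vector_derivative_def
    by (rule has_derivative_compose)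
  then show ?thesis
    by (simp add: has_field_derivative_def mult_commute_abs linear_scale[OF linear_D1[OF assms(2)]])
qed

lemma D2_along:
  assumes c: "(c has_vector_derivative c') (at t)" "c t \<in> W" and b: "(b has_vector_derivative b') (at t)"
  shows "((\<lambda>t. D1 (c t) (b t)) has_real_derivative D1 (c t) b' + D2 (c t) (b t) c') (at t)"
proof -
  have D: "((\<lambda>t. D1 (c t) e) has_real_derivative D2 (c t) e c') (at t)" for e
  proof -
    have "((\<lambda>t. D1 (c t) e) has_derivative (\<lambda>h. D2 (c t) e (h *\<^sub>R c'))) (at t)"
      using c(1) has_derivative_D2[OF c(2)] unfolding has_vector_derivative_def
      by (rule has_derivative_compose)
    then show ?thesis
      by (simp add: has_field_derivative_def mult_commute_abs linear_scale[OF linear_D2[OF c(2)]])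
  qed
  have B: "((\<lambda>t. b t \<bullet> e) has_real_derivative b' \<bullet> e) (at t)" for e
    using bounded_linear.has_vector_derivative[OF bounded_linear_inner_left b]
    by (simp add: has_real_derivative_iff_has_vector_derivative)
  have "((\<lambda>t. \<Sum>e\<in>Basis. (b t \<bullet> e) * D1 (c t) e) has_real_derivative
      (\<Sum>e\<in>Basis. (b' \<bullet> e) * D1 (c t) e + D2 (c t) e c' * (b t \<bullet> e))) (at t)"
    by (intro DERIV_sum DERIV_mult B D)
  moreover have "(\<Sum>e\<in>Basis. (b' \<bullet> e) * D1 (c t) e + D2 (c t) e c' * (b t \<bullet> e)) = D1 (c t) b' + D2 (c t) (b t) c'"
    using D1_expand[OF c(2), of b'] second_derivative_linear[OF c(2), of "b t" c']
    by (simp add: sum.distrib mult.commute)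
  moreover have "\<forall>\<^sub>F s in nhds t. (\<Sum>e\<in>Basis. (b s \<bullet> e) * D1 (c s) e) = D1 (c s) (b s)"
  proof -
    have "isCont c t" using c(1) has_vector_derivative_continuous by blast
    from isCont_eventually_in_open[OF this open_W c(2)] show ?thesis
      by eventually_elim (rule D1_expand[symmetric])
  qed
  ultimately show ?thesis by (simp add: DERIV_cong_ev[OF refl _ refl])
qed

end

lemma has_vector_derivative_sgn:
  fixes F :: "real \<Rightarrow> 'a::real_inner"
  assumes F: "(F has_vector_derivative F') (at t)" and "F t \<noteq> 0"
  shows "((\<lambda>t. norm (F t)) has_real_derivative sgn (F t) \<bullet> F') (at t)"
    and "((\<lambda>t. sgn (F t)) has_vector_derivative (inverse (norm (F t)) *\<^sub>R (F' - (sgn (F t) \<bullet> F') *\<^sub>R sgn (F t)))) (at t)"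
proof -
  have "((\<lambda>t. norm (F t)) has_derivative (\<lambda>h. (h *\<^sub>R F') \<bullet> sgn (F t))) (at t)"
    using F has_derivative_norm[OF assms(2)] unfolding has_vector_derivative_def
    by (rule has_derivative_compose)
  then show N: "((\<lambda>t. norm (F t)) has_real_derivative sgn (F t) \<bullet> F') (at t)"
    by (simp add: has_field_derivative_def mult_commute_abs inner_commute)
  have "((\<lambda>t. inverse (norm (F t)) *\<^sub>R F t) has_vector_derivative
      inverse (norm (F t)) *\<^sub>R F' + (- (inverse (norm (F t)) * (sgn (F t) \<bullet> F') * inverse (norm (F t)))) *\<^sub>R F t) (at t)"
    by (rule has_vector_derivative_scaleR[OF DERIV_inverse'[OF N] F]) (use assms(2) in simp)
  then show "((\<lambda>t. sgn (F t)) has_vector_derivative (inverse (norm (F t)) *\<^sub>R (F' - (sgn (F t) \<bullet> F') *\<^sub>R sgn (F t)))) (at t)"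
    by (simp add: sgn_div_norm scaleR_diff_right mult.assoc mult.left_commute mult.commute)
qed

text \<open>The second derivative of the norm at a nonzero vector \<open>F\<close>, in the
  directions \<open>a\<close> and \<open>b\<close>.\<close>

definition edge_form :: "'a::real_inner \<Rightarrow> 'a \<Rightarrow> 'a \<Rightarrow> real" where
  "edge_form F a b = (a \<bullet> b - (sgn F \<bullet> a) * (sgn F \<bullet> b)) / norm F"

lemma length_first_derivative:
  assumes "\<And>j. j < n \<Longrightarrow> ((\<lambda>t. y t j) has_vector_derivative y' j) (at t)"
    and "\<And>j. j < n \<Longrightarrow> y t (nxt n j) \<noteq> y t j"
  shows "((\<lambda>t. length_functional n (y t)) has_real_derivative
    (\<Sum>j<n. sgn (y t (nxt n j) - y t j) \<bullet> (y' (nxt n j) - y' j))) (at t)"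
  unfolding length_functional_def
proof (rule DERIV_sum)
  fix j assume "j \<in> {..<n}"
  then have j: "j < n" "nxt n j < n" by auto
  have "((\<lambda>t. y t (nxt n j) - y t j) has_vector_derivative y' (nxt n j) - y' j) (at t)"
    by (rule has_vector_derivative_diff[OF assms(1)[OF j(2)] assms(1)[OF j(1)]])
  then show "((\<lambda>t. norm (y t (nxt n j) - y t j)) has_real_derivative
      sgn (y t (nxt n j) - y t j) \<bullet> (y' (nxt n j) - y' j)) (at t)"
    by (rule has_vector_derivative_sgn(1)) (use assms(2)[OF j(1)] in simp)
qed

text \<open>The field \<open>b\<close> need not be the velocity \<open>y'\<close> of the curve. With
  \<open>b\<close> the velocity in a second parameter this computes mixed derivatives of
  two-parameter families, and with \<open>b\<close> the velocity itself the second derivative along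
  a curve.\<close>

lemma length_second_derivative:
  fixes y :: "real \<Rightarrow> nat \<Rightarrow> 'a::real_inner"
  assumes y: "\<And>j. j < n \<Longrightarrow> ((\<lambda>t. y t j) has_vector_derivative y' j) (at t)"
    and b: "\<And>j. j < n \<Longrightarrow> ((\<lambda>t. b t j) has_vector_derivative b' j) (at t)"
    and ne: "\<And>j. j < n \<Longrightarrow> y t (nxt n j) \<noteq> y t j"
  shows "((\<lambda>t. \<Sum>j<n. sgn (y t (nxt n j) - y t j) \<bullet> (b t (nxt n j) - b t j)) has_real_derivative
    (\<Sum>j<n. edge_form (y t (nxt n j) - y t j) (y' (nxt n j) - y' j) (b t (nxt n j) - b t j)
      + sgn (y t (nxt n j) - y t j) \<bullet> (b' (nxt n j) - b' j))) (at t)"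
proof (rule DERIV_sum)
  fix j assume "j \<in> {..<n}"
  then have j: "j < n" "nxt n j < n" by auto
  define F where "F t = y t (nxt n j) - y t j" for t
  define F' where "F' = y' (nxt n j) - y' j"
  define a where "a t = b t (nxt n j) - b t j" for t
  define a' where "a' = b' (nxt n j) - b' j"
  have F: "(F has_vector_derivative F') (at t)" and "F t \<noteq> 0"
    unfolding F_def F'_def using has_vector_derivative_diff[OF y[OF j(2)] y[OF j(1)]] ne[OF j(1)] by auto
  have a: "(a has_vector_derivative a') (at t)"
    unfolding a_def a'_def using has_vector_derivative_diff[OF b[OF j(2)] b[OF j(1)]] by auto
  have "((\<lambda>t. sgn (F t) \<bullet> a t) has_vector_derivative
      sgn (F t) \<bullet> a' + (inverse (norm (F t)) *\<^sub>R (F' - (sgn (F t) \<bullet> F') *\<^sub>R sgn (F t))) \<bullet> a t) (at t)"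
    by (rule bounded_bilinear.has_vector_derivative[OF bounded_bilinear_inner
          has_vector_derivative_sgn(2)[OF F \<open>F t \<noteq> 0\<close>] a])
  moreover have "sgn (F t) \<bullet> a' + (inverse (norm (F t)) *\<^sub>R (F' - (sgn (F t) \<bullet> F') *\<^sub>R sgn (F t))) \<bullet> a t
      = edge_form (F t) F' (a t) + sgn (F t) \<bullet> a'"
    by (simp add: edge_form_def inner_diff_left divide_inverse mult.commute)
  ultimately show "((\<lambda>t. sgn (y t (nxt n j) - y t j) \<bullet> (b t (nxt n j) - b t j)) has_real_derivative
    edge_form (y t (nxt n j) - y t j) (y' (nxt n j) - y' j) (b t (nxt n j) - b t j)
      + sgn (y t (nxt n j) - y t j) \<bullet> (b' (nxt n j) - b' j)) (at t)"
    by (simp add: has_real_derivative_iff_has_vector_derivative F_def F'_def a_def a'_def add.commute)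
qed

text \<open>Cyclic summation by parts, from a sum over edges to a sum over points.\<close>

lemma sum_nxt:
  assumes "n \<ge> 3"
  shows "(\<Sum>j<n. e j \<bullet> (x (nxt n j) - x j)) = (\<Sum>j<n. (e (prv n j) - e j) \<bullet> (x j :: 'a::real_inner))"
proof -
  have "(\<Sum>j<n. e j \<bullet> x (nxt n j)) = (\<Sum>j<n. e (prv n j) \<bullet> x j)"
    by (rule sum.reindex_bij_witness[of _ "prv n" "nxt n"]) (use nxt_prv[OF assms] in auto)
  then show ?thesis by (simp add: inner_diff_right inner_diff_left sum_subtractf)
qed

lemma convex_growth:
  fixes g :: "real \<Rightarrow> real"
  assumes "a > 0" "\<And>t. 0 \<le> t \<Longrightarrow> t \<le> a \<Longrightarrow> (g has_real_derivative g1 t) (at t)"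
    and "\<And>t. 0 \<le> t \<Longrightarrow> t \<le> a \<Longrightarrow> (g1 has_real_derivative g2 t) (at t)"
    and "\<And>t. 0 \<le> t \<Longrightarrow> t \<le> a \<Longrightarrow> g2 t > 0" "g1 0 \<ge> 0"
  shows "g a > g 0"
proof -
  obtain z where z: "0 < z" "z < a" "g a - g 0 = (a - 0) * g1 z"
    using MVT2[of 0 a g g1] assms(1,2) by blast
  have "g1 0 < g1 z"
    by (rule DERIV_pos_imp_increasing[OF z(1)]) (use z assms(3,4) in \<open>meson less_imp_le order_trans\<close>)
  then have "(a - 0) * g1 z > 0" using assms(1,5) by simp
  then show ?thesis using z(3) by simp
qed


section \<open>Critical configurations and their Hessian\<close>

context convex_table
begin

text \<open>The difference of unit vectors is the gradient of the length in the point
  \<open>j\<close>; it has to be normal to \<open>S\<close> there.\<close>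

definition critical :: "nat \<Rightarrow> (nat \<Rightarrow> 'a) \<Rightarrow> bool" where
  "critical n q \<longleftrightarrow> q \<in> cyclic_config n S \<and>
     (\<forall>j<n. \<forall>v. normal (q j) \<bullet> v = 0 \<longrightarrow> (sgn (q j - q (prv n j)) - sgn (q (nxt n j) - q j)) \<bullet> v = 0)"

end

locale critical_config = convex_table S U for S U :: "'a::euclidean_space set" +
  fixes n :: nat and q :: "nat \<Rightarrow> 'a" and W :: "nat \<Rightarrow> 'a set" and \<tau> :: "nat \<Rightarrow> 'a \<Rightarrow> real"
  assumes n: "n \<ge> 3" and crit: "critical n q"
    and charts: "\<And>j. j < n \<Longrightarrow> boundary_chart S U (q j) (normal (q j)) (W j) (\<tau> j)"
begin

abbreviation "\<nu> j \<equiv> normal (q j)"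
abbreviation "e j \<equiv> sgn (q (nxt n j) - q j)"
definition "lagrange j = (e (prv n j) - e j) \<bullet> \<nu> j"
abbreviation "DD j v w \<equiv> boundary_chart.D2 (\<tau> j) (q j) v w"
definition "pt j x = x + \<tau> j x *\<^sub>R \<nu> j"

text \<open>The Hessian at a critical point in closed form. The acceleration of a variation enters it only
  through the component normal to \<open>S\<close>, because the gradient \<open>lagrange j *\<^sub>R \<nu> j\<close> is normal, and
  that component is \<open>DD j (v j) (w j)\<close>: differentiate \<open>\<tau> j (\<sigma> (s, t) j) = 0\<close> twice.\<close>

definition hess :: "(nat \<Rightarrow> 'a) \<Rightarrow> (nat \<Rightarrow> 'a) \<Rightarrow> real" where
  "hess v w = (\<Sum>j<n. edge_form (q (nxt n j) - q j) (v (nxt n j) - v j) (w (nxt n j) - w j))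
     + (\<Sum>j<n. lagrange j * DD j (v j) (w j))"

lemma q_in: "q \<in> cyclic_config n S" "q \<in> configs n" "j < n \<Longrightarrow> q j \<in> S"
  "j < n \<Longrightarrow> q (nxt n j) \<noteq> q j" "j \<ge> n \<Longrightarrow> q j = undefined"
proof -
  show c: "q \<in> cyclic_config n S" using crit by (simp add: critical_def)
  then show q: "q \<in> configs n" by (simp add: cyclic_config_def)
  show "j < n \<Longrightarrow> q j \<in> S" by (rule PiE_mem[OF q]) simp
  show "j < n \<Longrightarrow> q (nxt n j) \<noteq> q j" using c unfolding cyclic_config_def by force
  show "j \<ge> n \<Longrightarrow> q j = undefined" by (rule PiE_arb[OF q]) simp
qed

lemma unit_normal: "j < n \<Longrightarrow> norm (\<nu> j) = 1" "j < n \<Longrightarrow> \<nu> j \<bullet> \<nu> j = 1"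
  using norm_normal[OF q_in(3)] by (auto simp: norm_eq_1)

lemma balance: "j < n \<Longrightarrow> e (prv n j) - e j = lagrange j *\<^sub>R \<nu> j"
proof -
  assume j: "j < n"
  define g where "g = e (prv n j) - e j"
  define v where "v = g - (\<nu> j \<bullet> g) *\<^sub>R \<nu> j"
  have \<nu>v: "\<nu> j \<bullet> v = 0" using unit_normal[OF j] by (simp add: v_def inner_diff_right)
  moreover have "g = sgn (q j - q (prv n j)) - sgn (q (nxt n j) - q j)"
    using nxt_prv[OF n j] by (simp add: g_def)
  ultimately have "g \<bullet> v = 0" using crit j unfolding critical_def by auto
  then have "v \<bullet> v = 0" using inner_tangential_part[OF \<nu>v, of g] by (simp add: v_def)
  then show ?thesis by (simp add: v_def lagrange_def g_def inner_commute)
qed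

lemma tangent_config: "v \<in> config_tangent_space n S q \<longleftrightarrow> (\<forall>j<n. \<nu> j \<bullet> v j = 0) \<and> (\<forall>j\<ge>n. v j = 0)"
  using tangent_space[OF q_in(3)] by (auto simp: config_tangent_space_def)

text \<open>For tangent vectors the right side is 0. The identity is also applied to accelerations,
  of which only the normal component survives.\<close>

lemma first_order: "(\<Sum>j<n. e j \<bullet> (x (nxt n j) - x j)) = (\<Sum>j<n. lagrange j * (\<nu> j \<bullet> x j))"
  unfolding sum_nxt[OF n, of e x] by (rule sum.cong) (simp_all only: lessThan_iff balance inner_scaleR_left)

text \<open>All variations with the same velocities give the same number, as the definite
  description in \<open>length_hessian\<close> requires.\<close>

lemma hessian_value:
  assumes "config_variation n S q v w \<sigma>"
  shows "deriv (\<lambda>s. deriv (\<lambda>t. length_functional n (\<sigma> (s, t))) 0) 0 = hess v w"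
proof -
  obtain r where "r > 0" and \<sigma>_in: "\<And>p. p \<in> ball (0, 0) r \<Longrightarrow> \<sigma> p \<in> cyclic_config n S"
    and \<sigma>_smooth: "\<And>j. j < n \<Longrightarrow> smooth_on (ball (0, 0) r) (\<lambda>z. \<sigma> z j)"
    and \<sigma>0: "\<sigma> (0, 0) = q"
    and vel: "\<And>j. j < n \<Longrightarrow> ((\<lambda>s. \<sigma> (s, 0) j) has_vector_derivative v j) (at 0)"
      "\<And>j. j < n \<Longrightarrow> ((\<lambda>t. \<sigma> (0, t) j) has_vector_derivative w j) (at 0)"
    using assms unfolding config_variation_def by (auto simp: image_subset_iff)
  define A where "A s j = frechet_derivative (\<lambda>z. \<sigma> z j) (at (s, 0)) (1, 0)" for s :: real and j
  define B where "B s j = frechet_derivative (\<lambda>z. \<sigma> z j) (at (s, 0)) (0, 1)" for s :: real and j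
  have inb: "(s, 0) \<in> ball (0, 0) r \<longleftrightarrow> \<bar>s\<bar> < r" "(0, s) \<in> ball (0, 0) r \<longleftrightarrow> \<bar>s\<bar> < r" for s :: real
    by (auto simp: dist_Pair_Pair)
  have ds: "((\<lambda>s. f (s, 0)) has_vector_derivative frechet_derivative f (at (s, 0)) (1, 0)) (at s)"
    and dt: "((\<lambda>t. f (s, t)) has_vector_derivative frechet_derivative f (at (s, 0)) (0, 1)) (at 0)"
    if f: "smooth_on (ball (0, 0) r) f" "\<bar>s\<bar> < r" for f :: "real \<times> real \<Rightarrow> 'a" and s
  proof -
    have D: "(f has_derivative frechet_derivative f (at (s, 0))) (at (s, 0))"
      by (rule smooth_on_has_derivative[OF f(1)]) (use inb f(2) in auto)
    have lin: "linear (frechet_derivative f (at (s, 0)))" using D has_derivative_linear by blast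
    have "((\<lambda>s. (s, 0::real)) has_derivative (\<lambda>h. h *\<^sub>R (1, 0))) (at s)"
      by (auto intro!: derivative_eq_intros)
    from has_derivative_compose[OF this D]
    show "((\<lambda>s. f (s, 0)) has_vector_derivative frechet_derivative f (at (s, 0)) (1, 0)) (at s)"
      unfolding has_vector_derivative_def linear_scale[OF lin] .
    have "((\<lambda>t. (s, t)) has_derivative (\<lambda>h. h *\<^sub>R (0, 1))) (at (0::real))"
      by (auto intro!: derivative_eq_intros)
    from has_derivative_compose[OF this D]
    show "((\<lambda>t. f (s, t)) has_vector_derivative frechet_derivative f (at (s, 0)) (0, 1)) (at 0)"
      unfolding has_vector_derivative_def linear_scale[OF lin] .
  qed
  have B0: "B 0 j = w j" if "j < n" for j
    using dt[OF \<sigma>_smooth[OF that], of 0] vel(2)[OF that] \<open>r > 0\<close> vector_derivative_unique_at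
    unfolding B_def by (metis abs_zero)
  define b' where "b' j = frechet_derivative (\<lambda>z. frechet_derivative (\<lambda>z. \<sigma> z j) (at z) (0, 1)) (at (0, 0)) (1, 0)" for j
  have DB: "((\<lambda>s. B s j) has_vector_derivative b' j) (at 0)" if "j < n" for j
    unfolding B_def b'_def using ds[OF smooth_on_Suc[OF \<sigma>_smooth[OF that]], of 0] \<open>r > 0\<close> by simp
  have ne: "\<sigma> p (nxt n j) \<noteq> \<sigma> p j" if "p \<in> ball (0, 0) r" "j < n" for p j
    using \<sigma>_in[OF that(1)] that(2) unfolding cyclic_config_def by force
  have inner_deriv: "deriv (\<lambda>t. length_functional n (\<sigma> (s, t))) 0 =
      (\<Sum>j<n. sgn (\<sigma> (s, 0) (nxt n j) - \<sigma> (s, 0) j) \<bullet> (B s (nxt n j) - B s j))" if s: "\<bar>s\<bar> < r" for s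
  proof (rule DERIV_imp_deriv, rule length_first_derivative)
    show "((\<lambda>t. \<sigma> (s, t) j) has_vector_derivative B s j) (at 0)" if "j < n" for j
      unfolding B_def by (rule dt[OF \<sigma>_smooth[OF that] s])
    show "\<sigma> (s, 0) (nxt n j) \<noteq> \<sigma> (s, 0) j" if "j < n" for j
      by (rule ne[OF _ that]) (use s inb in auto)
  qed
  have normal_b': "\<nu> j \<bullet> b' j = DD j (w j) (v j)" if j: "j < n" for j
  proof -
    interpret boundary_chart S U "q j" "\<nu> j" "W j" "\<tau> j" by (rule charts[OF j])
    have c0: "\<sigma> (0, 0) j = q j" using \<sigma>0 by simp
    have "isCont (\<lambda>s. \<sigma> (s, 0) j) 0" using vel(1)[OF j] has_vector_derivative_continuous by blast
    then have "\<forall>\<^sub>F s in nhds 0. \<sigma> (s, 0) j \<in> W j"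
      by (rule isCont_eventually_in_open[OF _ open_W]) (use c0 center in simp)
    moreover have "\<forall>\<^sub>F s in nhds 0. s \<in> {-r<..<r}" using \<open>r > 0\<close> by (intro eventually_nhds_in_open) auto
    \<comment> \<open>For each small \<open>s\<close> the curve in \<open>t\<close> stays in
      \<open>S\<close>, so its velocity \<open>B s j\<close> at \<open>t = 0\<close> is tangent.
      Differentiating this condition in \<open>s\<close> expresses the normal component of the mixed
      derivative \<open>b' j\<close> through \<open>DD\<close>.\<close>
    ultimately have "\<forall>\<^sub>F s in nhds 0. D1 (\<sigma> (s, 0) j) (B s j) = 0"
    proof eventually_elim
      case (elim s)
      then have s: "\<bar>s\<bar> < r" by auto
      have dB: "((\<lambda>t. \<sigma> (s, t) j) has_vector_derivative B s j) (at 0)"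
        unfolding B_def by (rule dt[OF \<sigma>_smooth[OF j] s])
      have D: "((\<lambda>t. \<tau> j (\<sigma> (s, t) j)) has_real_derivative D1 (\<sigma> (s, 0) j) (B s j)) (at 0)"
        by (rule D1_along[OF dB elim(1)])
      have "isCont (\<lambda>t. \<sigma> (s, t) j) 0" using dB has_vector_derivative_continuous by blast
      then have "\<forall>\<^sub>F t in nhds 0. \<sigma> (s, t) j \<in> W j"
        by (rule isCont_eventually_in_open[OF _ open_W]) (use elim in simp)
      moreover have "\<forall>\<^sub>F t in nhds (0::real). (s, t) \<in> ball (0, 0) r"
      proof -
        have "isCont (\<lambda>t::real. (s, t)) 0" by (intro continuous_intros)
        moreover have "(s, 0) \<in> ball (0, 0) r" using inb s by blast
        ultimately show ?thesis by (rule isCont_eventually_in_open[OF _ open_ball])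
      qed
      ultimately have "\<forall>\<^sub>F t in nhds 0. \<tau> j (\<sigma> (s, t) j) = 0"
      proof eventually_elim
        case (elim t)
        have "\<sigma> (s, t) \<in> configs n" using \<sigma>_in[OF elim(2)] by (simp add: cyclic_config_def)
        then have "\<sigma> (s, t) j \<in> S" by (rule PiE_mem) (use j in simp)
        then show ?case using in_S_iff[OF elim(1)] by simp
      qed
      then have "((\<lambda>t. \<tau> j (\<sigma> (s, t) j)) has_real_derivative 0) (at 0)"
        by (subst DERIV_cong_ev[OF refl _ refl, where g = "\<lambda>t. 0"]) auto
      from DERIV_unique[OF D this] show ?case .
    qed
    then have z: "((\<lambda>s. D1 (\<sigma> (s, 0) j) (B s j)) has_real_derivative 0) (at 0)"
      by (subst DERIV_cong_ev[OF refl _ refl, where g = "\<lambda>t. 0"]) auto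
    have "((\<lambda>s. D1 (\<sigma> (s, 0) j) (B s j)) has_real_derivative
        D1 (\<sigma> (0, 0) j) (b' j) + boundary_chart.D2 (\<tau> j) (\<sigma> (0, 0) j) (B 0 j) (v j)) (at 0)"
      by (rule D2_along[OF vel(1)[OF j] _ DB[OF j]]) (use c0 center in simp)
    from DERIV_unique[OF this z] have "D1 (q j) (b' j) + DD j (w j) (v j) = 0"
      unfolding c0 B0[OF j] .
    then show ?thesis using deriv_center[of "b' j"] by simp
  qed
  have "((\<lambda>s. \<Sum>j<n. sgn (\<sigma> (s, 0) (nxt n j) - \<sigma> (s, 0) j) \<bullet> (B s (nxt n j) - B s j)) has_real_derivative
    (\<Sum>j<n. edge_form (\<sigma> (0, 0) (nxt n j) - \<sigma> (0, 0) j) (v (nxt n j) - v j) (B 0 (nxt n j) - B 0 j)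
      + sgn (\<sigma> (0, 0) (nxt n j) - \<sigma> (0, 0) j) \<bullet> (b' (nxt n j) - b' j))) (at 0)"
  proof (rule length_second_derivative[where y = "\<lambda>s. \<sigma> (s, 0)" and b = B and y' = v and b' = b'])
    show "\<sigma> (0, 0) (nxt n j) \<noteq> \<sigma> (0, 0) j" if "j < n" for j
      by (rule ne[OF _ that]) (use \<open>r > 0\<close> in simp)
  qed (fact vel(1) DB)+
  moreover have "(\<Sum>j<n. edge_form (\<sigma> (0, 0) (nxt n j) - \<sigma> (0, 0) j) (v (nxt n j) - v j) (B 0 (nxt n j) - B 0 j)
      + sgn (\<sigma> (0, 0) (nxt n j) - \<sigma> (0, 0) j) \<bullet> (b' (nxt n j) - b' j)) = hess v w"
  proof -
    have "(\<Sum>j<n. lagrange j * (\<nu> j \<bullet> b' j)) = (\<Sum>j<n. lagrange j * DD j (v j) (w j))"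
      using normal_b' boundary_chart.D2_commute[OF charts boundary_chart.center(1)[OF charts]]
      by (intro sum.cong) (auto simp: charts)
    moreover have "(\<Sum>j<n. edge_form (q (nxt n j) - q j) (v (nxt n j) - v j) (B 0 (nxt n j) - B 0 j)) =
       (\<Sum>j<n. edge_form (q (nxt n j) - q j) (v (nxt n j) - v j) (w (nxt n j) - w j))"
      using n by (intro sum.cong) (auto simp: B0)
    ultimately show ?thesis by (simp add: \<sigma>0 sum.distrib hess_def first_order)
  qed
  ultimately have "((\<lambda>s. \<Sum>j<n. sgn (\<sigma> (s, 0) (nxt n j) - \<sigma> (s, 0) j) \<bullet> (B s (nxt n j) - B s j)) has_real_derivative
    hess v w) (at 0)" by simp
  then have "((\<lambda>s. deriv (\<lambda>t. length_functional n (\<sigma> (s, t))) 0) has_real_derivative hess v w) (at 0)"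
    by (rule has_field_derivative_transform_within_open[of _ _ _ "{-r<..<r}"]) (use inner_deriv \<open>r > 0\<close> in auto)
  then show ?thesis by (rule DERIV_imp_deriv)
qed

text \<open>Existence for the definite description in \<open>length_hessian\<close>. The planar
  family \<open>q + s v + t w\<close> is projected to \<open>S\<close> along the normals; since
  \<open>v\<close> and \<open>w\<close> are tangent the velocities are preserved, and small
  parameters produce no collisions.\<close>

lemma variation_exists:
  assumes "v \<in> config_tangent_space n S q" "w \<in> config_tangent_space n S q"
  shows "\<exists>\<sigma>. config_variation n S q v w \<sigma>"
proof -
  have vw: "\<nu> j \<bullet> v j = 0" "\<nu> j \<bullet> w j = 0" if "j < n" for j
    using assms that by (auto simp: tangent_config)
  define Y where "Y j p = q j + fst p *\<^sub>R v j + snd p *\<^sub>R w j" for j and p :: "real \<times> real"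
  define \<sigma> where "\<sigma> p = (\<lambda>j. if j < n then pt j (Y j p) else undefined)" for p
  have Y0: "Y j (0, 0) = q j" for j by (simp add: Y_def)
  have contY: "isCont (Y j) p" for j p unfolding Y_def by (intro continuous_intros)
  have pt0: "pt j (q j) = q j" if "j < n" for j
    using boundary_chart.center(2)[OF charts[OF that]] by (simp add: pt_def)
  have contpt: "isCont (\<lambda>p. pt j (Y j p)) (0, 0)" if "j < n" for j
    unfolding pt_def
    by (intro continuous_intros boundary_chart.isCont_\<tau>[OF charts[OF that]] contY)
       (simp add: Y0 boundary_chart.center(1)[OF charts[OF that]])
  have ev: "\<forall>\<^sub>F p in nhds (0, 0). Y j p \<in> W j \<and> pt (nxt n j) (Y (nxt n j) p) \<noteq> pt j (Y j p)" if j: "j < n" for j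
  proof (rule eventually_conj)
    show "\<forall>\<^sub>F p in nhds (0, 0). Y j p \<in> W j"
      by (rule isCont_eventually_in_open[OF contY boundary_chart.open_W[OF charts[OF j]]])
         (simp add: Y0 boundary_chart.center(1)[OF charts[OF j]])
    have k: "nxt n j < n" using n by simp
    have "\<forall>\<^sub>F p in nhds (0, 0). pt (nxt n j) (Y (nxt n j) p) - pt j (Y j p) \<in> - {0}"
      by (rule isCont_eventually_in_open) (use q_in(4)[OF j] pt0[OF j] pt0[OF k] in
          \<open>auto intro!: continuous_intros contpt j k simp: Y0\<close>)
    then show "\<forall>\<^sub>F p in nhds (0, 0). pt (nxt n j) (Y (nxt n j) p) \<noteq> pt j (Y j p)"
      by eventually_elim auto
  qed
  have "\<forall>\<^sub>F p in nhds (0, 0). \<forall>j\<in>{..<n}. Y j p \<in> W j \<and> pt (nxt n j) (Y (nxt n j) p) \<noteq> pt j (Y j p)"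
    by (rule eventually_ball_finite) (use ev in auto)
  then obtain r where "r > 0" and r: "\<And>p j. dist p (0, 0) < r \<Longrightarrow> j < n \<Longrightarrow> Y j p \<in> W j \<and> pt (nxt n j) (Y (nxt n j) p) \<noteq> pt j (Y j p)"
    unfolding eventually_nhds_metric by (metis lessThan_iff)
  have in_S: "pt j (Y j p) \<in> S" if "dist p (0, 0) < r" "j < n" for p j
    using boundary_chart.graph_in[OF charts[OF that(2)]] r[OF that] by (simp add: pt_def)
  have "config_variation n S q v w \<sigma>"
    unfolding config_variation_def
  proof (intro conjI exI allI impI)
    show "r > 0" by fact
    show "\<sigma> ` ball (0, 0) r \<subseteq> cyclic_config n S"
    proof (intro image_subsetI)
      fix p :: "real \<times> real" assume "p \<in> ball (0, 0) r"
      then have p: "dist p (0, 0) < r" by (simp add: dist_commute)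
      show "\<sigma> p \<in> cyclic_config n S"
      proof -
        have "\<sigma> p \<in> configs n" using in_S[OF p] by (auto simp: \<sigma>_def PiE_iff extensional_def)
        moreover have "\<sigma> p j \<noteq> \<sigma> p (nxt n j)" if "j < n" for j
          using r[OF p that] that n by (simp add: \<sigma>_def eq_commute)
        ultimately show ?thesis by (simp add: cyclic_config_def)
      qed
    qed
    show "smooth_on (ball (0, 0) r) (\<lambda>z. \<sigma> z j)" if "j < n" for j
    proof -
      have "smooth_on (ball (0, 0) r) (\<lambda>z. Y j z + \<tau> j (Y j z) *\<^sub>R \<nu> j)"
      proof (rule boundary_chart.smooth_on_graph_line[OF charts[OF that] open_ball])
        show "Y j p \<in> W j" if "p \<in> ball (0, 0) r" for p
          using r[of p j] that \<open>j < n\<close> by (simp add: dist_commute)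
        show "smooth_on (ball (0, 0) r) (Y j)"
          unfolding smooth_on_def Y_def
          by (intro allI C_k_on_add[OF open_ball] C_k_on_const[OF open_ball] C_k_on_bounded_linear[OF open_ball]
              bounded_linear_scaleR_const bounded_linear_fst bounded_linear_snd)
      qed
      then show ?thesis using that by (simp add: \<sigma>_def pt_def)
    qed
    show "\<sigma> (0, 0) = q" using q_in(5) by (auto simp: \<sigma>_def Y0 pt0 fun_eq_iff)
    have dir: "((\<lambda>s. pt j (q j + s *\<^sub>R u)) has_vector_derivative u) (at 0)" if j: "j < n" and u: "\<nu> j \<bullet> u = 0" for j u
    proof -
      interpret boundary_chart S U "q j" "\<nu> j" "W j" "\<tau> j" by (rule charts[OF j])
      have l: "((\<lambda>s. q j + s *\<^sub>R u) has_vector_derivative u) (at 0)"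
        by (auto intro!: derivative_eq_intros simp: has_vector_derivative_def)
      have "((\<lambda>s. \<tau> j (q j + s *\<^sub>R u)) has_real_derivative D1 (q j + 0 *\<^sub>R u) u) (at 0)"
        by (rule D1_along[OF l]) (simp add: center)
      then have "((\<lambda>s. \<tau> j (q j + s *\<^sub>R u) *\<^sub>R \<nu> j) has_vector_derivative 0 *\<^sub>R \<nu> j) (at 0)"
        using has_vector_derivative_scaleR[OF _ has_vector_derivative_const, of "\<lambda>s. \<tau> j (q j + s *\<^sub>R u)" 0 0 UNIV "\<nu> j"]
          deriv_center[of u] u by simp
      from has_vector_derivative_add[OF l this] show ?thesis by (simp add: pt_def)
    qed
    show "((\<lambda>s. \<sigma> (s, 0) j) has_vector_derivative v j) (at 0)" if "j < n" for j
      using dir[OF that vw(1)[OF that]] that by (simp add: \<sigma>_def Y_def)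
    show "((\<lambda>t. \<sigma> (0, t) j) has_vector_derivative w j) (at 0)" if "j < n" for j
      using dir[OF that vw(2)[OF that]] that by (simp add: \<sigma>_def Y_def)
  qed
  then show ?thesis by blast
qed

lemma length_hessian_eq:
  assumes "v \<in> config_tangent_space n S q" "w \<in> config_tangent_space n S q"
  shows "length_hessian n S q v w = hess v w"
  unfolding length_hessian_def
proof (rule the_equality)
  show "\<exists>\<sigma>. config_variation n S q v w \<sigma> \<and> hess v w = deriv (\<lambda>s. deriv (\<lambda>t. length_functional n (\<sigma> (s, t))) 0) 0"
    using variation_exists[OF assms] hessian_value by metis
qed (use hessian_value in metis)

end


section \<open>Critical configurations with two positive eigenvectors\<close>

lemma edge_form_commute: "edge_form F a b = edge_form F b a"
  by (simp add: edge_form_def inner_commute mult.commute)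

lemma edge_form_linear: "edge_form F (a *\<^sub>R x + b *\<^sub>R y) u = a * edge_form F x u + b * edge_form F y u"
  unfolding edge_form_def
  by (simp add: inner_add_left inner_add_right add_divide_distrib diff_divide_distrib algebra_simps)

lemma isCont_coordinate_fst_fst:
  "isCont (\<lambda>p. fst (fst p) j) (p :: ((nat \<Rightarrow> 'a::metric_space) \<times> 'b::metric_space) \<times> 'c::metric_space)"
  by (rule isCont_o2[OF _ isCont_coordinate]) (intro continuous_intros)

context critical_config
begin

lemma hess_commute: "hess v w = hess w v"
  unfolding hess_def
  by (intro arg_cong2[where f = "(+)"] sum.cong refl edge_form_commute arg_cong[where f = "(*) _"]
      boundary_chart.D2_commute[OF charts boundary_chart.center(1)[OF charts]]) auto

lemma hess_linear: "hess (\<lambda>j. a *\<^sub>R v j + b *\<^sub>R w j) u = a * hess v u + b * hess w u"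
proof -
  have E: "edge_form F (a *\<^sub>R v k + b *\<^sub>R w k - (a *\<^sub>R v j + b *\<^sub>R w j)) x
      = a * edge_form F (v k - v j) x + b * edge_form F (w k - w j) x" for F k j x
    unfolding edge_form_linear[symmetric] by (simp add: algebra_simps)
  have D: "DD j (a *\<^sub>R v j + b *\<^sub>R w j) x = a * DD j (v j) x + b * DD j (w j) x" if "j < n" for j x
  proof -
    note L = boundary_chart.linear_D2_left[OF charts[OF that] boundary_chart.center(1)[OF charts[OF that]], of x]
    show ?thesis unfolding linear_add[OF L] linear_scale[OF L] by simp
  qed
  have "(\<Sum>j<n. lagrange j * DD j (a *\<^sub>R v j + b *\<^sub>R w j) (u j))
      = (\<Sum>j<n. a * (lagrange j * DD j (v j) (u j)) + b * (lagrange j * DD j (w j) (u j)))"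
    by (rule sum.cong[OF refl]) (simp add: D algebra_simps)
  then show ?thesis
    unfolding hess_def E by (simp add: sum.distrib sum_distrib_left algebra_simps)
qed

text \<open>By symmetry of the Hessian, eigenvectors for different eigenvalues are orthogonal and
  the mixed terms vanish; for a common eigenvalue the combination is again an eigenvector.\<close>

lemma hess_positive:
  assumes v: "v \<in> positive_eigenvectors n S q" and w: "w \<in> positive_eigenvectors n S q"
    and indep: "\<And>a b. (\<lambda>j. a *\<^sub>R v j + b *\<^sub>R w j) = (\<lambda>j. 0) \<Longrightarrow> a = 0 \<and> b = 0"
    and ab: "a \<noteq> 0 \<or> b \<noteq> 0"
  defines "z \<equiv> \<lambda>j. a *\<^sub>R v j + b *\<^sub>R w j"
  shows "hess z z > 0"
proof -
  let ?T = "config_tangent_space n S q"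
  obtain \<mu> where \<mu>: "v \<in> ?T" "\<mu> > 0" "\<And>u. u \<in> ?T \<Longrightarrow> hess v u = \<mu> * config_inner n v u"
    using v length_hessian_eq unfolding positive_eigenvectors_def by auto
  obtain \<kappa> where \<kappa>: "w \<in> ?T" "\<kappa> > 0" "\<And>u. u \<in> ?T \<Longrightarrow> hess w u = \<kappa> * config_inner n w u"
    using w length_hessian_eq unfolding positive_eigenvectors_def by auto
  have zT: "z \<in> ?T"
    using \<mu>(1) \<kappa>(1) unfolding tangent_config by (simp add: z_def inner_add_right)
  have inner_linear: "config_inner n (\<lambda>j. a *\<^sub>R x j + b *\<^sub>R y j) u = a * config_inner n x u + b * config_inner n y u" for a b x y u
    by (simp add: config_inner_def inner_add_left sum.distrib sum_distrib_left)
  have inner_commute': "config_inner n x y = config_inner n y x" for x y :: "nat \<Rightarrow> 'a"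
    by (simp add: config_inner_def inner_commute)
  have inner_pos: "config_inner n x x > 0" if "x \<in> ?T" "x \<noteq> (\<lambda>j. 0)" for x
  proof -
    obtain j where "x j \<noteq> 0" using \<open>x \<noteq> (\<lambda>j. 0)\<close> by auto
    then have "j < n" using that(1) unfolding tangent_config by (meson not_le)
    then show ?thesis
      unfolding config_inner_def using \<open>x j \<noteq> 0\<close> by (intro sum_pos2[of _ j]) auto
  qed
  have vw: "v \<noteq> (\<lambda>j. 0)" "w \<noteq> (\<lambda>j. 0)" using indep[of 1 0] indep[of 0 1] by auto
  have "hess z z = a * hess v z + b * hess w z" by (simp add: z_def hess_linear)
  then have H: "hess z z = a * (\<mu> * config_inner n v z) + b * (\<kappa> * config_inner n w z)"
    using \<mu>(3)[OF zT] \<kappa>(3)[OF zT] by simp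
  have "\<mu> * config_inner n v w = \<kappa> * config_inner n v w"
    using \<mu>(3)[OF \<kappa>(1)] \<kappa>(3)[OF \<mu>(1)] unfolding hess_commute[of v w] inner_commute'[of w v] by linarith
  then consider "\<mu> = \<kappa>" | "config_inner n v w = 0" by auto
  then show ?thesis
  proof cases
    case 1
    have "hess z z = \<mu> * config_inner n z z"
      using H inner_linear[of a v b w z] 1 by (simp add: z_def[symmetric] algebra_simps)
    moreover have "z \<noteq> (\<lambda>j. 0)" using indep[of a b] ab unfolding z_def by blast
    ultimately show ?thesis using inner_pos[OF zT] \<mu>(2) by simp
  next
    case 2
    have "config_inner n v z = a * config_inner n v v" "config_inner n w z = b * config_inner n w w"
      using inner_linear[of a v b w v, folded z_def] inner_linear[of a v b w w, folded z_def] 2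
        inner_commute'[of v z] inner_commute'[of w z] inner_commute'[of w v] by simp_all
    then have "hess z z = a\<^sup>2 * (\<mu> * config_inner n v v) + b\<^sup>2 * (\<kappa> * config_inner n w w)"
      using H by (simp add: power2_eq_square algebra_simps)
    moreover have "\<mu> * config_inner n v v > 0" "\<kappa> * config_inner n w w > 0"
      using inner_pos \<mu> \<kappa> vw by auto
    moreover have "a\<^sup>2 > 0 \<or> b\<^sup>2 > 0" using ab by auto
    ultimately show ?thesis
      by (metis add_nonneg_pos add_pos_nonneg mult_nonneg_nonneg mult_pos_pos less_imp_le zero_le_power2)
  qed
qed

text \<open>Along a ray whose initial slope is nonnegative the length increases, since its second
  derivative is positive; of two opposite rays at least one has this property.\<close>

lemma passable_positive:
  assumes vT: "v \<in> config_tangent_space n S q" and wT: "w \<in> config_tangent_space n S q"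
    and pos: "\<And>a b. a \<noteq> 0 \<or> b \<noteq> 0 \<Longrightarrow>
      hess (\<lambda>j. a *\<^sub>R v j + b *\<^sub>R w j) (\<lambda>j. a *\<^sub>R v j + b *\<^sub>R w j) > 0"
  shows "passable (configs n) (length_functional n) (length_functional n q) q"
proof -
  define Z where "Z u j = fst u *\<^sub>R v j + snd u *\<^sub>R w j" for u :: "real \<times> real" and j
  have Z_scale: "Z (t *\<^sub>R u) j = t *\<^sub>R Z u j" and Z_neg: "Z (- u) j = - Z u j" and Z_0: "Z 0 j = 0" for t u j
    by (auto simp: Z_def algebra_simps)
  have ZT: "\<nu> j \<bullet> Z u j = 0" if "j < n" for u j
    using vT wT that unfolding tangent_config by (simp add: Z_def inner_add_right)
  \<comment> \<open>A parameter \<open>((\<zeta>, t), u)\<close> stands for the configuration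
    \<open>\<zeta>\<close> moved for time \<open>t\<close> in direction \<open>u\<close> of the
    plane of \<open>v\<close> and \<open>w\<close>, and projected to \<open>S\<close> by
    \<open>pt\<close>. \<open>dy\<close> and \<open>ddy\<close> are the first two
    \<open>t\<close>-derivatives of its points, \<open>F\<close> its edges, and \<open>G1\<close>
    and \<open>G2\<close> the first two \<open>t\<close>-derivatives of its length.\<close>
  define Y where "Y p j = fst (fst p) j + snd (fst p) *\<^sub>R Z (snd p) j" for p :: "((nat \<Rightarrow> 'a) \<times> real) \<times> (real \<times> real)" and j
  define dy where "dy p j = Z (snd p) j + boundary_chart.D1 (\<tau> j) (Y p j) (Z (snd p) j) *\<^sub>R \<nu> j" for p j
  define ddy where "ddy p j = boundary_chart.D2 (\<tau> j) (Y p j) (Z (snd p) j) (Z (snd p) j) *\<^sub>R \<nu> j" for p j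
  define F where "F p j = pt (nxt n j) (Y p (nxt n j)) - pt j (Y p j)" for p j
  define G1 where "G1 p = (\<Sum>j<n. sgn (F p j) \<bullet> (dy p (nxt n j) - dy p j))" for p
  define G2 where "G2 p = (\<Sum>j<n. edge_form (F p j) (dy p (nxt n j) - dy p j) (dy p (nxt n j) - dy p j)
      + sgn (F p j) \<bullet> (ddy p (nxt n j) - ddy p j))" for p
  define good where "good p \<longleftrightarrow> (\<forall>j\<in>{..<n}. Y p j \<in> W j \<and> F p j \<noteq> 0) \<and> G2 p > 0" for p
  have nx: "nxt n j < n" for j using n by simp
  have contZ: "isCont (\<lambda>p. Z (snd p) j) p" for p :: "((nat \<Rightarrow> 'a) \<times> real) \<times> (real \<times> real)" and j
    unfolding Z_def by (intro continuous_intros)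
  have contY: "isCont (\<lambda>p. Y p j) p" for p j
    unfolding Y_def by (intro continuous_intros isCont_coordinate_fst_fst contZ)
  have pt0: "pt j x = x" if "j < n" "x \<in> S" "x \<in> W j" for j x
    using boundary_chart.in_S_iff[OF charts[OF that(1)] that(3)] that(2) by (simp add: pt_def)
  have qW: "q j \<in> W j" if "j < n" for j using boundary_chart.center(1)[OF charts[OF that]] .
  have contpt: "isCont (\<lambda>p. pt j (Y p j)) p" if "j < n" "Y p j \<in> W j" for p j
    unfolding pt_def by (intro continuous_intros contY boundary_chart.isCont_\<tau>[OF charts[OF that(1)] contY that(2)])
  define K1 where "K1 = sphere (0 :: real \<times> real) 1"
  have near: "\<forall>\<^sub>F p in nhds ((q, 0), u). good p" if u: "u \<in> K1" for u
  proof -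
    let ?p = "((q, 0::real), u)"
    have Yp: "Y ?p j = q j" for j by (simp add: Y_def)
    have YW: "Y ?p j \<in> W j" if "j < n" for j using qW[OF that] Yp by simp
    have Fp: "F ?p j = q (nxt n j) - q j" if "j < n" for j
      using pt0[OF that q_in(3)[OF that] qW[OF that]] pt0[OF nx q_in(3)[OF nx] qW[OF nx]] by (simp add: F_def Yp)
    have contF: "isCont (\<lambda>p. F p j) ?p" if "j < n" for j
      unfolding F_def by (intro continuous_intros contpt nx that YW)
    have contdy: "isCont (\<lambda>p. dy p j) ?p" if "j < n" for j
      unfolding dy_def by (intro continuous_intros contZ boundary_chart.isCont_D1[OF charts[OF that] contY contZ YW[OF that]])
    have contddy: "isCont (\<lambda>p. ddy p j) ?p" if "j < n" for j
      unfolding ddy_def by (intro continuous_intros boundary_chart.isCont_D2[OF charts[OF that] contY contZ contZ YW[OF that]])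
    have F0: "F ?p j \<noteq> 0" if "j < n" for j using Fp[OF that] q_in(4)[OF that] by simp
    have "isCont G2 ?p"
      unfolding G2_def edge_form_def
      by (intro continuous_intros isCont_sgn contF contdy contddy nx F0) (use F0 in auto)
    moreover have "G2 ?p > 0"
    proof -
      have dyp: "dy ?p j = Z u j" if "j < n" for j
        using boundary_chart.deriv_center[OF charts[OF that]] ZT[OF that, of u] by (simp add: dy_def Yp)
      have "G2 ?p = (\<Sum>j<n. edge_form (q (nxt n j) - q j) (Z u (nxt n j) - Z u j) (Z u (nxt n j) - Z u j))
          + (\<Sum>j<n. e j \<bullet> (ddy ?p (nxt n j) - ddy ?p j))"
        unfolding G2_def sum.distrib[symmetric] by (rule sum.cong) (simp_all add: Fp dyp nx)
      also have "(\<Sum>j<n. e j \<bullet> (ddy ?p (nxt n j) - ddy ?p j)) = (\<Sum>j<n. lagrange j * DD j (Z u j) (Z u j))"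
        unfolding first_order by (rule sum.cong) (simp_all add: ddy_def Yp unit_normal)
      finally have "G2 ?p = hess (Z u) (Z u)" by (simp add: hess_def)
      moreover have "u \<noteq> 0" using u by (auto simp: K1_def)
      then have "fst u \<noteq> 0 \<or> snd u \<noteq> 0" by (simp add: prod_eq_iff)
      ultimately show ?thesis using pos[of "fst u" "snd u"] unfolding Z_def[abs_def] by simp
    qed
    ultimately have "\<forall>\<^sub>F p in nhds ?p. G2 p > 0" by (rule isCont_eventually_gt(1))
    moreover have "\<forall>\<^sub>F p in nhds ?p. \<forall>j\<in>{..<n}. Y p j \<in> W j \<and> F p j \<noteq> 0"
    proof (rule eventually_ball_finite[OF finite_lessThan], rule ballI, rule eventually_conj)
      fix j assume "j \<in> {..<n}"
      then have j: "j < n" by simp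
      show "\<forall>\<^sub>F p in nhds ?p. Y p j \<in> W j"
        by (rule isCont_eventually_in_open[OF contY boundary_chart.open_W[OF charts[OF j]] YW[OF j]])
      have "\<forall>\<^sub>F p in nhds ?p. F p j \<in> - {0}"
        by (rule isCont_eventually_in_open[OF contF[OF j]]) (use F0[OF j] in auto)
      then show "\<forall>\<^sub>F p in nhds ?p. F p j \<noteq> 0" by simp
    qed
    ultimately show ?thesis unfolding good_def by (simp add: eventually_conj)
  qed
  have "((q, 0), u) \<in> interior {p. good p}" if u: "u \<in> K1" for u
  proof -
    obtain A where "open A" "((q, 0), u) \<in> A" "\<forall>p\<in>A. good p"
      using near[OF u] unfolding eventually_nhds by blast
    then show ?thesis by (intro interiorI[of A]) auto
  qed
  then have sub: "{(q, 0)} \<times> K1 \<subseteq> interior {p. good p}" by blast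
  have "compact K1" by (simp add: K1_def)
  \<comment> \<open>Positivity of \<open>G2\<close> holds over \<open>(q, 0)\<close> for all
    directions in the compact circle \<open>K1\<close>; the tube lemma provides one neighbourhood
    \<open>G0\<close> and one time \<open>\<delta>\<close> for all of them.\<close>
  obtain X0 where X0: "(q, 0) \<in> X0" "open X0" "X0 \<times> K1 \<subseteq> interior {p. good p}"
    using Elementary_Topology.tube_lemma[OF \<open>compact K1\<close> open_interior sub] by blast
  obtain G0 T where GT: "open G0" "open T" "(q, 0) \<in> G0 \<times> T" "G0 \<times> T \<subseteq> X0"
    by (rule open_prod_elim[OF X0(2,1)]) (rule that)
  then obtain \<delta> where "\<delta> > 0" and \<delta>: "\<And>t. dist t 0 < \<delta> \<Longrightarrow> t \<in> T"
    by (auto simp: open_dist)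
  have good: "good ((\<zeta>, t), u)" if "\<zeta> \<in> G0" "\<bar>t\<bar> < \<delta>" "u \<in> K1" for \<zeta> t u
  proof -
    have "((\<zeta>, t), u) \<in> X0 \<times> K1" using that GT(4) \<delta>[of t] by auto
    then show ?thesis using X0(3) interior_subset by blast
  qed
  have goodD: "Y ((\<zeta>, t), u) j \<in> W j" "F ((\<zeta>, t), u) j \<noteq> 0" "G2 ((\<zeta>, t), u) > 0"
    if "\<zeta> \<in> G0" "\<bar>t\<bar> < \<delta>" "u \<in> K1" "j < n" for \<zeta> t u j
    using good[OF that(1-3)] that(4) unfolding good_def by auto
  define y where "y \<zeta> u t = (\<lambda>j. pt j (Y ((\<zeta>, t), u) j))" for \<zeta> u t
  have n0: "0 < n" using n by simp
  have Dy: "((\<lambda>t. y \<zeta> u t j) has_vector_derivative dy ((\<zeta>, t), u) j) (at t)"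
    and Ddy: "((\<lambda>t. dy ((\<zeta>, t), u) j) has_vector_derivative ddy ((\<zeta>, t), u) j) (at t)"
    if p: "\<zeta> \<in> G0" "\<bar>t\<bar> < \<delta>" "u \<in> K1" and j: "j < n" for \<zeta> t u j
  proof -
    have l: "((\<lambda>t. Y ((\<zeta>, t), u) j) has_vector_derivative Z u j) (at t)"
      unfolding Y_def by (auto intro!: derivative_eq_intros simp: has_vector_derivative_def)
    note c = charts[OF j]
    have W: "Y ((\<zeta>, t), u) j \<in> W j" by (rule goodD(1)[OF p j])
    have "((\<lambda>t. \<tau> j (Y ((\<zeta>, t), u) j) *\<^sub>R \<nu> j) has_vector_derivative
        boundary_chart.D1 (\<tau> j) (Y ((\<zeta>, t), u) j) (Z u j) *\<^sub>R \<nu> j) (at t)"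
      using has_vector_derivative_scaleR[OF boundary_chart.D1_along[OF c l W] has_vector_derivative_const, of "\<nu> j"] by simp
    from has_vector_derivative_add[OF l this]
    show "((\<lambda>t. y \<zeta> u t j) has_vector_derivative dy ((\<zeta>, t), u) j) (at t)"
      by (simp add: y_def pt_def dy_def)
    have "((\<lambda>t. boundary_chart.D1 (\<tau> j) (Y ((\<zeta>, t), u) j) (Z u j)) has_real_derivative
        boundary_chart.D1 (\<tau> j) (Y ((\<zeta>, t), u) j) 0 + boundary_chart.D2 (\<tau> j) (Y ((\<zeta>, t), u) j) (Z u j) (Z u j)) (at t)"
      by (rule boundary_chart.D2_along[OF c l W has_vector_derivative_const])
    then have "((\<lambda>t. boundary_chart.D1 (\<tau> j) (Y ((\<zeta>, t), u) j) (Z u j)) has_real_derivative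
        boundary_chart.D2 (\<tau> j) (Y ((\<zeta>, t), u) j) (Z u j) (Z u j)) (at t)"
      using linear_0[OF boundary_chart.linear_D1[OF c W]] by simp
    from has_vector_derivative_scaleR[OF this has_vector_derivative_const, of "\<nu> j"]
    have "((\<lambda>t. boundary_chart.D1 (\<tau> j) (Y ((\<zeta>, t), u) j) (Z u j) *\<^sub>R \<nu> j) has_vector_derivative ddy ((\<zeta>, t), u) j) (at t)"
      by (simp add: ddy_def)
    from has_vector_derivative_add[OF has_vector_derivative_const this, of "Z u j"]
    show "((\<lambda>t. dy ((\<zeta>, t), u) j) has_vector_derivative ddy ((\<zeta>, t), u) j) (at t)"
      by (simp add: dy_def)
  qed
  have y_ne: "y \<zeta> u t (nxt n j) \<noteq> y \<zeta> u t j"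
    if "\<zeta> \<in> G0" "\<bar>t\<bar> < \<delta>" "u \<in> K1" "j < n" for \<zeta> t u j
    using goodD(2)[OF that] by (simp add: F_def y_def)
  have growth: "length_functional n (y \<zeta> u t) > length_functional n (y \<zeta> u 0)"
    if p: "\<zeta> \<in> G0" "u \<in> K1" and t: "0 < t" "t < \<delta>" and slope: "G1 ((\<zeta>, 0), u) \<ge> 0" for \<zeta> u t
  proof (rule convex_growth[where g = "\<lambda>t. length_functional n (y \<zeta> u t)" and ?g1.0 = "\<lambda>t. G1 ((\<zeta>, t), u)" and ?g2.0 = "\<lambda>t. G2 ((\<zeta>, t), u)", OF t(1) _ _ _ slope])
    fix s assume "0 \<le> s" "s \<le> t"
    then have s: "\<bar>s\<bar> < \<delta>" using t by auto
    note ps = p(1) s p(2)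
    show "((\<lambda>t. length_functional n (y \<zeta> u t)) has_real_derivative G1 ((\<zeta>, s), u)) (at s)"
      using length_first_derivative[of n "y \<zeta> u" "dy ((\<zeta>, s), u)" s, OF Dy[OF ps] y_ne[OF ps]]
      by (simp add: G1_def F_def y_def)
    show "((\<lambda>t. G1 ((\<zeta>, t), u)) has_real_derivative G2 ((\<zeta>, s), u)) (at s)"
      using length_second_derivative[of n "y \<zeta> u" "dy ((\<zeta>, s), u)" s "\<lambda>t. dy ((\<zeta>, t), u)" "ddy ((\<zeta>, s), u)",
          OF Dy[OF ps] Ddy[OF ps] y_ne[OF ps]]
      by (simp add: G1_def G2_def F_def y_def)
    show "G2 ((\<zeta>, s), u) > 0" by (rule goodD(3)[OF ps n0])
  qed
  \<comment> \<open>At time 0 the edges do not depend on \<open>u\<close> and the velocities are odd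
    in \<open>u\<close>, so one of two opposite directions has nonnegative slope.\<close>
  have neg_slope: "G1 ((\<zeta>, 0), - u) = - G1 ((\<zeta>, 0), u)" if "\<zeta> \<in> G0" "u \<in> K1" for \<zeta> u
  proof -
    have dyn: "dy ((\<zeta>, 0), - u) j = - dy ((\<zeta>, 0), u) j" if "j < n" for j
      using linear_neg[OF boundary_chart.linear_D1[OF charts[OF that] goodD(1)[OF \<open>\<zeta> \<in> G0\<close> _ \<open>u \<in> K1\<close> that, of 0]]] \<open>\<delta> > 0\<close>
      by (simp add: dy_def Y_def Z_neg)
    have "F ((\<zeta>, 0), - u) j = F ((\<zeta>, 0), u) j" for j by (simp add: F_def Y_def)
    then have "G1 ((\<zeta>, 0), - u) = (\<Sum>j<n. - (sgn (F ((\<zeta>, 0), u) j) \<bullet> (dy ((\<zeta>, 0), u) (nxt n j) - dy ((\<zeta>, 0), u) j)))"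
      unfolding G1_def by (intro sum.cong) (simp_all add: dyn nx inner_diff_right)
    then show ?thesis by (simp add: G1_def sum_negf)
  qed
  define \<epsilon> where "\<epsilon> = \<delta> / 2"
  have \<epsilon>: "\<epsilon> > 0" "\<epsilon> < \<delta>" using \<open>\<delta> > 0\<close> by (auto simp: \<epsilon>_def)
  define K where "K = sphere (0 :: real \<times> real) \<epsilon>"
  define V where "V = ball (0 :: real \<times> real) \<delta>"
  define M where "M = (\<lambda>(\<zeta>, x). \<lambda>j. if j < n then pt j (\<zeta> j + Z x j) else undefined)"
  have polar: "\<exists>u\<in>K1. x = norm x *\<^sub>R u" for x :: "real \<times> real"
  proof (cases "x = 0")
    case True
    have "(1, 0) \<in> K1" by (simp add: K1_def norm_Pair)
    then show ?thesis by (rule bexI[rotated]) (use True in \<open>simp add: zero_prod_def\<close>)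
  next
    case False
    then show ?thesis by (intro bexI[of _ "sgn x"]) (auto simp: K1_def norm_sgn sgn_div_norm)
  qed
  have MW: "\<zeta> j + Z x j \<in> W j" if "\<zeta> \<in> G0" "x \<in> V" "j < n" for \<zeta> x j
  proof -
    obtain u where u: "u \<in> K1" "x = norm x *\<^sub>R u" using polar by blast
    have "Y ((\<zeta>, norm x), u) j \<in> W j" by (rule goodD(1)) (use that u in \<open>auto simp: V_def\<close>)
    then show ?thesis using Z_scale[of "norm x" u j] u(2) by (simp add: Y_def)
  qed
  have M_y: "length_functional n (M (\<zeta>, t *\<^sub>R u)) = length_functional n (y \<zeta> u t)" for \<zeta> t u
    unfolding length_functional_def by (rule sum.cong) (auto simp: M_def y_def Y_def Z_scale nx)
  have zeta_pt: "\<zeta> j = pt j (\<zeta> j)" if "\<zeta> \<in> configs n" "\<zeta> \<in> G0" "j < n" for \<zeta> j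
  proof -
    have "0 \<in> V" using \<open>\<delta> > 0\<close> by (simp add: V_def)
    then show ?thesis
      using pt0[OF that(3) PiE_mem[OF that(1)]] MW[OF that(2) _ that(3), of 0] that(3) by (simp add: Z_0)
  qed
  have gain: "length_functional n (M (\<zeta>, t *\<^sub>R u)) > length_functional n \<zeta>"
    if "\<zeta> \<in> configs n" "\<zeta> \<in> G0" "u \<in> K1" "0 < t" "t < \<delta>" "G1 ((\<zeta>, 0), u) \<ge> 0" for \<zeta> t u
  proof -
    have "length_functional n (y \<zeta> u 0) = length_functional n \<zeta>"
      unfolding length_functional_def y_def Y_def
      by (rule sum.cong) (auto simp: nx zeta_pt[OF that(1,2), symmetric])
    then show ?thesis using growth[OF that(2,3,4,5,6)] M_y by simp
  qed
  have q0: "q \<in> G0" using GT by auto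
  show ?thesis
  proof (rule passable_of_mover[where K = K and V = V and ?G0.0 = G0 and M = M])
    show "path_connected K" unfolding K_def by (rule path_connected_sphere) simp
    show "K \<noteq> {}" unfolding K_def using \<epsilon> by simp
    show "t *\<^sub>R u \<in> V" if "u \<in> K" "0 \<le> t" "t \<le> 1" for t u
    proof -
      have "norm (t *\<^sub>R u) = t * \<epsilon>" using that by (simp add: K_def)
      moreover have "t * \<epsilon> \<le> 1 * \<epsilon>" using that \<epsilon> by (intro mult_right_mono) auto
      ultimately have "norm (t *\<^sub>R u) < \<delta>" using \<epsilon> by linarith
      then show ?thesis by (simp add: V_def)
    qed
    show "continuous_on ((configs n \<inter> G0) \<times> V) M"
    proof (rule continuous_on_coordinatewise_then_product)
      fix j
      show "continuous_on ((configs n \<inter> G0) \<times> V) (\<lambda>p. M p j)"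
      proof (cases "j < n")
        case True
        have c: "isCont (\<lambda>p. fst p j + Z (snd p) j) p" for p :: "(nat \<Rightarrow> 'a) \<times> (real \<times> real)"
        proof -
          have "isCont (\<lambda>p. fst p j) p"
            by (rule isCont_o2[OF _ isCont_coordinate]) (intro continuous_intros)
          then show ?thesis unfolding Z_def by (intro continuous_intros)
        qed
        have "continuous_on ((configs n \<inter> G0) \<times> V) (\<lambda>p. pt j (fst p j + Z (snd p) j))"
          unfolding pt_def
          by (intro continuous_at_imp_continuous_on ballI continuous_intros c boundary_chart.isCont_\<tau>[OF charts[OF True] c])
             (use MW[OF _ _ True] in auto)
        then show ?thesis using True by (simp add: M_def case_prod_unfold)
      qed (simp add: M_def case_prod_unfold)
    qed
    show "M (\<zeta>, x) \<in> configs n" if "\<zeta> \<in> configs n" "\<zeta> \<in> G0" "x \<in> V" for \<zeta> x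
      using boundary_chart.graph_in[OF charts MW[OF that(2,3)]] by (simp add: M_def pt_def PiE_iff extensional_def)
    show "M (\<zeta>, 0) = \<zeta>" if \<zeta>: "\<zeta> \<in> configs n" "\<zeta> \<in> G0" for \<zeta>
      using zeta_pt[OF \<zeta>] PiE_arb[OF \<zeta>(1)] by (auto simp: M_def Z_0 fun_eq_iff)
    show "length_functional n (M (q, x)) > length_functional n q" if "x \<in> K" for x
    proof -
      obtain u where u: "u \<in> K1" "x = norm x *\<^sub>R u" using polar by blast
      \<comment> \<open>At \<open>q\<close> the moves are tangent, so by criticality the slope is 0
        in every direction, and the length grows all around the circle.\<close>
      have "G1 ((q, 0), u) = (\<Sum>j<n. e j \<bullet> (Z u (nxt n j) - Z u j))"
      proof -
        have "F ((q, 0), u) j = q (nxt n j) - q j" if "j < n" for j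
          using zeta_pt[OF q_in(2) q0] that nx by (simp add: F_def Y_def)
        moreover have "dy ((q, 0), u) j = Z u j" if "j < n" for j
          using boundary_chart.deriv_center[OF charts[OF that]] ZT[OF that, of u] by (simp add: dy_def Y_def)
        ultimately show ?thesis unfolding G1_def by (intro sum.cong) (simp_all add: nx)
      qed
      also have "\<dots> = 0" unfolding first_order by (intro sum.neutral) (simp add: ZT)
      finally have "G1 ((q, 0), u) \<ge> 0" by simp
      moreover have "norm x = \<epsilon>" using that by (simp add: K_def)
      ultimately show ?thesis using gain[OF q_in(2) q0 u(1), of \<epsilon>] \<epsilon> u(2) by simp
    qed
    show "\<exists>x\<in>K. \<forall>t. 0 < t \<longrightarrow> t \<le> 1 \<longrightarrow> length_functional n (M (\<zeta>, t *\<^sub>R x)) > length_functional n \<zeta>"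
      if \<zeta>: "\<zeta> \<in> configs n" "\<zeta> \<in> G0" for \<zeta>
    proof -
      define u0 where "u0 = (1::real, 0::real)"
      have u0: "u0 \<in> K1" "- u0 \<in> K1" by (auto simp: K1_def u0_def norm_Pair)
      then obtain u where u: "u \<in> K1" "G1 ((\<zeta>, 0), u) \<ge> 0"
        using neg_slope[OF \<zeta>(2) u0(1)] by (metis linear neg_0_le_iff_le)
      have "length_functional n (M (\<zeta>, t *\<^sub>R (\<epsilon> *\<^sub>R u))) > length_functional n \<zeta>" if t: "0 < t" "t \<le> 1" for t
      proof -
        have "t * \<epsilon> \<le> 1 * \<epsilon>" using t \<epsilon> by (intro mult_right_mono) auto
        then have "t * \<epsilon> < \<delta>" using \<epsilon> by linarith
        then show ?thesis using gain[OF \<zeta> u(1), of "t * \<epsilon>"] u(2) t \<epsilon> by simp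
      qed
      moreover have "\<epsilon> *\<^sub>R u \<in> K" using u(1) \<epsilon> by (simp add: K_def K1_def)
      ultimately show ?thesis by blast
    qed
  qed (use GT q0 q_in(2) in \<open>auto simp: weakly_lpc_configs continuous_on_length K_def\<close>)
qed

end


context critical_config
begin

text \<open>The coindex is the dimension of a span of eigenvectors with possibly different
  eigenvalues; a basis chosen among these eigenvectors contains two independent ones.\<close>

lemma passable_of_coindex:
  assumes "morse_coindex n S q \<ge> 2"
  shows "passable (configs n) (length_functional n) (length_functional n q) q"
proof -
  interpret cs: vector_space "config_scale :: real \<Rightarrow> (nat \<Rightarrow> 'a) \<Rightarrow> _" by (rule vector_space_config)
  let ?P = "positive_eigenvectors n S q"
  have "cs.dim ?P \<ge> 2" using assms unfolding morse_coindex_def cs.dim_span .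
  then obtain B where B: "B \<subseteq> ?P" "cs.independent B" "card B \<ge> 2"
    using cs.basis_exists[of ?P] by metis
  obtain A where "A \<subseteq> B" "card A = 2" using obtain_subset_with_card_n[OF B(3)] by metis
  then obtain v w where vw: "A = {v, w}" "v \<noteq> w" by (auto simp: card_2_iff)
  have indep: "a = 0 \<and> b = 0" if "(\<lambda>j. a *\<^sub>R v j + b *\<^sub>R w j) = (\<lambda>j. 0)" for a b
  proof -
    define f where "f x = (if x = v then a else b)" for x
    have "cs.independent {v, w}" using cs.independent_mono[OF B(2) \<open>A \<subseteq> B\<close>] vw by simp
    moreover have "(\<Sum>x\<in>{v, w}. config_scale (f x) x) = 0"
      using vw(2) that by (simp add: f_def config_scale_def plus_fun_def zero_fun_def)
    ultimately have "f v = 0" "f w = 0"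
      using cs.independentD[of "{v, w}" "{v, w}" f] by auto
    then show ?thesis using vw(2) by (simp add: f_def)
  qed
  have "v \<in> ?P" "w \<in> ?P" using B(1) \<open>A \<subseteq> B\<close> vw by auto
  then show ?thesis
    by (intro passable_positive[of v w] hess_positive indep) (auto simp: positive_eigenvectors_def)
qed

end

text \<open>Sum and difference of vectors of equal length are orthogonal, so the sum is orthogonal
  to \<open>\<nu>\<close> once the difference is a nonzero multiple of it.\<close>

lemma reflection_law_of_balance:
  assumes "\<nu> \<bullet> \<nu> = 1" "a \<bullet> a = b \<bullet> b" and l: "a - b = l *\<^sub>R \<nu>" and "l \<noteq> 0"
  shows "reflection_law \<nu> a b"
proof -
  have "(a - b) \<bullet> (a + b) = 0"
    using assms(2) by (simp add: inner_add_right inner_diff_left inner_commute[of b a])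
  then have "\<nu> \<bullet> (a + b) = 0" unfolding l using \<open>l \<noteq> 0\<close> by simp
  then have s: "b \<bullet> \<nu> = - (a \<bullet> \<nu>)" by (simp add: inner_add_right inner_commute)
  have "(a - b) \<bullet> \<nu> = l" unfolding l using assms(1) by simp
  then have "l = 2 * (a \<bullet> \<nu>)" using s by (simp add: inner_diff_left)
  then have "b = a - (2 * (a \<bullet> \<nu>)) *\<^sub>R \<nu>" using l by (simp add: algebra_simps)
  then have "b - (- (a \<bullet> \<nu>)) *\<^sub>R \<nu> = a - (a \<bullet> \<nu>) *\<^sub>R \<nu>" by (simp add: algebra_simps flip: scaleR_add_left)
  then show ?thesis unfolding reflection_law_def s by simp
qed

subsection \<open>Critical configurations as billiard trajectories\<close>

context critical_config
begin

text \<open>Chords are transversal to \<open>S\<close>, so the direction of arrival points outwards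
  and that of departure inwards. Hence the two differ and the multiplier is not 0.\<close>

lemma reflection:
  assumes "j < n"
  shows "reflection_law (\<nu> j) (e (prv n j)) (e j)"
proof -
  note N = nxt_prv[OF n assms]
  have unit: "norm (e i) = 1" if "i < n" for i using q_in(4)[OF that] by (simp add: norm_sgn)
  have ej: "e j = e (prv n j) - lagrange j *\<^sub>R \<nu> j" using balance[OF assms] by (simp add: algebra_simps)
  have "\<nu> j \<bullet> (q (prv n j) - q j) < 0" "\<nu> j \<bullet> (q (nxt n j) - q j) < 0"
    using chord_normal[OF q_in(3)[OF assms]] q_in(3)[OF N(2)] q_in(3)[OF N(1)] q_in(4)[OF N(2)] q_in(4)[OF assms] S_subset_U N(3)
    by auto
  then have "\<nu> j \<bullet> e (prv n j) > 0" "\<nu> j \<bullet> e j < 0"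
    using N(3) q_in(4)[OF N(2)] q_in(4)[OF assms]
    by (auto simp: sgn_div_norm inner_diff_right mult_less_0_iff zero_less_mult_iff)
  then have "lagrange j \<noteq> 0" using ej by auto
  moreover have "e (prv n j) \<bullet> e (prv n j) = e j \<bullet> e j"
    using unit[OF assms] unit[OF N(2)] by (simp add: norm_eq_1)
  ultimately show ?thesis
    using reflection_law_of_balance[OF unit_normal(2)[OF assms] _ balance[OF assms]] by blast
qed

definition len :: "nat \<Rightarrow> real" where "len j = norm (q (nxt n j) - q j)"
definition tm :: "nat \<Rightarrow> real" where "tm j = (\<Sum>i<j. len i)"
text \<open>Bounces are numbered by all integers: \<open>idx k\<close> is the index of the point hit
  by bounce \<open>k\<close>, and \<open>time k\<close> its moment at unit speed. Integer division
  rounds down, so negative times follow the same formula and a period is a shift by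
  \<open>n\<close>.\<close>

definition idx :: "int \<Rightarrow> nat" where "idx k = nat (k mod int n)"
definition time :: "int \<Rightarrow> real" where "time k = of_int (k div int n) * tm n + tm (idx k)"
definition curve :: "real \<Rightarrow> 'a" where
  "curve s = (let k = (THE k. time k \<le> s \<and> s < time (k + 1)) in q (idx k) + (s - time k) *\<^sub>R e (idx k))"

lemma n_pos: "int n > 0" "n > 0" using n by auto

lemma idx_less: "idx k < n"
  using n_pos by (simp add: idx_def nat_less_iff)

lemma len_pos: "j < n \<Longrightarrow> len j > 0"
  using q_in(4) by (simp add: len_def)

lemma edge: "j < n \<Longrightarrow> q (nxt n j) = q j + len j *\<^sub>R e j"
  using q_in(4) by (simp add: len_def sgn_div_norm)

lemma idx_Suc: "idx (k + 1) = nxt n (idx k)"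
proof -
  have "int (nxt n (idx k)) = (k + 1) mod int n"
    using n_pos by (simp add: idx_def zmod_int mod_simps add.commute)
  then show ?thesis by (simp add: idx_def)
qed

lemma time_Suc: "time (k + 1) = time k + len (idx k)"
proof (cases "Suc (idx k) = n")
  case True
  have "k mod int n \<ge> 0" using n_pos by simp
  then have "k mod int n = int n - 1" using True unfolding idx_def by linarith
  then have "k + 1 = int n * (k div int n + 1) + 0" using mult_div_mod_eq[of "int n" k] by (simp add: distrib_left)
  from int_div_pos_eq[OF this] int_mod_pos_eq[OF this]
  have "(k + 1) div int n = k div int n + 1" "idx (k + 1) = 0" using n_pos by (simp_all add: idx_def)
  moreover have "tm (Suc (idx k)) = tm (idx k) + len (idx k)" by (simp add: tm_def)
  then have "tm n = tm (idx k) + len (idx k)" unfolding True .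
  ultimately show ?thesis by (simp add: time_def algebra_simps) (simp add: tm_def)
next
  case False
  then have "Suc (idx k) < n" using idx_less[of k] by simp
  then have m: "k mod int n + 1 < int n" "0 \<le> k mod int n" using n_pos by (auto simp: idx_def)
  have "k + 1 = int n * (k div int n) + (k mod int n + 1)" by simp
  from int_div_pos_eq[OF this _ m(1)] have "(k + 1) div int n = k div int n" using m(2) by simp
  moreover have "idx (k + 1) = Suc (idx k)" using idx_Suc[of k] \<open>Suc (idx k) < n\<close> by simp
  ultimately show ?thesis by (simp add: time_def tm_def)
qed

lemma time_shift: "time (k + int n) = time k + tm n" "idx (k + int n) = idx k"
  using n_pos by (simp_all add: time_def idx_def algebra_simps)

lemma time_less: "i < j \<Longrightarrow> time i < time j"
proof -
  assume "i < j"
  have "time i < time (i + int (Suc m))" for m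
  proof (induction m)
    case 0
    then show ?case using time_Suc[of i] len_pos[OF idx_less] by simp
  next
    case (Suc m)
    have eq: "i + int (Suc (Suc m)) = i + int (Suc m) + 1" by simp
    show ?case
      using Suc time_Suc[of "i + int (Suc m)"] len_pos[OF idx_less, of "i + int (Suc m)"] unfolding eq by linarith
  qed
  moreover have "j = i + int (Suc (nat (j - i - 1)))" using \<open>i < j\<close> by simp
  ultimately show ?thesis by metis
qed

lemma time_less_iff: "time i < time j \<longleftrightarrow> i < j"
  using time_less[of i j] time_less[of j i] by (cases i j rule: linorder_cases) auto

lemma time_le_iff: "time i \<le> time j \<longleftrightarrow> i \<le> j"
  using time_less_iff[of j i] by (simp add: not_less[symmetric])

lemma time_nat: "j < n \<Longrightarrow> time (int j) = tm j" "j < n \<Longrightarrow> idx (int j) = j" and time_n: "time (int n) = tm n"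
  and time_0: "time 0 = 0"
  using n_pos by (auto simp: time_def idx_def tm_def)

lemma tm_n_pos: "tm n > 0"
  using time_less[of 0 "int n"] n_pos time_n time_0 by simp

lemma piece_exists: "\<exists>k. time k \<le> s \<and> s < time (k + 1)"
proof -
  define m where "m = \<lfloor>s / tm n\<rfloor>"
  have mult_n: "time (i * int n) = of_int i * tm n" for i
    using n_pos by (simp add: time_def idx_def tm_def)
  have "of_int m \<le> s / tm n" "s / tm n < of_int (m + 1)" unfolding m_def by linarith+
  then have s: "time (m * int n) \<le> s" "s < time ((m + 1) * int n)"
    unfolding mult_n using tm_n_pos by (simp_all only: pos_le_divide_eq pos_divide_less_eq)
  \<comment> \<open>The period number \<open>m\<close> confines the search for the last bounce not
    after \<open>s\<close> to a finite set of indices.\<close>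
  define A where "A = {k \<in> {m * int n..(m + 1) * int n}. time k \<le> s}"
  have "finite A" by (rule finite_subset[of A "{m * int n..(m + 1) * int n}"]) (auto simp: A_def)
  have "m * int n \<in> A" using s n_pos by (auto simp: A_def)
  define k where "k = Max A"
  have "k \<in> A" unfolding k_def using \<open>finite A\<close> \<open>m * int n \<in> A\<close> by (intro Max_in) auto
  have "\<not> time (k + 1) \<le> s"
  proof
    assume le: "time (k + 1) \<le> s"
    have "k \<le> (m + 1) * int n" "time k \<le> s" using \<open>k \<in> A\<close> by (auto simp: A_def)
    moreover have "k \<noteq> (m + 1) * int n" using \<open>time k \<le> s\<close> s(2) by fastforce
    ultimately have "k < (m + 1) * int n" by simp
    then have "k + 1 \<in> A" using le \<open>k \<in> A\<close> by (auto simp: A_def)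
    then have "k + 1 \<le> k" unfolding k_def using \<open>finite A\<close> by (intro Max_ge)
    then show False by simp
  qed
  then show ?thesis using \<open>k \<in> A\<close> by (auto simp: A_def)
qed

text \<open>The formula includes the right end, where the definition of \<open>curve\<close> already
  uses the next edge; so at a bounce both the incoming and the outgoing piece are available.\<close>

lemma curve_piece:
  assumes "time k \<le> s" "s \<le> time (k + 1)"
  shows "curve s = q (idx k) + (s - time k) *\<^sub>R e (idx k)"
proof -
  have c: "curve s = q (idx k) + (s - time k) *\<^sub>R e (idx k)" if "time k \<le> s" "s < time (k + 1)" for k
  proof -
    have "(THE k. time k \<le> s \<and> s < time (k + 1)) = k"
    proof (rule the_equality)
      fix i assume i: "time i \<le> s \<and> s < time (i + 1)"
      then have "i < k + 1" "k < i + 1" using that time_less_iff by (meson le_less_trans)+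
      then show "i = k" by simp
    qed (use that in simp)
    then show ?thesis by (simp add: curve_def)
  qed
  show ?thesis
  proof (cases "s < time (k + 1)")
    case False
    then have s: "s = time (k + 1)" using assms by simp
    have "curve s = q (idx (k + 1))" using c[of "k + 1"] time_less[of "k + 1" "k + 1 + 1"] by (simp add: s)
    then show ?thesis using edge[OF idx_less[of k]] time_Suc[of k] by (simp add: s idx_Suc)
  qed (use c assms in blast)
qed

lemma curve_time: "curve (time k) = q (idx k)"
  using curve_piece[of k "time k"] time_less[of k "k + 1"] by simp

lemma curve_interior:
  assumes "time k < s" "s < time (k + 1)"
  shows "curve s \<in> interior U"
proof -
  define \<theta> where "\<theta> = (s - time k) / len (idx k)"
  have l: "len (idx k) > 0" by (rule len_pos[OF idx_less])
  have \<theta>: "0 < \<theta>" "\<theta> < 1" using assms l time_Suc[of k] by (auto simp: \<theta>_def)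
  have "curve s = q (idx k) + \<theta> *\<^sub>R (q (nxt n (idx k)) - q (idx k))"
  proof -
    have "\<theta> *\<^sub>R (q (nxt n (idx k)) - q (idx k)) = (s - time k) *\<^sub>R e (idx k)"
      by (simp add: \<theta>_def len_def sgn_div_norm divide_inverse)
    then show ?thesis using curve_piece[of k s] assms by simp
  qed
  moreover have "q (idx k) + \<theta> *\<^sub>R (q (nxt n (idx k)) - q (idx k)) \<in> interior U"
    using S_subset_U q_in(3)[OF idx_less[of k]] q_in(3)[of "nxt n (idx k)"] q_in(4)[OF idx_less[of k]] n_pos \<theta>
    by (intro chord_interior) auto
  ultimately show ?thesis by simp
qed

lemma curve_cases:
  obtains k where "s = time k" | k where "time k < s" "s < time (k + 1)"
  using piece_exists[of s] by (metis less_eq_real_def)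

text \<open>Chords run in the interior of \<open>U\<close> between their end points.
  \<open>bounce_sequence\<close> asks for the exact set of times at which \<open>S\<close> is
  hit.\<close>

lemma curve_in_S_iff: "curve s \<in> S \<longleftrightarrow> (\<exists>k. s = time k)"
proof (cases s rule: curve_cases)
  case (1 k)
  then show ?thesis using curve_time[of k] q_in(3)[OF idx_less[of k]] by auto
next
  case (2 k)
  have "s \<noteq> time i" for i
  proof
    assume "s = time i"
    then have "k < i" "i < k + 1" using 2 time_less_iff by auto
    then show False by simp
  qed
  then show ?thesis using curve_interior[OF 2] in_interior_iff by auto
qed

lemma curve_periodic: "curve (s + tm n) = curve s"
proof -
  obtain k where k: "time k \<le> s" "s < time (k + 1)" using piece_exists by blast
  have "curve (s + tm n) = q (idx (k + int n)) + (s + tm n - time (k + int n)) *\<^sub>R e (idx (k + int n))"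
    using k time_shift(1)[of k] time_shift(1)[of "k + 1"]
    by (intro curve_piece) (simp_all add: add.assoc add.commute[of 1] add.left_commute[of 1])
  then show ?thesis using curve_piece[of k s] k by (simp add: time_shift)
qed

lemma curve_trajectory: "periodic_billiard_trajectory U (tm n) curve"
  unfolding periodic_billiard_trajectory_def
proof (intro conjI allI)
  show "tm n > 0" by (rule tm_n_pos)
  show "curve (s + tm n) = curve s" for s by (rule curve_periodic)
  have in_U: "curve s \<in> U" for s
    using curve_cases[of s] curve_interior interior_subset[of U] curve_time q_in(3)[OF idx_less] S_subset_U
    by (metis subsetD)
  then show "range curve \<subseteq> U" by auto
  have unit: "norm (e (idx k)) = 1" for k using q_in(4)[OF idx_less] by (simp add: norm_sgn)
  show "\<exists>speed>0. \<forall>t. \<exists>v v' r. r > 0 \<and> norm v = speed \<and> norm v' = speed \<and>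
        (\<forall>h\<in>{0..r}. curve (t - h) = curve t - h *\<^sub>R v) \<and>
        (\<forall>h\<in>{0..r}. curve (t + h) = curve t + h *\<^sub>R v') \<and>
        (if curve t \<in> frontier U then reflection_law (outer_normal U (curve t)) v v' else v' = v)"
  proof (intro exI[of _ 1] conjI allI)
    fix s
    show "\<exists>v v' r. r > 0 \<and> norm v = 1 \<and> norm v' = 1 \<and>
        (\<forall>h\<in>{0..r}. curve (s - h) = curve s - h *\<^sub>R v) \<and>
        (\<forall>h\<in>{0..r}. curve (s + h) = curve s + h *\<^sub>R v') \<and>
        (if curve s \<in> frontier U then reflection_law (outer_normal U (curve s)) v v' else v' = v)"
    proof (cases s rule: curve_cases)
      case (1 k)
      define r where "r = min (len (idx (k - 1))) (len (idx k))"
      have prev: "time k = time (k - 1) + len (idx (k - 1))" "idx k = nxt n (idx (k - 1))"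
        using time_Suc[of "k - 1"] idx_Suc[of "k - 1"] by auto
      have bounce: "curve s = q (idx k)" "curve s \<in> frontier U"
        using curve_time[of k] 1 q_in(3)[OF idx_less[of k]] S_def by auto
      have "curve (s - h) = curve s - h *\<^sub>R e (idx (k - 1))" if "h \<in> {0..r}" for h
        using curve_piece[of "k - 1" "s - h"] that edge[OF idx_less[of "k - 1"]] prev bounce 1
        by (auto simp: r_def algebra_simps)
      moreover have "curve (s + h) = curve s + h *\<^sub>R e (idx k)" if "h \<in> {0..r}" for h
        using curve_piece[of k "s + h"] that time_Suc[of k] bounce 1 by (auto simp: r_def)
      moreover have "r > 0" using len_pos[OF idx_less] by (simp add: r_def)
      moreover have "reflection_law (outer_normal U (curve s)) (e (idx (k - 1))) (e (idx k))"
        using reflection[OF idx_less[of k]] nxt_prv(4)[OF n idx_less[of "k - 1"]] prev(2) bounce(1) by simp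
      ultimately show ?thesis using unit bounce(2) by (intro exI[of _ "e (idx (k - 1))"] exI[of _ "e (idx k)"] exI[of _ r]) auto
    next
      case (2 k)
      define r where "r = min (s - time k) (time (k + 1) - s)"
      have "curve (s + h) = curve s + h *\<^sub>R e (idx k)" if "\<bar>h\<bar> \<le> r" for h
      proof -
        have c: "curve (s + h) = q (idx k) + (s + h - time k) *\<^sub>R e (idx k)" "curve s = q (idx k) + (s - time k) *\<^sub>R e (idx k)"
          by (rule curve_piece; use that 2 in \<open>auto simp: r_def\<close>)+
        show ?thesis unfolding c by (simp add: algebra_simps)
      qed
      then have "\<forall>h\<in>{0..r}. curve (s - h) = curve s - h *\<^sub>R e (idx k)"
        "\<forall>h\<in>{0..r}. curve (s + h) = curve s + h *\<^sub>R e (idx k)" by (force dest: spec[of _ "- _"])+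
      moreover have "r > 0" using 2 by (simp add: r_def)
      moreover have "curve s \<notin> frontier U" using curve_interior[OF 2] in_interior_iff S_def by auto
      ultimately show ?thesis using unit by (intro exI[of _ "e (idx k)"] exI[of _ r]) auto
    qed
  qed simp
qed

lemma curve_bounces: "bounce_sequence S (tm n) curve n q"
  unfolding bounce_sequence_def
proof (intro conjI exI[of _ "\<lambda>j. time (int j)"])
  show "q \<in> cyclic_config n S" by (rule q_in(1))
  show "strict_mono_on {..<n} (\<lambda>j. time (int j))" by (auto simp: strict_mono_on_def time_less)
  show "\<forall>j<n. q j = curve (time (int j))" by (simp add: curve_time time_nat(2))
  show "{s \<in> {time (int 0)..<time (int 0) + tm n}. curve s \<in> S} = (\<lambda>j. time (int j)) ` {..<n}"
  proof (intro equalityI subsetI)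
    fix s assume "s \<in> {s \<in> {time (int 0)..<time (int 0) + tm n}. curve s \<in> S}"
    then obtain k where k: "s = time k" "time 0 \<le> time k" "time k < time (int n)"
      using curve_in_S_iff time_n time_0 by auto
    then have "0 \<le> k" "k < int n" using time_le_iff time_less_iff by auto
    then show "s \<in> (\<lambda>j. time (int j)) ` {..<n}" using k(1) by (intro image_eqI[of _ _ "nat k"]) auto
  next
    fix s assume "s \<in> (\<lambda>j. time (int j)) ` {..<n}"
    then obtain j where j: "j < n" "s = time (int j)" by auto
    then have "time 0 \<le> s" "s < time (int n)" using time_le_iff time_less_iff by auto
    then show "s \<in> {s \<in> {time (int 0)..<time (int 0) + tm n}. curve s \<in> S}"
      using curve_in_S_iff j(2) time_n time_0 by auto
  qed
qed

end

context convex_table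
begin

lemma critical_config_exists:
  assumes "n \<ge> 3" "critical n q"
  shows "\<exists>W \<tau>. critical_config S U n q W \<tau>"
proof -
  have "q j \<in> S" if "j < n" for j
    using assms(2) that unfolding critical_def cyclic_config_def by (auto dest: PiE_mem)
  then have "\<forall>j. \<exists>W \<tau>. j < n \<longrightarrow> boundary_chart S U (q j) (normal (q j)) W \<tau>" using chart by meson
  then obtain W \<tau> where "\<And>j. j < n \<Longrightarrow> boundary_chart S U (q j) (normal (q j)) (W j) (\<tau> j)" by metis
  then have "critical_config S U n q W \<tau>"
    using assms by (intro critical_config.intro critical_config_axioms.intro convex_table_axioms)
  then show ?thesis by blast
qed

lemma critical_trajectory:
  assumes "n \<ge> 3" "critical n q"
  shows "\<exists>T \<gamma>. periodic_billiard_trajectory U T \<gamma> \<and> bounce_sequence S T \<gamma> n q"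
  using critical_config_exists[OF assms] critical_config.curve_trajectory critical_config.curve_bounces by blast

lemma critical_passable:
  assumes "n \<ge> 3" "critical n q" "morse_coindex n S q \<ge> 2"
  shows "passable (configs n) (length_functional n) (length_functional n q) q"
  using critical_config_exists[OF assms(1,2)] critical_config.passable_of_coindex assms(3) by blast

end


subsection \<open>Invariance of the average length\<close>

lemma sum_cyclic_shift: "(\<Sum>j<n. h (Suc j mod n)) = (\<Sum>j<n. h j :: real)"
proof (cases n)
  case (Suc m)
  have "(\<Sum>j<Suc m. h (Suc j mod Suc m)) = (\<Sum>j<m. h (Suc j)) + h 0" by simp
  then show ?thesis using Suc by (simp add: sum.lessThan_Suc_shift del: sum.lessThan_Suc)
qed simp

lemma sum_cyclic_rotate:
  fixes n k :: nat
  shows "(\<Sum>j<n. g ((k + j) mod n)) = (\<Sum>j<n. g j :: real)"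
proof (induction k)
  case (Suc k)
  have "(\<Sum>j<n. g ((Suc k + j) mod n)) = (\<Sum>j<n. (\<lambda>i. g ((k + i) mod n)) (Suc j mod n))"
    by (rule sum.cong) (auto simp: mod_simps)
  then show ?case using Suc sum_cyclic_shift[of "\<lambda>i. g ((k + i) mod n)" n] by simp
qed simp

lemma length_functional_restrict:
  "length_functional n (restrict r {..<n}) = (\<Sum>j<n. norm (r (Suc j mod n) - r j))"
  unfolding length_functional_def by (rule sum.cong) auto

lemma length_functional_dihedral:
  assumes "r \<in> dihedral_orbit n q"
  shows "length_functional n r = length_functional n q"
proof -
  define f where "f i = norm (q (Suc i mod n) - q i)" for i
  have L: "length_functional n q = (\<Sum>j<n. f j)" by (simp add: length_functional_def f_def)
  obtain k where "k < n" and
    r: "r = restrict (\<lambda>j. q ((k + j) mod n)) {..<n} \<or> r = restrict (\<lambda>j. q ((k + (n - j)) mod n)) {..<n}"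
    using assms unfolding dihedral_orbit_def by blast
  from r show ?thesis
  proof
    assume r: "r = restrict (\<lambda>j. q ((k + j) mod n)) {..<n}"
    have "length_functional n r = (\<Sum>j<n. f ((k + j) mod n))"
      unfolding r length_functional_restrict f_def by (rule sum.cong) (auto simp: mod_simps)
    then show ?thesis using sum_cyclic_rotate[where g = f] L by metis
  next
    assume r: "r = restrict (\<lambda>j. q ((k + (n - j)) mod n)) {..<n}"
    \<comment> \<open>A reflected sequence runs through the edges backwards: its edge from
      \<open>j\<close> to the next index is the edge of \<open>q\<close> that starts at the image of
      that next index, with opposite orientation.\<close>
    have edge: "norm (q ((k + (n - Suc j mod n)) mod n) - q ((k + (n - j)) mod n)) = f ((k + (n - Suc j mod n)) mod n)"
      if "j < n" for j
    proof -
      have "Suc ((k + (n - Suc j mod n)) mod n) mod n = (k + (n - j)) mod n"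
      proof (cases "Suc j < n")
        case True
        then show ?thesis by (simp add: mod_simps Suc_diff_Suc)
      next
        case False
        then have n: "n = Suc j" using that by simp
        then have s: "Suc j mod n = 0" "n - j = 1" by auto
        show ?thesis unfolding s by (simp add: mod_simps)
      qed
      then show ?thesis by (simp add: f_def norm_minus_commute)
    qed
    have "length_functional n r = (\<Sum>j<n. f ((k + (n - Suc j mod n)) mod n))"
      unfolding r length_functional_restrict using edge by (intro sum.cong) auto
    also have "\<dots> = (\<Sum>j<n. f ((k + (n - j)) mod n))"
      by (rule sum_cyclic_shift[where h = "\<lambda>j. f ((k + (n - j)) mod n)"])
    also have "\<dots> = (\<Sum>j<n. (\<lambda>i. f ((Suc k + i) mod n)) (n - Suc j))"
      by (rule sum.cong) (auto simp flip: Suc_diff_Suc)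
    also have "\<dots> = (\<Sum>i<n. f ((Suc k + i) mod n))" by (rule sum.nat_diff_reindex)
    finally show ?thesis using sum_cyclic_rotate[where g = f] L by metis
  qed
qed

lemma sum_mod_iterate: "(\<Sum>j<n * m. f (j mod n)) = real m * (\<Sum>j<n. f j)"
proof (induction m)
  case (Suc m)
  have add: "(\<Sum>j<a + b. g j) = (\<Sum>j<a. g j) + (\<Sum>j<b. g (a + j) :: real)" for a b :: nat and g
    by (induction b) auto
  have "(\<Sum>j<n * Suc m. f (j mod n)) = (\<Sum>j<n * m. f (j mod n)) + (\<Sum>j<n. f ((n * m + j) mod n))"
    using add[of "\<lambda>j. f (j mod n)" "n * m" n] by (simp add: add.commute)
  also have "(\<Sum>j<n. f ((n * m + j) mod n)) = (\<Sum>j<n. f j)" by (rule sum.cong) auto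
  finally show ?case using Suc by (simp add: algebra_simps)
qed simp

lemma length_functional_iterated:
  "length_functional (n * m) (iterated m n q) = real m * length_functional n q"
proof -
  have "length_functional (n * m) (iterated m n q) = (\<Sum>j<n * m. (\<lambda>i. norm (q (Suc i mod n) - q i)) (j mod n))"
    unfolding iterated_def length_functional_restrict
  proof (rule sum.cong[OF refl])
    fix j
    have "Suc j mod (n * m) mod n = Suc (j mod n) mod n" by (simp add: mod_mult2_eq mod_simps)
    then show "norm (q (Suc j mod (n * m) mod n) - q (j mod n)) = norm (q (Suc (j mod n) mod n) - q (j mod n))"
      by simp
  qed
  also have "\<dots> = real m * (\<Sum>j<n. norm (q (Suc j mod n) - q j))" by (rule sum_mod_iterate)
  finally show ?thesis by (simp add: length_functional_def)
qed

lemma geometrically_distinct_of_average: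
  assumes "n > 0" "n' > 0" "length_functional n q / n \<noteq> length_functional n' q' / n'"
  shows "geometrically_distinct n q n' q'"
  unfolding geometrically_distinct_def
proof (rule notI, elim exE conjE)
  fix m m' assume m: "1 \<le> m" "1 \<le> m'" "n * m = n' * m'"
    "iterated m' n' q' \<in> dihedral_orbit (n * m) (iterated m n q)"
  have "real m' * length_functional n' q' = real m * length_functional n q"
    using length_functional_dihedral[OF m(4)] m(3) length_functional_iterated by metis
  moreover have "real n * real m = real n' * real m'" using m(3) by (metis of_nat_mult)
  ultimately have "length_functional n q * real n' * (real m * real m') = length_functional n' q' * real n * (real m * real m')"
    by (metis mult.assoc mult.commute)
  then have "length_functional n q * real n' = length_functional n' q' * real n" using m(1,2) by simp
  then show False using assms by (simp add: field_simps)
qed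

lemma finite_dihedral_orbit: "finite (dihedral_orbit n q)"
  unfolding dihedral_orbit_def by simp

lemma in_dihedral_orbit: "n > 0 \<Longrightarrow> q \<in> extensional {..<n} \<Longrightarrow> q \<in> dihedral_orbit n q"
  unfolding dihedral_orbit_def
  by (rule UnI1, rule CollectI, rule exI[of _ 0]) (auto simp: fun_eq_iff extensional_def)

text \<open>Alternative (A) counts trajectories up to the dihedral group. As orbits are finite,
  finitely many of them contain only finitely many bounce sequences.\<close>

lemma finite_of_finite_orbits:
  assumes "n > 0" "A \<subseteq> extensional {..<n}" "finite (dihedral_orbit n ` A)"
  shows "finite A"
proof (rule finite_subset)
  show "A \<subseteq> \<Union> (dihedral_orbit n ` A)" using in_dihedral_orbit[OF assms(1)] assms(2) by blast
  show "finite (\<Union> (dihedral_orbit n ` A))" using assms(3) finite_dihedral_orbit by blast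
qed

subsection \<open>Existence of mountain pass trajectories\<close>

context convex_table
begin

lemma passable_or_critical:
  assumes dim: "DIM('a) \<ge> 3" and n: "n \<ge> 3" and q: "q \<in> configs n" "length_functional n q \<noteq> 0"
    and nc: "\<not> critical n q"
  shows "passable (configs n) (length_functional n) (length_functional n q) q"
proof (cases "\<exists>i<n. q (nxt n i) = q i")
  case True
  then obtain j where "j < n" "q (nxt n j) = q j" "q (prv n j) \<noteq> q j"
    using collision_index[OF n q(2)] by metis
  then show ?thesis using passable_collision[OF n _ q(1) _ _ dim] by blast
next
  case False
  then have "q \<in> cyclic_config n S" using q(1) by (auto simp: cyclic_config_def eq_commute)
  then obtain j v where jv: "j < n" "normal (q j) \<bullet> v = 0"
      "(sgn (q j - q (prv n j)) - sgn (q (nxt n j) - q j)) \<bullet> v \<noteq> 0"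
    using nc unfolding critical_def by blast
  have "q j \<noteq> q (prv n j)" using False nxt_prv(2,3)[OF n jv(1)] by metis
  then show ?thesis using passable_noncritical[OF n jv(1) q(1) _ _ jv(2,3)] False jv(1) by blast
qed

text \<open>A compact convex set is the convex hull of its frontier, so a frontier with at most one
  point would leave no interior.\<close>

lemma boundary_two_points: "\<exists>a\<in>S. \<exists>b\<in>S. a \<noteq> b"
proof (rule ccontr)
  assume "\<not> ?thesis"
  then have sub: "S \<subseteq> {a}" if "a \<in> S" for a using that by blast
  have "U = convex hull S"
    using Krein_Milman_frontier[OF convex_U compact_U] S_def by simp
  moreover have "finite (convex hull S)"
  proof (cases "S = {}")
    case False
    then obtain a where "a \<in> S" by blast
    then show ?thesis using hull_mono[OF sub, of a convex] by (auto intro: finite_subset)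
  qed simp
  ultimately have "finite U" by simp
  then have "interior U = {}" by (rule empty_interior_finite)
  then show False using int_ne by simp
qed

lemma diameter_attained:
  obtains X Y where "X \<in> S" "Y \<in> S" "X \<noteq> Y" "\<And>a b. a \<in> S \<Longrightarrow> b \<in> S \<Longrightarrow> norm (b - a) \<le> norm (Y - X)"
proof -
  obtain a b where ab: "a \<in> S" "b \<in> S" "a \<noteq> b" using boundary_two_points by blast
  have c: "compact (S \<times> S)" "S \<times> S \<noteq> {}" using compact_S ab by (auto intro: compact_Times)
  have "continuous_on (S \<times> S) (\<lambda>p. norm (snd p - fst p))" by (intro continuous_intros)
  from continuous_attains_sup[OF c this]
  obtain p where p: "p \<in> S \<times> S" "\<And>p'. p' \<in> S \<times> S \<Longrightarrow> norm (snd p' - fst p') \<le> norm (snd p - fst p)"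
    by blast
  have "norm (b - a) \<le> norm (snd p - fst p)" using p(2)[of "(a, b)"] ab by auto
  moreover have "norm (b - a) > 0" using ab by simp
  ultimately have "fst p \<noteq> snd p" by auto
  then show thesis using that[of "fst p" "snd p"] p by force
qed

text \<open>The points of \<open>x\<close> are moved one after the other; at any time at most three edges are shorter
  than in \<open>x\<close>.\<close>

lemma connect_to_oscillation:
  assumes dim: "DIM('a) \<ge> 2" and n: "n \<ge> 3" and XY: "X \<in> S" "Y \<in> S"
    and D: "\<And>a b. a \<in> S \<Longrightarrow> b \<in> S \<Longrightarrow> norm (b - a) \<le> D" "norm (Y - X) = D" "D > 0"
    and x: "x \<in> configs n" "length_functional n x \<ge> (real n - 1) * D"
  shows "path_component {y \<in> configs n. length_functional n y > (real n - 5) * D} x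
    (\<lambda>j. if j < n then if even j then X else Y else undefined)"
proof -
  let ?Q = "{y \<in> configs n. length_functional n y > (real n - 5) * D}"
  define z where "z j = (if even j then X else Y)" for j :: nat
  define mix where "mix i = (\<lambda>j. if j < n then if j < i then z j else x j else undefined)" for i
  have z_S: "z j \<in> S" for j using XY by (simp add: z_def)
  have x_S: "x j \<in> S" if "j < n" for j by (rule PiE_mem[OF x(1)]) (use that in simp)
  have z_edge: "norm (z (Suc j) - z j) = D" for j using D(2) by (simp add: z_def norm_minus_commute)
  have mix_S: "mix i j \<in> S" if "j < n" for i j using z_S x_S that by (simp add: mix_def)
  have step: "(mix i)(i := p) \<in> ?Q" if i: "i < n" and p: "p \<in> S" for i p
  proof -
    define y where "y = (mix i)(i := p)"
    have y: "y \<in> configs n" using mix_S i p by (auto simp: y_def PiE_iff extensional_def mix_def)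
    let ?E = "\<lambda>q j. norm (q (nxt n j) - q j)"
    \<comment> \<open>The two edges at the moving point \<open>i\<close> and the closing edge, which
      leads from an unmoved point to a moved one. The remaining edges before \<open>i\<close> have
      the maximal length \<open>D\<close>, those after \<open>i\<close> are unchanged. For
      \<open>i = 0\<close> truncated subtraction merges the first two indices, and the edge arriving
      at 0 is the closing one.\<close>
    define B where "B = {..<n} \<inter> {i - 1, i, n - 1}"
    have "card B \<le> card {i - 1, i, n - 1}" by (rule card_mono) (auto simp: B_def)
    also have "\<dots> \<le> 3" by (simp add: card_insert_if)
    finally have "card B \<le> 3" .
    have x_edge: "?E x j \<le> D" if "j < n" for j using D(1) x_S n that by simp
    have "(\<Sum>j\<in>B. ?E x j) \<le> real (card B) * D" using x_edge by (intro sum_bounded_above) (auto simp: B_def)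
    also have "\<dots> \<le> 3 * D" using \<open>card B \<le> 3\<close> D(3) by (intro mult_right_mono) auto
    finally have B3: "(\<Sum>j\<in>B. ?E x j) \<le> 3 * D" .
    have "length_functional n x = (\<Sum>j\<in>{..<n} - B. ?E x j) + (\<Sum>j\<in>B. ?E x j)"
      unfolding length_functional_def by (rule sum.subset_diff) (auto simp: B_def)
    also have "\<dots> \<le> (\<Sum>j\<in>{..<n} - B. ?E y j) + 3 * D"
    proof (rule add_mono[OF sum_mono B3])
      fix j assume "j \<in> {..<n} - B"
      then have j: "j < n" "j \<noteq> i" "j \<noteq> n - 1" "j \<noteq> i - 1" by (auto simp: B_def)
      then have s: "nxt n j = Suc j" "Suc j < n" by auto
      consider "Suc j < i" | "i < j" | "Suc j = i" using j(2) by linarith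
      then show "?E x j \<le> ?E y j"
      proof cases
        case 1
        then have "?E y j = D" using s j z_edge[of j] by (simp add: y_def mix_def)
        then show ?thesis using x_edge[OF j(1)] by simp
      qed (use s j in \<open>auto simp: y_def mix_def\<close>)
    qed
    also have "(\<Sum>j\<in>{..<n} - B. ?E y j) \<le> length_functional n y"
      unfolding length_functional_def by (intro sum_mono2) auto
    finally have "length_functional n y \<ge> (real n - 4) * D" using x(2) by (simp add: algebra_simps)
    then show ?thesis using y D(3) by (simp add: y_def[symmetric] algebra_simps)
  qed
  have "path_component ?Q (mix 0) (mix i)" if "i \<le> n" for i
    using that
  proof (induction i)
    case 0
    have "mix 0 = (mix 0)(0 := x 0)" using n by (auto simp: mix_def)
    then have "mix 0 \<in> ?Q" using step[of 0 "x 0"] x_S[of 0] n by simp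
    then show ?case by (rule path_component_refl)
  next
    case (Suc i)
    then have i: "i < n" by simp
    have "path_component S (x i) (z i)"
      using path_connected_S dim x_S[OF i] z_S by (simp add: path_connected_component)
    then obtain g where g: "path g" "path_image g \<subseteq> S" "pathstart g = x i" "pathfinish g = z i"
      unfolding path_component_def by blast
    define h where "h t = (mix i)(i := g t)" for t
    have "continuous_on {0..1} (\<lambda>t. h t j)" for j
      using g(1) by (cases "j = i") (auto simp: h_def path_def)
    then have "path h" unfolding path_def by (rule continuous_on_coordinatewise_then_product)
    moreover have "path_image h \<subseteq> ?Q"
      unfolding path_image_def h_def using step[OF i] g(2) by (auto simp only: path_image_def image_subset_iff)
    moreover have "pathstart h = mix i" "pathfinish h = mix (Suc i)"
      using g(3,4) i by (auto simp: pathstart_def pathfinish_def h_def mix_def fun_eq_iff)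
    ultimately have "path_component ?Q (mix i) (mix (Suc i))"
      unfolding path_component_def by blast
    then show ?case using Suc by (auto intro: path_component_trans)
  qed
  moreover have "mix 0 = x" using PiE_arb[OF x(1)] by (auto simp: mix_def fun_eq_iff)
  moreover have "mix n = (\<lambda>j. if j < n then if even j then X else Y else undefined)"
    by (auto simp: mix_def z_def fun_eq_iff)
  ultimately show ?thesis by (metis order_refl)
qed

lemma mountain_pass_critical:
  assumes dim: "DIM('a) \<ge> 3" and n: "n \<ge> 5" and XY: "X \<in> S" "Y \<in> S"
    and D: "\<And>a b. a \<in> S \<Longrightarrow> b \<in> S \<Longrightarrow> norm (b - a) \<le> D" "norm (Y - X) = D" "D > 0"
    and fin: "finite {q. critical n q}"
  shows "\<exists>q. critical n q \<and> morse_coindex n S q \<le> 1 \<and> \<not> length_local_max n S q \<and>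
    (real n - 5) * D < length_functional n q \<and> length_functional n q < real n * D"
proof -
  let ?L = "length_functional n"
  let ?c = "(real n - 5) * D"
  have n3: "n \<ge> 3" using n by simp
  have c0: "?c \<ge> 0" using n D(3) by simp
  define z where "z = (\<lambda>j. if j < n then if even j then X else Y else undefined)"
  have z: "z \<in> configs n" using XY by (auto simp: z_def PiE_iff extensional_def)
  \<comment> \<open>For odd \<open>n\<close> the closing edge joins \<open>X\<close> to itself, so
    only \<open>n - 1\<close> edges are counted.\<close>
  have Lz: "?L z \<ge> (real n - 1) * D"
  proof -
    have "(real n - 1) * D = (\<Sum>j<n - 1. D)" using n by (simp add: of_nat_diff)
    also have "\<dots> = (\<Sum>j<n - 1. norm (z (nxt n j) - z j))"
      using D(2) by (intro sum.cong) (auto simp: z_def norm_minus_commute)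
    also have "\<dots> \<le> ?L z" unfolding length_functional_def by (intro sum_mono2) auto
    finally show ?thesis .
  qed
  obtain x where x: "x \<in> configs n" "\<And>y. y \<in> configs n \<Longrightarrow> ?L y \<le> ?L x"
  proof -
    have "configs n \<noteq> {}" using z by blast
    from continuous_attains_sup[OF compact_configs this continuous_on_length[of _ n]] show thesis
      using that by blast
  qed
  have Lx: "?L x \<ge> (real n - 1) * D" using x(2)[OF z] Lz by simp
  \<comment> \<open>The cyclic shift is a second maximum; it is different from \<open>x\<close>
    because a shift invariant configuration has length 0.\<close>
  define x' where "x' = (\<lambda>j. if j < n then x (nxt n j) else undefined)"
  have nx: "nxt n j < n" for j using n by simp
  have x': "x' \<in> configs n" using PiE_mem[OF x(1)] nx by (auto simp: x'_def PiE_iff extensional_def)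
  have Lx': "?L x' = ?L x"
  proof -
    have "?L x' = (\<Sum>j<n. (\<lambda>i. norm (x (nxt n i) - x i)) (nxt n j))"
      unfolding length_functional_def using nx by (intro sum.cong) (auto simp: x'_def)
    also have "\<dots> = ?L x" unfolding length_functional_def
      by (rule sum_cyclic_shift[where h = "\<lambda>i. norm (x (nxt n i) - x i)"])
    finally show ?thesis .
  qed
  have "x \<noteq> x'"
  proof
    assume "x = x'"
    then have "x (nxt n j) = x j" if "j < n" for j using that by (metis x'_def)
    then have "?L x = 0" by (simp add: length_functional_def)
    moreover have "(real n - 1) * D > 0" using n D(3) by simp
    ultimately show False using Lx by simp
  qed
  have conn: "path_component {y \<in> configs n. ?L y > ?c} y z" if "y \<in> configs n" "?L y \<ge> (real n - 1) * D" for y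
    unfolding z_def using connect_to_oscillation[OF _ n3 XY D that] dim by simp
  have path: "path_component {y \<in> configs n. ?L y > ?c} x x'"
  proof (rule path_component_trans[OF conn[OF x(1) Lx] path_component_sym])
    show "path_component {y \<in> configs n. ?L y > ?c} x' z" by (rule conn[OF x']) (use Lx Lx' in simp)
  qed
  obtain q where q: "q \<in> {q. critical n q}" "q \<in> configs n" "?L q > ?c" "\<not> passable (configs n) ?L (?L q) q"
    and up: "\<And>G. open G \<Longrightarrow> q \<in> G \<Longrightarrow> \<exists>y\<in>configs n \<inter> G. ?L y > ?L q"
  proof (rule mountain_pass[OF compact_configs weakly_lpc_configs continuous_on_length x(1) x' \<open>x \<noteq> x'\<close> x(2) Lx' path fin])
    show "passable (configs n) ?L (?L y) y" if "y \<in> configs n" "y \<notin> {q. critical n q}" "?L y > ?c" for y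
      using passable_or_critical[OF dim n3 that(1)] that c0 by auto
  qed (use that in auto)
  have crit: "critical n q" using q(1) by simp
  have "morse_coindex n S q \<le> 1" using critical_passable[OF n3 crit] q(4) by force
  \<comment> \<open>\<open>length_local_max\<close> compares only with configurations free of
    collisions, whereas the mountain pass yields longer ones in the full product. Close to
    \<open>q\<close> there are no collisions, so these count.\<close>
  moreover have "\<not> length_local_max n S q"
  proof
    assume "length_local_max n S q"
    then obtain r where r: "r > 0"
      "\<And>y. y \<in> cyclic_config n S \<Longrightarrow> (\<forall>j<n. dist (y j) (q j) < r) \<Longrightarrow> ?L y \<le> ?L q"
      unfolding length_local_max_def by blast
    have ne: "q (nxt n j) \<noteq> q j" if "j < n" for j
      using crit that unfolding critical_def cyclic_config_def by force
    have "\<forall>\<^sub>F y in nhds q. \<forall>j\<in>{..<n}. dist (y j) (q j) < r \<and> y (nxt n j) \<noteq> y j"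
    proof (rule eventually_ball_finite[OF finite_lessThan], rule ballI, rule eventually_conj)
      fix j assume j: "j \<in> {..<n}"
      have "\<forall>\<^sub>F y in nhds q. y j \<in> ball (q j) r"
        by (rule isCont_eventually_in_open[OF isCont_coordinate]) (use r(1) in auto)
      then show "\<forall>\<^sub>F y in nhds q. dist (y j) (q j) < r" by (simp add: dist_commute)
      have "\<forall>\<^sub>F y in nhds q. y (nxt n j) - y j \<in> - {0}"
        by (rule isCont_eventually_in_open) (use ne j in \<open>auto intro!: continuous_intros isCont_coordinate\<close>)
      then show "\<forall>\<^sub>F y in nhds q. y (nxt n j) \<noteq> y j" by simp
    qed
    then obtain G where G: "open G" "q \<in> G" "\<And>y. y \<in> G \<Longrightarrow> \<forall>j\<in>{..<n}. dist (y j) (q j) < r \<and> y (nxt n j) \<noteq> y j"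
      unfolding eventually_nhds by blast
    obtain y where y: "y \<in> configs n" "y \<in> G" "?L y > ?L q" using up[OF G(1,2)] by blast
    have "y \<in> cyclic_config n S" using y(1) G(3)[OF y(2)] by (force simp: cyclic_config_def)
    then show False using r(2)[of y] G(3)[OF y(2)] y(3) by force
  qed
  \<comment> \<open>Strict, because some configuration is longer than \<open>q\<close>, and its
    edges have length at most \<open>D\<close>.\<close>
  moreover have "?L q < real n * D"
  proof -
    obtain y where y: "y \<in> configs n" "?L y > ?L q" using up[of UNIV] by auto
    have "?L y \<le> (\<Sum>j<n. D)"
      unfolding length_functional_def using PiE_mem[OF y(1)] nx by (intro sum_mono D(1)) auto
    then show ?thesis using y(2) by simp
  qed
  ultimately show ?thesis using crit q(3) by blast
qed

end

theorem theorem1p1: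
  fixes N p :: nat
    and S U :: "'a::euclidean_space set"
  assumes "N \<ge> 2"
    and "DIM('a) = N + 1"
    and "smooth_hypersurface S"
    and "encloses S U"
    and "strictly_convex U"
    and "prime p"
  shows
    "(\<exists>n\<ge>1. infinite (dihedral_orbit (p ^ n) ` billiard_bounces S U (p ^ n)))
     \<or>
     (\<exists>(T :: nat \<Rightarrow> real) (\<gamma> :: nat \<Rightarrow> real \<Rightarrow> 'a) (n :: nat \<Rightarrow> nat) (q :: nat \<Rightarrow> nat \<Rightarrow> 'a).
        (\<forall>\<alpha>. n \<alpha> \<ge> 1 \<and> periodic_billiard_trajectory U (T \<alpha>) (\<gamma> \<alpha>) \<and>
             bounce_sequence S (T \<alpha>) (\<gamma> \<alpha>) (p ^ n \<alpha>) (q \<alpha>)) \<and>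
        (\<forall>\<alpha> \<beta>. \<alpha> \<noteq> \<beta> \<longrightarrow> geometrically_distinct (p ^ n \<alpha>) (q \<alpha>) (p ^ n \<beta>) (q \<beta>)) \<and>
        (\<forall>\<alpha>. morse_coindex (p ^ n \<alpha>) S (q \<alpha>) \<le> N \<and>
             \<not> length_local_max (p ^ n \<alpha>) S (q \<alpha>)))"
proof (cases "\<exists>n\<ge>1. infinite (dihedral_orbit (p ^ n) ` billiard_bounces S U (p ^ n))")
  case False
  interpret convex_table S U using assms by unfold_locales
  have dim: "DIM('a) \<ge> 3" using assms by simp
  have p2: "p \<ge> 2" using assms by (simp add: prime_ge_2_nat)
  have big: "p ^ k > k" for k
    using power_mono[OF p2, of k] less_exp[of k] by (meson le0 less_le_trans)
  obtain X Y where XY: "X \<in> S" "Y \<in> S" "X \<noteq> Y" "\<And>a b. a \<in> S \<Longrightarrow> b \<in> S \<Longrightarrow> norm (b - a) \<le> norm (Y - X)"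
    by (rule diameter_attained) (rule that)
  define D where "D = norm (Y - X)"
  have "D > 0" using XY by (simp add: D_def)
  have "\<exists>q. critical (p ^ k) q \<and> morse_coindex (p ^ k) S q \<le> 1 \<and> \<not> length_local_max (p ^ k) S q \<and>
      (real (p ^ k) - 5) * D < length_functional (p ^ k) q \<and> length_functional (p ^ k) q < real (p ^ k) * D"
    if k: "k \<ge> 5" for k
  proof (rule mountain_pass_critical[OF dim _ XY(1,2)])
    have n: "p ^ k \<ge> 5" using big[of k] k by simp
    then show "p ^ k \<ge> 5" .
    have "{q. critical (p ^ k) q} \<subseteq> billiard_bounces S U (p ^ k)"
      using critical_trajectory[of "p ^ k"] n unfolding billiard_bounces_def by auto
    moreover have "finite (billiard_bounces S U (p ^ k))"
    proof (rule finite_of_finite_orbits)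
      show "p ^ k > 0" using p2 by simp
      show "billiard_bounces S U (p ^ k) \<subseteq> extensional {..<p ^ k}"
        unfolding billiard_bounces_def bounce_sequence_def cyclic_config_def PiE_def by blast
      show "finite (dihedral_orbit (p ^ k) ` billiard_bounces S U (p ^ k))"
        using False k by (meson le_trans one_le_numeral)
    qed
    ultimately show "finite {q. critical (p ^ k) q}" by (rule finite_subset)
  qed (use XY \<open>D > 0\<close> in \<open>auto simp: D_def\<close>)
  then obtain Q where Q: "\<And>k. k \<ge> 5 \<Longrightarrow> critical (p ^ k) (Q k) \<and> morse_coindex (p ^ k) S (Q k) \<le> 1 \<and>
      \<not> length_local_max (p ^ k) S (Q k) \<and> (real (p ^ k) - 5) * D < length_functional (p ^ k) (Q k) \<and>
      length_functional (p ^ k) (Q k) < real (p ^ k) * D" by metis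
  define avg where "avg k = length_functional (p ^ k) (Q k) / real (p ^ k)" for k
  have ppos: "real (p ^ k) > 0" for k using p2 by simp
  have avg_lt: "avg k < D" if "k \<ge> 5" for k
    using Q[OF that] ppos[of k] by (simp add: avg_def pos_divide_less_eq mult.commute del: of_nat_power)
  \<comment> \<open>The bound \<open>p ^ k > k\<close> is crude but gives a lower estimate that
    tends to \<open>D\<close> as \<open>k\<close> grows.\<close>
  have avg_gt: "avg k > D - 5 * D / real k" if "k \<ge> 5" for k
  proof -
    have "5 * D / real (p ^ k) \<le> 5 * D / real k"
      using big[of k] that \<open>D > 0\<close> by (intro divide_left_mono mult_pos_pos ppos) (auto simp del: of_nat_power)
    moreover have "avg k > (real (p ^ k) - 5) * D / real (p ^ k)"
      unfolding avg_def using Q[OF that] ppos[of k] by (intro divide_strict_right_mono) auto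
    moreover have "(real (p ^ k) - 5) * D / real (p ^ k) = D - 5 * D / real (p ^ k)"
      using ppos[of k] by (simp add: field_simps del: of_nat_power)
    ultimately show ?thesis by linarith
  qed
  have next_k: "\<exists>k'. k' \<ge> 5 \<and> avg k < avg k'" if "k \<ge> 5" for k
  proof -
    have pos: "D - avg k > 0" using avg_lt[OF that] by simp
    obtain m where m: "real m > 5 * D / (D - avg k)" using reals_Archimedean2 by blast
    define k' where "k' = max m 5"
    have "real k' > 5 * D / (D - avg k)" "k' \<ge> 5" using m by (auto simp: k'_def)
    then have "5 * D / real k' < D - avg k" using pos by (simp add: field_simps)
    then show ?thesis using avg_gt[OF \<open>k' \<ge> 5\<close>] \<open>k' \<ge> 5\<close> by (intro exI[of _ k']) auto
  qed
  obtain f where f: "\<And>i. f i \<ge> 5" "\<And>i. avg (f i) < avg (f (Suc i))"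
    using dependent_nat_choice[of "\<lambda>_ k. k \<ge> 5" "\<lambda>_ k k'. avg k < avg k'"] next_k by blast
  have mono: "strict_mono (\<lambda>i. avg (f i))" using f(2) by (simp add: strict_mono_Suc_iff)
  have "\<exists>T \<gamma>. periodic_billiard_trajectory U T \<gamma> \<and> bounce_sequence S T \<gamma> (p ^ f i) (Q (f i))" for i
    using critical_trajectory[of "p ^ f i" "Q (f i)"] Q[OF f(1)[of i]] big[of "f i"] f(1)[of i] by simp
  then obtain T \<gamma> where T: "\<And>i. periodic_billiard_trajectory U (T i) (\<gamma> i) \<and> bounce_sequence S (T i) (\<gamma> i) (p ^ f i) (Q (f i))"
    by metis
  have distinct: "geometrically_distinct (p ^ f i) (Q (f i)) (p ^ f j) (Q (f j))" if "i \<noteq> j" for i j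
  proof (rule geometrically_distinct_of_average)
    show "p ^ f i > 0" "p ^ f j > 0" using p2 by auto
    have "avg (f i) \<noteq> avg (f j)" using that strict_mono_eq[OF mono] by simp
    then show "length_functional (p ^ f i) (Q (f i)) / real (p ^ f i) \<noteq> length_functional (p ^ f j) (Q (f j)) / real (p ^ f j)"
      by (simp add: avg_def)
  qed
  have "f i \<ge> 1" "morse_coindex (p ^ f i) S (Q (f i)) \<le> N" "\<not> length_local_max (p ^ f i) S (Q (f i))" for i
    using f(1)[of i] Q[OF f(1)[of i]] assms(1) by auto
  then show ?thesis using T distinct
    by (intro disjI2 exI[of _ T] exI[of _ \<gamma>] exI[of _ f] exI[of _ "\<lambda>i. Q (f i)"]) blast
qed simp

end
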